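(* Let $q$ be a power of $2$ and let $H=\mathbb{F}_{q^2}(x,y)$ be the Hermitian function field over $\mathbb{F}_{q^2}$, defined by $y^q+y=x^{q+1}$. Let $m$ be a positive divisor of $q^2-1$ and let $b\in\mathbb{F}_{q^2}^*$ be an element of order $m$. Let $\lambda,\omega$ be the $\mathbb{F}_{q^2}$-automorphisms of $H$ given by $\lambda(x)=bx$, $\lambda(y)=b^{q+1}y$ and $\omega(x)=x/y$, $\omega(y)=1/y$, and let $\mathcal G=\langle\lambda,\omega\rangle$. Let $d=\gcd(m,q+1)$ and $\tilde d=\gcd(m,q-1)$. Then the genus of the fixed field $H^{\mathcal G}$ is $$g(H^{\mathcal G})=\frac{q^2-q+m-(d-1)(q-1)-\tilde{d}(q+1)}{4m}.$$
   Context: $H^{\mathcal G}$ denotes the subfield of $H$ fixed by every element of $\mathcal G$, regarded as a function field over $\mathbb{F}_{q^2}$. *)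

theory Defs
  imports
    "HOL-Computational_Algebra.Polynomial"
    "HOL-Algebra.Generated_Groups"
    "HOL.Real"
begin

text \<open>
  A field extension \<open>H/K\<close> is given by an embedding \<open>\<iota> :: 'k \<Rightarrow> 'h\<close> of the base field into the
  type \<open>'h\<close>; intermediate fields \<open>F\<close> are subsets of \<open>'h\<close>. The theory of function fields follows
  Stichtenoth, Algebraic Function Fields and Codes, Chapter 1.
\<close>

definition field_hom :: "('a::field \<Rightarrow> 'b::field) \<Rightarrow> bool" where
  "field_hom f \<longleftrightarrow> f 1 = 1 \<and> (\<forall>a b. f (a + b) = f a + f b) \<and> (\<forall>a b. f (a * b) = f a * f b)"

definition is_subfield :: "'h::field set \<Rightarrow> bool" where
  "is_subfield F \<longleftrightarrow> 1 \<in> F \<and> (\<forall>a\<in>F. \<forall>b\<in>F. a - b \<in> F \<and> a * b \<in> F) \<and> (\<forall>a\<in>F. inverse a \<in> F)"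

definition transcendental_over :: "('k::field \<Rightarrow> 'h::field) \<Rightarrow> 'h \<Rightarrow> bool" where
  "transcendental_over \<iota> x \<longleftrightarrow> (\<forall>p. p \<noteq> 0 \<longrightarrow> poly (map_poly \<iota> p) x \<noteq> 0)"

definition adjoin :: "('k::field \<Rightarrow> 'h::field) \<Rightarrow> 'h set \<Rightarrow> 'h set" where
  "adjoin \<iota> S = \<Inter>{F. is_subfield F \<and> range \<iota> \<subseteq> F \<and> S \<subseteq> F}"

text \<open>
  Since \<open>T^q + T - x^(q+1)\<close> is irreducible over \<open>K(x)\<close> when \<open>K\<close> has \<open>q^2\<close> elements and \<open>x\<close> is
  transcendental, the conditions below determine \<open>(H, x, y)\<close> up to isomorphism over \<open>K\<close>.
\<close>

definition hermitian_function_field ::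
    "nat \<Rightarrow> ('k::field \<Rightarrow> 'h::field) \<Rightarrow> 'h \<Rightarrow> 'h \<Rightarrow> bool" where
  "hermitian_function_field q \<iota> x y \<longleftrightarrow>
     card (UNIV :: 'k set) = q^2 \<and> field_hom \<iota> \<and> transcendental_over \<iota> x \<and>
     y ^ q + y = x ^ (q + 1) \<and> adjoin \<iota> {x, y} = UNIV"

definition aut_group :: "('k::field \<Rightarrow> 'h::field) \<Rightarrow> ('h \<Rightarrow> 'h) monoid" where
  "aut_group \<iota> = \<lparr>carrier = {\<sigma>. bij \<sigma> \<and> field_hom \<sigma> \<and> (\<forall>c. \<sigma> (\<iota> c) = \<iota> c)},
                 mult = (\<circ>), one = id\<rparr>"

definition fixed_field :: "('h \<Rightarrow> 'h) set \<Rightarrow> 'h set" where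
  "fixed_field G = {z. \<forall>\<sigma>\<in>G. \<sigma> z = z}"

text \<open>A place of \<open>F/K\<close> is represented throughout by its valuation ring, whose unique maximal ideal
  is the place itself.\<close>

definition valuation_ring :: "('k::field \<Rightarrow> 'h::field) \<Rightarrow> 'h set \<Rightarrow> 'h set \<Rightarrow> bool" where
  "valuation_ring \<iota> F V \<longleftrightarrow> range \<iota> \<subset> V \<and> V \<subset> F \<and>
     (\<forall>a\<in>V. \<forall>b\<in>V. a - b \<in> V \<and> a * b \<in> V) \<and> (\<forall>z\<in>F. z \<in> V \<or> inverse z \<in> V)"

definition max_ideal :: "'h::field set \<Rightarrow> 'h set" where
  "max_ideal V = {z\<in>V. z = 0 \<or> inverse z \<notin> V}"

text \<open>Here \<open>t\<close> ranges over the prime elements (generators of the maximal ideal); the value does not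
  depend on \<open>t\<close>. Only meaningful for \<open>z \<noteq> 0\<close>.\<close>

definition val :: "'h::field set \<Rightarrow> 'h \<Rightarrow> int" where
  "val V z = (THE n. \<exists>t u. max_ideal V = {t * v | v. v \<in> V} \<and>
       u \<in> V - max_ideal V \<and> z = t powi n * u)"

text \<open>The classes of the elements of \<open>B\<close> are distinct and form a \<open>K\<close>-basis of the residue class
  field \<open>V / max_ideal V\<close>.\<close>

definition residue_basis :: "('k::field \<Rightarrow> 'h::field) \<Rightarrow> 'h set \<Rightarrow> 'h set \<Rightarrow> bool" where
  "residue_basis \<iota> V B \<longleftrightarrow> finite B \<and> B \<subseteq> V \<and>
     (\<forall>z\<in>V. \<exists>!c. (\<forall>b. b \<notin> B \<longrightarrow> c b = 0) \<and> z - (\<Sum>b\<in>B. \<iota> (c b) * b) \<in> max_ideal V)"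

definition residue_degree :: "('k::field \<Rightarrow> 'h::field) \<Rightarrow> 'h set \<Rightarrow> nat" where
  "residue_degree \<iota> V = (THE d. \<exists>B. residue_basis \<iota> V B \<and> card B = d)"

definition divisors :: "('k::field \<Rightarrow> 'h::field) \<Rightarrow> 'h set \<Rightarrow> ('h set \<Rightarrow> int) set" where
  "divisors \<iota> F = {A. finite {V. A V \<noteq> 0} \<and> (\<forall>V. A V \<noteq> 0 \<longrightarrow> valuation_ring \<iota> F V)}"

definition divisor_degree :: "('k::field \<Rightarrow> 'h::field) \<Rightarrow> ('h set \<Rightarrow> int) \<Rightarrow> int" where
  "divisor_degree \<iota> A = (\<Sum>V | A V \<noteq> 0. A V * int (residue_degree \<iota> V))"

definition riemann_roch_space ::
    "('k::field \<Rightarrow> 'h::field) \<Rightarrow> 'h set \<Rightarrow> ('h set \<Rightarrow> int) \<Rightarrow> 'h set" where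
  "riemann_roch_space \<iota> F A = {z\<in>F. z = 0 \<or> (\<forall>V. valuation_ring \<iota> F V \<longrightarrow> val V z \<ge> - A V)}"

definition ell :: "('k::field \<Rightarrow> 'h::field) \<Rightarrow> 'h set \<Rightarrow> ('h set \<Rightarrow> int) \<Rightarrow> nat" where
  "ell \<iota> F A = vector_space.dim (\<lambda>c z. \<iota> c * z) (riemann_roch_space \<iota> F A)"

text \<open>The genus \<open>max {deg A - ell A + 1}\<close> of \<open>F\<close> as a function field over \<open>K\<close>, for \<open>K\<close> the full
  constant field of \<open>F\<close>; unspecified if no maximum exists.\<close>

definition genus :: "('k::field \<Rightarrow> 'h::field) \<Rightarrow> 'h set \<Rightarrow> int" where
  "genus \<iota> F = (GREATEST g. \<exists>A\<in>divisors \<iota> F. g = divisor_degree \<iota> A - int (ell \<iota> F A) + 1)"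

end

theory Submission imports Defs begin

text \<open>
  Put \<open>N = (q + 1) / d\<close>, \<open>n = (q - 1) / d'\<close>, \<open>U = (x^2 / y)^d\<close>, \<open>Y = y^d'\<close> and
  \<open>P = Y + 1/Y\<close>. Since \<open>m = d d'\<close> with \<open>d\<close>, \<open>d'\<close> coprime, averaging over the powers of
  \<open>lam\<close> shows that its fixed field is generated by \<open>U\<close> and \<open>Y\<close>; as \<open>\<omega>\<close> fixes \<open>U\<close> and
  inverts \<open>Y\<close>, the fixed field of the whole group is generated by \<open>P\<close> and \<open>U\<close>. The equation of
  the Hermitian curve becomes \<open>U\<^sup>N = Y\<^sup>n + Y\<^sup>-\<^sup>n = P E(P)\<^sup>2\<close>, where \<open>E\<close> has \<open>(n - 1)/2\<close> distinct
  nonzero roots \<open>\<zeta> + 1/\<zeta>\<close>, \<open>\<zeta>\<^sup>n = 1\<close>, in the constant field. This is a Kummer extension of the rational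
  function field, totally ramified over \<open>P = 0\<close>, \<open>P = \<infinity>\<close> and the roots of \<open>E\<close>, of genus
  \<open>(N - 1)(n - 1)/4\<close>. The genus is found by Riemann's argument: the integral closure of the polynomial
  ring has the basis \<open>U^i / E^\<lfloor>2i/N\<rfloor>\<close>, \<open>i < N\<close>, whose pole orders at the single place at
  infinity give the dimension of the space of a large multiple of that place, and every
  divisor is bounded by one equivalent to such a multiple. As the constant field is finite, dimensions are
  computed by counting elements.
\<close>

section \<open>Existence of valuation rings\<close>

text \<open>A place is an arbitrary valuation ring, and \<open>val\<close> and
  \<open>residue_degree\<close> are defined by \<open>THE\<close>. So before any degree can be
  computed, every place of the quotient field has to be shown discrete with a finite residue field.
  The usual Noetherian arguments are replaced by the finiteness of R/gR, for the integral closure R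
  and a nonzero polynomial g: pigeonhole among the powers of an element yields both properties.
  Counting in R/gR also bounds the degree of the zero divisor of g by N deg g; with the monotonicity
  of deg A - ell A this controls all divisors at once, so neither Riemann-Roch nor the Hurwitz
  formula enters. Characteristic 2 acts twice. The numbers q + 1 and q - 1 are odd and differ by 2,
  hence are coprime, which gives m = d d' and an odd N. And Y^n + Y^-n equals (Y^n - 1)^2 / Y^n,
  which is why it is \<open>P\<close> times a square in K(P).\<close>

definition is_subring :: "'h::field set \<Rightarrow> bool" where
  "is_subring A \<longleftrightarrow> 1 \<in> A \<and> (\<forall>a\<in>A. \<forall>b\<in>A. a - b \<in> A \<and> a * b \<in> A)"

lemma subringD:
  assumes "is_subring A"
  shows subring_1: "1 \<in> A"
    and subring_diff: "a \<in> A \<Longrightarrow> b \<in> A \<Longrightarrow> a - b \<in> A"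
    and subring_mult: "a \<in> A \<Longrightarrow> b \<in> A \<Longrightarrow> a * b \<in> A"
  using assms unfolding is_subring_def by auto

lemma subring_0: "is_subring A \<Longrightarrow> 0 \<in> A"
  using subring_diff[of A 1 1] subring_1[of A] by simp

lemma subring_uminus: "is_subring A \<Longrightarrow> a \<in> A \<Longrightarrow> - a \<in> A"
  using subring_diff[of A 0 a] subring_0[of A] by simp

lemma subring_add: "is_subring A \<Longrightarrow> a \<in> A \<Longrightarrow> b \<in> A \<Longrightarrow> a + b \<in> A"
  using subring_diff[of A a "- b"] subring_uminus[of A b] by simp

lemma subring_power: "is_subring A \<Longrightarrow> a \<in> A \<Longrightarrow> a ^ n \<in> A"
  by (induction n) (auto simp: subring_1 subring_mult)

lemma subring_sum: "is_subring A \<Longrightarrow> (\<And>i. i \<in> I \<Longrightarrow> f i \<in> A) \<Longrightarrow> sum f I \<in> A"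
  by (induction I rule: infinite_finite_induct) (auto simp: subring_0 subring_add)

lemma subring_prod: "is_subring A \<Longrightarrow> (\<And>i. i \<in> I \<Longrightarrow> f i \<in> A) \<Longrightarrow> prod f I \<in> A"
  by (induction I rule: infinite_finite_induct) (auto simp: subring_1 subring_mult)

lemma subfield_subring: "is_subfield F \<Longrightarrow> is_subring F"
  unfolding is_subfield_def is_subring_def by auto

lemma subfield_inverse: "is_subfield F \<Longrightarrow> a \<in> F \<Longrightarrow> inverse a \<in> F"
  unfolding is_subfield_def by auto

lemma subfield_divide: "is_subfield F \<Longrightarrow> a \<in> F \<Longrightarrow> b \<in> F \<Longrightarrow> a / b \<in> F"
  by (simp add: field_class.field_divide_inverse subfield_inverse subfield_subring subring_mult)

lemma subfield_powi: "is_subfield F \<Longrightarrow> a \<in> F \<Longrightarrow> a powi n \<in> F"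
  by (simp add: power_int_def subfield_inverse subring_power subfield_subring)

definition adj_ring :: "'h::field set \<Rightarrow> 'h \<Rightarrow> 'h set" where
  "adj_ring A z = {poly p z | p. \<forall>i. coeff p i \<in> A}"

lemma adj_ringI: "\<forall>i. coeff p i \<in> A \<Longrightarrow> poly p z \<in> adj_ring A z"
  unfolding adj_ring_def by auto

lemma adj_ring_subring:
  assumes "is_subring A"
  shows "is_subring (adj_ring A z)"
proof -
  note [simp] = subring_1[OF assms] subring_0[OF assms]
  have "poly [:1:] z \<in> adj_ring A z"
    by (rule adj_ringI) (auto simp: coeff_pCons split: nat.split)
  moreover have "a - b \<in> adj_ring A z \<and> a * b \<in> adj_ring A z"
    if "a \<in> adj_ring A z" "b \<in> adj_ring A z" for a b
  proof -
    from that obtain p r where p: "a = poly p z" "\<forall>i. coeff p i \<in> A"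
      and r: "b = poly r z" "\<forall>i. coeff r i \<in> A" unfolding adj_ring_def by auto
    have "poly (p - r) z \<in> adj_ring A z"
      by (rule adj_ringI) (use p r assms in \<open>auto intro: subring_diff\<close>)
    moreover have "poly (p * r) z \<in> adj_ring A z"
      by (rule adj_ringI) (use p r assms in \<open>auto simp: coeff_mult intro!: subring_sum subring_mult\<close>)
    ultimately show ?thesis using p r by auto
  qed
  ultimately show ?thesis unfolding is_subring_def by auto
qed

lemma adj_ring_superset: "is_subring A \<Longrightarrow> A \<subseteq> adj_ring A z"
proof
  fix a assume "is_subring A" "a \<in> A"
  then have "poly [:a:] z \<in> adj_ring A z"
    by (intro adj_ringI) (auto simp: coeff_pCons subring_0 split: nat.split)
  then show "a \<in> adj_ring A z" by simp
qed

lemma adj_ring_mem: "is_subring A \<Longrightarrow> z \<in> adj_ring A z"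
  using adj_ringI[of "[:0, 1:]" A z]
  by (auto simp: coeff_pCons subring_0 subring_1 split: nat.split)

lemma adj_ring_subset:
  assumes "is_subring B" "A \<subseteq> B" "z \<in> B"
  shows "adj_ring A z \<subseteq> B"
  using assms unfolding adj_ring_def
  by (auto simp: poly_altdef intro!: subring_sum subring_mult subring_power)

text \<open>For an ideal \<open>I\<close> of a ring A: it generates the unit ideal of A[z],
  witnessed by an expression of degree at most \<open>n\<close> in \<open>z\<close>.\<close>

definition unit_rel :: "'h::field set \<Rightarrow> 'h \<Rightarrow> nat \<Rightarrow> bool" where
  "unit_rel I z n \<longleftrightarrow> (\<exists>c. (\<forall>i\<le>n. c i \<in> I) \<and> 1 = (\<Sum>i\<le>n. c i * z ^ i))"

text \<open>The relation in \<open>1/z\<close>, multiplied by \<open>z ^ n\<close>, can be solved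
  for \<open>z ^ n\<close> because \<open>1 - d 0\<close> is a unit of \<open>A\<close>;
  substituting the result into the top term of the other relation lowers its degree. This is the
  descent in Chevalley's extension theorem.\<close>

lemma unit_rel_reduce:
  fixes z :: "'h::field"
  assumes A: "is_subring A" and IA: "I \<subseteq> A"
    and Iadd: "\<And>a b. a \<in> I \<Longrightarrow> b \<in> I \<Longrightarrow> a + b \<in> I"
    and Imult: "\<And>a b. a \<in> A \<Longrightarrow> b \<in> I \<Longrightarrow> a * b \<in> I"
    and Iunit: "\<And>a. a \<in> I \<Longrightarrow> 1 - a \<noteq> 0 \<and> inverse (1 - a) \<in> A"
    and z: "z \<noteq> 0" and P: "unit_rel I z n" and Q: "unit_rel I (inverse z) m" and le: "m \<le> n"
  shows "unit_rel I z (n - 1) \<and> 0 < n"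
proof -
  from P obtain c where c: "\<forall>i\<le>n. c i \<in> I" "1 = (\<Sum>i\<le>n. c i * z ^ i)"
    unfolding unit_rel_def by auto
  from Q obtain d where d: "\<forall>i\<le>m. d i \<in> I" "1 = (\<Sum>i\<le>m. d i * inverse z ^ i)"
    unfolding unit_rel_def by auto
  define s where "s = inverse (1 - d 0)"
  have s: "s \<in> A" "s * (1 - d 0) = 1" using Iunit[of "d 0"] d(1) by (auto simp: s_def)
  have "(\<Sum>i\<le>m. d i * inverse z ^ i) = d 0 + (\<Sum>i=1..m. d i * inverse z ^ i)"
    by (simp add: atMost_atLeast0 sum.atLeast_Suc_atMost)
  then have 1: "1 - d 0 = (\<Sum>i=1..m. d i * inverse z ^ i)"
    unfolding d(2)[symmetric] by (simp add: algebra_simps)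
  have m: "m > 0"
  proof (rule ccontr)
    assume "\<not> m > 0"
    then have "1 - d 0 = 0" using 1 by simp
    then show False using Iunit[of "d 0"] d(1) by auto
  qed
  then have n: "n > 0" using le by simp
  have "z ^ n = s * (1 - d 0) * z ^ n" using s by simp
  also have "\<dots> = (\<Sum>i=1..m. s * d i * z ^ (n - i))"
    unfolding 1 sum_distrib_left sum_distrib_right
  proof (rule sum.cong)
    fix i assume "i \<in> {1..m}"
    then have "z ^ n = z ^ i * z ^ (n - i)" using le by (simp add: power_add[symmetric])
    then show "s * (d i * inverse z ^ i) * z ^ n = s * d i * z ^ (n - i)"
      using z by (simp add: field_simps)
  qed simp
  finally have zn: "z ^ n = (\<Sum>i=1..m. s * d i * z ^ (n - i))" .
  have "(\<Sum>i=1..m. s * d i * z ^ (n - i)) = (\<Sum>j\<in>{n-m..n-1}. s * d (n - j) * z ^ j)"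
    by (rule sum.reindex_bij_witness[of _ "\<lambda>j. n - j" "\<lambda>i. n - i"]) (use le m in auto)
  also have "\<dots> = (\<Sum>j\<le>n-1. (if n - m \<le> j then s * d (n - j) else 0) * z ^ j)"
    by (rule sum.mono_neutral_cong_left) auto
  finally have zn': "z ^ n = (\<Sum>j\<le>n-1. (if n - m \<le> j then s * d (n - j) else 0) * z ^ j)"
    using zn by simp
  have "n = Suc (n - 1)" using n by simp
  then have "1 = (\<Sum>i\<le>n-1. c i * z ^ i) + c n * z ^ n"
    using c(2) by (metis sum.atMost_Suc)
  also have "\<dots> = (\<Sum>i\<le>n-1. (c i + c n * (if n - m \<le> i then s * d (n - i) else 0)) * z ^ i)"
    unfolding zn' sum_distrib_left sum.distrib[symmetric]
    by (rule sum.cong) (auto simp: algebra_simps)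
  finally have eq: "1 = (\<Sum>i\<le>n-1. (c i + c n * (if n - m \<le> i then s * d (n - i) else 0)) * z ^ i)" .
  have I0: "0 \<in> I" using Imult[of 0 "d 0"] d(1) A subring_0 by auto
  have "c i + c n * (if n - m \<le> i then s * d (n - i) else 0) \<in> I" if "i \<le> n - 1" for i
  proof (rule Iadd)
    show "c i \<in> I" using c that by auto
    have "(if n - m \<le> i then s * d (n - i) else 0) \<in> I"
      using d(1) s(1) I0 Imult that le n by auto
    moreover have "c n \<in> A" using c IA by auto
    ultimately show "c n * (if n - m \<le> i then s * d (n - i) else 0) \<in> I" by (intro Imult)
  qed
  with eq have "unit_rel I z (n - 1)" unfolding unit_rel_def
    by (intro exI[of _ "\<lambda>i. c i + c n * (if n - m \<le> i then s * d (n - i) else 0)"] conjI allI impI)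
  then show ?thesis using n by simp
qed

text \<open>The usual proof of Chevalley's extension theorem works with local rings; here a subring
  containing \<open>1/e\<close> that is maximal subject to \<open>e\<close> not being an element is already a valuation ring.\<close>

lemma maximal_subring_dichotomy:
  fixes e z :: "'h::field"
  assumes F: "is_subfield F" and A: "is_subring A" "A \<subseteq> F" and e: "inverse e \<in> A" "e \<notin> A"
    and max: "\<And>A'. is_subring A' \<Longrightarrow> A \<subseteq> A' \<Longrightarrow> A' \<subseteq> F \<Longrightarrow> e \<notin> A' \<Longrightarrow> A' = A"
    and z: "z \<in> F"
  shows "z \<in> A \<or> inverse z \<in> A"
proof (rule ccontr)
  assume nz: "\<not> (z \<in> A \<or> inverse z \<in> A)"
  have e0: "e \<noteq> 0" using e A subring_0 by auto
  have z0: "z \<noteq> 0" using nz A subring_0 by auto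
  \<comment> \<open>The principal ideal (1/e) takes the place of the maximal ideal of the classical
    proof.\<close>
  define I where "I = {a * inverse e | a. a \<in> A}"
  have II: "a * inverse e \<in> I" if "a \<in> A" for a using that by (auto simp: I_def)
  have IA: "I \<subseteq> A" using A e subring_mult by (auto simp: I_def)
  have Iadd: "a + b \<in> I" if "a \<in> I" "b \<in> I" for a b
  proof -
    from that obtain a' b' where "a = a' * inverse e" "b = b' * inverse e" "a' \<in> A" "b' \<in> A"
      by (auto simp: I_def)
    then show ?thesis using II[of "a' + b'"] A subring_add[of A a' b'] by (simp add: algebra_simps)
  qed
  have Imult: "a * b \<in> I" if "a \<in> A" "b \<in> I" for a b
  proof -
    from that obtain b' where "b = b' * inverse e" "b' \<in> A" by (auto simp: I_def)
    then show ?thesis using II[of "a * b'"] A that subring_mult[of A a b'] by (simp add: algebra_simps)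
  qed
  have eF: "e \<in> F"
    using e A F subfield_inverse[of F "inverse e"] by auto
  have Iunit: "1 - a \<noteq> 0 \<and> inverse (1 - a) \<in> A" if a: "a \<in> I" for a
  proof -
    let ?s = "1 - a"
    from a obtain a' where a': "a = a' * inverse e" "a' \<in> A" by (auto simp: I_def)
    have s0: "?s \<noteq> 0"
    proof
      assume "?s = 0"
      then have "e = a'" using a' e0 by (simp add: field_simps)
      then show False using a' e by simp
    qed
    have sA: "?s \<in> A" using A IA a subring_1 subring_diff by blast
    \<comment> \<open>As \<open>e * a = a'\<close> lies in \<open>A\<close>, multiplication by
      \<open>1 - a\<close> fixes \<open>e\<close> modulo \<open>A\<close>. So no power of
      \<open>1 - a\<close> carries \<open>e\<close> into \<open>A\<close>; hence \<open>e\<close> is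
      not in A[1/(1-a)], and maximality makes \<open>1 - a\<close> a unit.\<close>
    have pw: "\<exists>b\<in>A. e * ?s ^ k = e + b" for k
    proof (induction k)
      case 0 then show ?case using A subring_0 by force
    next
      case (Suc k)
      then obtain b where b: "b \<in> A" "e * ?s ^ k = e + b" by auto
      have "e * ?s ^ Suc k = (e + b) * ?s" using b(2) by (simp add: algebra_simps)
      also have "\<dots> = e + (b * ?s - a')" using e0 a' by (simp add: field_simps)
      finally show ?case using A b a' sA subring_mult subring_diff by blast
    qed
    have "e \<notin> adj_ring A (inverse ?s)"
    proof
      assume "e \<in> adj_ring A (inverse ?s)"
      then obtain p where p: "e = poly p (inverse ?s)" "\<forall>i. coeff p i \<in> A"
        unfolding adj_ring_def by auto
      have "e * ?s ^ degree p = (\<Sum>i\<le>degree p. coeff p i * ?s ^ (degree p - i))"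
        unfolding p(1) poly_altdef sum_distrib_right
      proof (rule sum.cong)
        fix i assume "i \<in> {..degree p}"
        then have "?s ^ degree p = ?s ^ i * ?s ^ (degree p - i)" by (simp add: power_add[symmetric])
        then show "coeff p i * inverse ?s ^ i * ?s ^ degree p = coeff p i * ?s ^ (degree p - i)"
          using s0 by (simp add: field_simps)
      qed simp
      also have "\<dots> \<in> A" using p(2) sA A by (intro subring_sum subring_mult subring_power) auto
      finally have "e * ?s ^ degree p \<in> A" .
      moreover obtain b where "b \<in> A" "e * ?s ^ degree p = e + b" using pw by blast
      ultimately have "e \<in> A" using subring_diff[OF A(1), of "e + b" b] by auto
      then show False using e by simp
    qed
    moreover have "adj_ring A (inverse ?s) \<subseteq> F"
      using F A sA by (intro adj_ring_subset subfield_subring subfield_inverse) auto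
    ultimately have "adj_ring A (inverse ?s) = A"
      using A by (intro max adj_ring_subring adj_ring_superset) auto
    then show ?thesis using s0 adj_ring_mem[OF A(1)] by blast
  qed
  \<comment> \<open>Maximality puts \<open>e\<close> into A[v]; dividing the expression for
    \<open>e\<close> by \<open>e\<close> gives coefficients in \<open>I\<close>.\<close>
  have ex: "\<exists>n. unit_rel I v n" if v: "v \<in> F" "v \<notin> A" for v
  proof -
    have "adj_ring A v \<subseteq> F" using F A v by (intro adj_ring_subset subfield_subring) auto
    then have "e \<in> adj_ring A v"
      using max[OF adj_ring_subring[OF A(1)] adj_ring_superset[OF A(1)]] adj_ring_mem[OF A(1)] v
      by blast
    then obtain p where p: "e = poly p v" "\<forall>i. coeff p i \<in> A" unfolding adj_ring_def by auto
    have "1 = poly p v * inverse e" using e0 by (simp flip: p(1))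
    also have "\<dots> = (\<Sum>i\<le>degree p. (coeff p i * inverse e) * v ^ i)"
      unfolding poly_altdef sum_distrib_right by (rule sum.cong) (auto simp: mult_ac)
    finally have "1 = (\<Sum>i\<le>degree p. (coeff p i * inverse e) * v ^ i)" .
    then show ?thesis using p(2) II unfolding unit_rel_def
      by (intro exI[of _ "degree p"] exI[of _ "\<lambda>i. coeff p i * inverse e"]) auto
  qed
  define n where "n = (LEAST n. unit_rel I z n)"
  define m where "m = (LEAST n. unit_rel I (inverse z) n)"
  have n: "unit_rel I z n" and m: "unit_rel I (inverse z) m"
    unfolding n_def m_def using ex[OF z] ex[OF subfield_inverse[OF F z]] nz
    by (auto intro: LeastI_ex)
  show False
  proof (cases "m \<le> n")
    case True
    from unit_rel_reduce[OF A(1) IA Iadd Imult Iunit z0 n m True]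
    have "unit_rel I z (n - 1)" "n > 0" by auto
    moreover from this have "n \<le> n - 1" unfolding n_def by (intro Least_le)
    ultimately show False by simp
  next
    case False
    then have "n \<le> m" by simp
    from unit_rel_reduce[OF A(1) IA Iadd Imult Iunit _ m _ this] n z0
    have "unit_rel I (inverse z) (m - 1)" "m > 0" by auto
    moreover from this have "m \<le> m - 1" unfolding m_def by (intro Least_le)
    ultimately show False by simp
  qed
qed

lemma maximal_subring_exists:
  fixes e :: "'h::field"
  assumes B: "is_subring B" "B \<subseteq> F" "e \<notin> B"
  shows "\<exists>A. is_subring A \<and> B \<subseteq> A \<and> A \<subseteq> F \<and> e \<notin> A \<and>
    (\<forall>A'. is_subring A' \<longrightarrow> A \<subseteq> A' \<longrightarrow> A' \<subseteq> F \<longrightarrow> e \<notin> A' \<longrightarrow> A' = A)"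
proof -
  define S where "S = {A. is_subring A \<and> B \<subseteq> A \<and> A \<subseteq> F \<and> e \<notin> A}"
  have "\<exists>M\<in>S. \<forall>X\<in>S. M \<subseteq> X \<longrightarrow> X = M"
  proof (rule subset_Zorn_nonempty)
    show "S \<noteq> {}" using B by (auto simp: S_def)
  next
    fix C assume C: "C \<noteq> {}" "subset.chain S C"
    then have CS: "C \<subseteq> S" and tot: "\<And>X Y. X \<in> C \<Longrightarrow> Y \<in> C \<Longrightarrow> X \<subseteq> Y \<or> Y \<subseteq> X"
      unfolding subset.chain_def by auto
    have "is_subring (\<Union>C)"
      unfolding is_subring_def
    proof (intro conjI ballI)
      show "1 \<in> \<Union>C" using C CS subring_1 by (auto simp: S_def)
      fix a b assume "a \<in> \<Union>C" "b \<in> \<Union>C"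
      then obtain X where "X \<in> C" "a \<in> X" "b \<in> X" using tot by blast
      moreover from this have "is_subring X" using CS by (auto simp: S_def)
      ultimately show "a - b \<in> \<Union>C" "a * b \<in> \<Union>C"
        by (meson UnionI subring_diff, meson UnionI subring_mult)
    qed
    then show "\<Union>C \<in> S" using C CS by (auto simp: S_def)
  qed
  then obtain M where M: "M \<in> S" and max: "\<And>X. X \<in> S \<Longrightarrow> M \<subseteq> X \<Longrightarrow> X = M" by blast
  have "A' = M" if "is_subring A'" "M \<subseteq> A'" "A' \<subseteq> F" "e \<notin> A'" for A'
    by (rule max) (use that M in \<open>auto simp: S_def\<close>)
  then show ?thesis using M unfolding S_def by (intro exI[of _ M]) simp
qed

text \<open>The hypothesis on \<open>e\<close> says that \<open>e\<close> is not integral over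
  \<open>B\<close>. The maximal subring is sought above B[1/e], so that it contains
  \<open>1/e\<close> as the dichotomy requires.\<close>

lemma valuation_ring_exists:
  fixes \<iota> :: "'k::field \<Rightarrow> 'h::field" and e :: 'h
  assumes F: "is_subfield F" and B: "is_subring B" "range \<iota> \<subseteq> B" "B \<subseteq> F"
    and \<iota>: "\<And>c. inverse (\<iota> c) \<in> range \<iota>"
    and e: "e \<in> F" "e \<notin> adj_ring B (inverse e)"
  shows "\<exists>V. valuation_ring \<iota> F V \<and> B \<subseteq> V \<and> e \<notin> V"
proof -
  let ?B = "adj_ring B (inverse e)"
  have "is_subring ?B" "?B \<subseteq> F"
    using F B e by (auto intro!: adj_ring_subring) (meson adj_ring_subset subfield_inverse subfield_subring subsetD)
  from maximal_subring_exists[OF this e(2)] obtain A where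
    A: "is_subring A" "?B \<subseteq> A" "A \<subseteq> F" "e \<notin> A"
    and max: "\<And>A'. is_subring A' \<Longrightarrow> A \<subseteq> A' \<Longrightarrow> A' \<subseteq> F \<Longrightarrow> e \<notin> A' \<Longrightarrow> A' = A"
    by metis
  have ie: "inverse e \<in> A" using A adj_ring_mem[OF B(1)] by blast
  have BA: "B \<subseteq> A" using A adj_ring_superset[OF B(1)] by blast
  \<comment> \<open>A place must contain the constants strictly; \<open>1/e\<close> is the witness,
    for a constant \<open>1/e\<close> would bring \<open>e\<close> into \<open>A\<close>.\<close>
  have "inverse e \<notin> range \<iota>"
  proof
    assume "inverse e \<in> range \<iota>"
    then obtain c where "inverse e = \<iota> c" by (elim imageE)
    then have "inverse (inverse e) \<in> range \<iota>" using \<iota>[of c] by simp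
    then show False using BA B A by auto
  qed
  then have "range \<iota> \<subset> A" using ie BA B by auto
  moreover have "A \<subset> F" using A e by auto
  moreover have "\<forall>z\<in>F. z \<in> A \<or> inverse z \<in> A"
    by (intro ballI maximal_subring_dichotomy[OF F A(1,3) ie A(4) max])
  ultimately have "valuation_ring \<iota> F A"
    unfolding valuation_ring_def by (simp add: subring_diff[OF A(1)] subring_mult[OF A(1)])
  then show ?thesis using BA A by blast
qed

section \<open>Valuation rings of a field extension\<close>

locale field_embedding =
  fixes \<iota> :: "'k::field \<Rightarrow> 'h::field"
  assumes hom: "field_hom \<iota>"
begin

lemma \<iota>_1 [simp]: "\<iota> 1 = 1" and \<iota>_add: "\<iota> (a + b) = \<iota> a + \<iota> b" and \<iota>_mult: "\<iota> (a * b) = \<iota> a * \<iota> b"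
  using hom unfolding field_hom_def by auto

lemma \<iota>_0 [simp]: "\<iota> 0 = 0"
  using \<iota>_add[of 0 0] by (metis add.right_neutral add_left_cancel)

lemma \<iota>_uminus: "\<iota> (- a) = - \<iota> a"
  using \<iota>_add[of a "- a"] by (simp add: eq_neg_iff_add_eq_0 add.commute)

lemma \<iota>_diff: "\<iota> (a - b) = \<iota> a - \<iota> b"
  using \<iota>_add[of a "- b"] by (simp add: \<iota>_uminus)

lemma \<iota>_eq_0_iff [simp]: "\<iota> a = 0 \<longleftrightarrow> a = 0"
proof
  assume "\<iota> a = 0"
  then show "a = 0" using \<iota>_mult[of a "inverse a"] by (cases "a = 0") auto
qed simp

lemma \<iota>_eq_iff [simp]: "\<iota> a = \<iota> b \<longleftrightarrow> a = b"
  using \<iota>_diff[of a b] \<iota>_eq_0_iff[of "a - b"] by auto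

lemma \<iota>_inverse: "\<iota> (inverse a) = inverse (\<iota> a)"
proof (cases "a = 0")
  case False
  then have "\<iota> a * \<iota> (inverse a) = 1" by (simp flip: \<iota>_mult)
  then show ?thesis by (metis inverse_unique)
qed simp

lemma \<iota>_power: "\<iota> (a ^ n) = \<iota> a ^ n"
  by (induction n) (auto simp: \<iota>_mult)

lemma \<iota>_sum: "\<iota> (sum f A) = (\<Sum>x\<in>A. \<iota> (f x))"
  by (induction A rule: infinite_finite_induct) (auto simp: \<iota>_add)

lemma \<iota>_prod: "\<iota> (prod f A) = (\<Prod>x\<in>A. \<iota> (f x))"
  by (induction A rule: infinite_finite_induct) (auto simp: \<iota>_mult)

lemma \<iota>_of_nat: "\<iota> (of_nat n) = of_nat n"
  by (induction n) (auto simp: \<iota>_add)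

lemma subring_range: "is_subring (range \<iota>)"
  unfolding is_subring_def by (auto simp flip: \<iota>_1 \<iota>_diff \<iota>_mult)

lemma inverse_range: "inverse (\<iota> c) \<in> range \<iota>"
  by (simp flip: \<iota>_inverse)

end

locale extension_field = field_embedding \<iota> for \<iota> :: "'k::field \<Rightarrow> 'h::field" +
  fixes F :: "'h set"
  assumes subfield: "is_subfield F" and const: "range \<iota> \<subseteq> F"
begin

abbreviation place :: "'h set \<Rightarrow> bool" where
  "place V \<equiv> valuation_ring \<iota> F V"

lemmas F_subring = subfield_subring[OF subfield]

lemma place_exists:
  assumes "is_subring B" "range \<iota> \<subseteq> B" "B \<subseteq> F" "e \<in> F" "e \<notin> adj_ring B (inverse e)"
  shows "\<exists>V. place V \<and> B \<subseteq> V \<and> e \<notin> V"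
  using valuation_ring_exists[OF subfield assms(1-3) inverse_range assms(4,5)] .

lemma place_const: "place V \<Longrightarrow> \<iota> c \<in> V"
  unfolding valuation_ring_def by auto

lemma place_sub: "place V \<Longrightarrow> z \<in> V \<Longrightarrow> z \<in> F"
  unfolding valuation_ring_def by auto

lemma place_neq: "place V \<Longrightarrow> \<exists>z\<in>F. z \<notin> V"
  unfolding valuation_ring_def by auto

lemma place_cases: "place V \<Longrightarrow> z \<in> F \<Longrightarrow> z \<in> V \<or> inverse z \<in> V"
  unfolding valuation_ring_def by auto

lemma place_subring: "place V \<Longrightarrow> is_subring V"
  using place_const[of V 1] unfolding valuation_ring_def is_subring_def by auto

text \<open>Valuation rings are integrally closed: otherwise \<open>1/z\<close> is in
  \<open>V\<close>, and \<open>z\<close> is \<open>z ^ k\<close> times a power of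
  \<open>1/z\<close>.\<close>

lemma root_in_place:
  assumes V: "place V" and z: "z \<in> F" "z ^ k \<in> V" "k > 0"
  shows "z \<in> V"
proof (rule ccontr)
  assume n: "z \<notin> V"
  then have i: "inverse z \<in> V" and z0: "z \<noteq> 0"
    using place_cases[OF V z(1)] subring_0[OF place_subring[OF V]] by auto
  have "z ^ k = z * z ^ (k - 1)" using z(3) by (cases k) auto
  then have "z = z ^ k * inverse z ^ (k - 1)" using z0 by (simp add: power_inverse)
  also have "\<dots> \<in> V"
    by (rule subring_mult[OF place_subring[OF V] z(2) subring_power[OF place_subring[OF V] i]])
  finally show False using n by simp
qed

lemma unit_iff: "u \<in> V - max_ideal V \<longleftrightarrow> u \<noteq> 0 \<and> u \<in> V \<and> inverse u \<in> V"
  unfolding max_ideal_def by auto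

lemma max_ideal_sub: "z \<in> max_ideal V \<Longrightarrow> z \<in> V"
  unfolding max_ideal_def by auto

lemma max_ideal_0: "place V \<Longrightarrow> 0 \<in> max_ideal V"
  using subring_0[OF place_subring] unfolding max_ideal_def by auto

lemma max_ideal_1: "place V \<Longrightarrow> 1 \<notin> max_ideal V"
  using subring_1[OF place_subring] unfolding max_ideal_def by auto

lemma max_ideal_const: "place V \<Longrightarrow> \<iota> c \<in> max_ideal V \<longleftrightarrow> c = 0"
  using place_const[of V "inverse c"] max_ideal_0[of V] unfolding max_ideal_def
  by (auto simp: \<iota>_inverse)

lemma max_ideal_mult:
  assumes V: "place V" and a: "a \<in> V" and b: "b \<in> max_ideal V"
  shows "a * b \<in> max_ideal V"
proof -
  note S = place_subring[OF V]
  have "inverse (a * b) \<notin> V" if "a * b \<noteq> 0"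
  proof
    assume "inverse (a * b) \<in> V"
    then have "a * inverse (a * b) \<in> V" using a S subring_mult by blast
    then show False using b that unfolding max_ideal_def by (auto simp: field_simps)
  qed
  then show ?thesis using b subring_mult[OF S a] unfolding max_ideal_def by auto
qed

lemma max_ideal_uminus: "place V \<Longrightarrow> a \<in> max_ideal V \<Longrightarrow> - a \<in> max_ideal V"
  using max_ideal_mult[of V "- 1" a] place_const[of V "- 1"] by (simp add: \<iota>_uminus)

lemma max_ideal_add:
  assumes V: "place V" and ab: "a \<in> max_ideal V" "b \<in> max_ideal V"
  shows "a + b \<in> max_ideal V"
proof -
  have *: "a + b \<in> max_ideal V"
    if ab: "a \<in> max_ideal V" "b \<in> max_ideal V" "a \<noteq> 0" "b / a \<in> V" for a b
  proof -
    have "1 + b / a \<in> V" using that subring_add subring_1 place_subring[OF V] by blast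
    from max_ideal_mult[OF V this ab(1)] show ?thesis using that by (simp add: ring_distribs)
  qed
  show ?thesis
  proof (cases "a = 0 \<or> b = 0")
    case False
    then have "b / a \<in> V \<or> inverse (b / a) \<in> V"
      using place_cases[OF V, of "b / a"] ab max_ideal_sub place_sub[OF V] subfield subfield_divide
      by blast
    then show ?thesis
    proof
      assume "b / a \<in> V" then show ?thesis using *[of a b] ab False by auto
    next
      assume "inverse (b / a) \<in> V"
      then show ?thesis using *[of b a] ab False by (auto simp: add.commute)
    qed
  qed (use ab in auto)
qed

lemma max_ideal_diff: "place V \<Longrightarrow> a \<in> max_ideal V \<Longrightarrow> b \<in> max_ideal V \<Longrightarrow> a - b \<in> max_ideal V"
  using max_ideal_add[of V a "- b"] max_ideal_uminus[of V b] by simp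

lemma max_ideal_sum:
  "place V \<Longrightarrow> (\<And>i. i \<in> I \<Longrightarrow> f i \<in> max_ideal V) \<Longrightarrow> sum f I \<in> max_ideal V"
  by (induction I rule: infinite_finite_induct) (auto simp: max_ideal_0 max_ideal_add)

lemma not_in_place: "place V \<Longrightarrow> z \<in> F \<Longrightarrow> z \<notin> V \<Longrightarrow> inverse z \<in> max_ideal V"
  using place_cases[of V z] unfolding max_ideal_def by auto

lemma max_ideal_inverse: "z \<in> max_ideal V \<Longrightarrow> z \<noteq> 0 \<Longrightarrow> inverse z \<notin> V"
  unfolding max_ideal_def by auto

lemma unit_mult:
  "place V \<Longrightarrow> a \<in> V - max_ideal V \<Longrightarrow> b \<in> V - max_ideal V \<Longrightarrow> a * b \<in> V - max_ideal V"
  unfolding unit_iff using subring_mult[OF place_subring, of V] by (auto simp: mult.commute)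

lemma unit_inverse: "a \<in> V - max_ideal V \<Longrightarrow> inverse a \<in> V - max_ideal V"
  unfolding unit_iff by auto

lemma unit_powi: "place V \<Longrightarrow> a \<in> V - max_ideal V \<Longrightarrow> a powi n \<in> V - max_ideal V"
proof -
  assume V: "place V" and a: "a \<in> V - max_ideal V"
  have p: "b ^ k \<in> V - max_ideal V" if "b \<in> V - max_ideal V" for b k
  proof (induction k)
    case 0
    then show ?case using subring_1[OF place_subring[OF V]] max_ideal_1[OF V] by simp
  next
    case (Suc k)
    then show ?case using unit_mult[OF V that Suc] by simp
  qed
  show ?thesis unfolding power_int_def using p[OF a] p[OF unit_inverse[OF a]] by simp
qed

lemma unit_add_max_ideal:
  assumes "place V" "u \<in> V - max_ideal V" "a \<in> max_ideal V"
  shows "u + a \<in> V - max_ideal V"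
proof -
  have "u + a \<in> V" using assms max_ideal_sub subring_add place_subring by blast
  moreover have "u + a \<notin> max_ideal V"
    using max_ideal_diff[OF assms(1) _ assms(3), of "u + a"] assms(2) by auto
  ultimately show ?thesis by auto
qed

lemma max_ideal_power:
  "place V \<Longrightarrow> a \<in> max_ideal V \<Longrightarrow> k > 0 \<Longrightarrow> a ^ k \<in> max_ideal V"
  using max_ideal_mult[of V "a ^ (k - 1)" a]
  by (cases k) (auto simp: max_ideal_sub place_subring subring_power mult.commute)

lemma max_ideal_root:
  assumes "place V" "a \<in> F" "a ^ k \<in> max_ideal V" "k > 0"
  shows "a \<in> max_ideal V"
proof (rule ccontr)
  assume "a \<notin> max_ideal V"
  moreover have "a \<in> V" using assms root_in_place max_ideal_sub by blast
  ultimately have "a powi int k \<in> V - max_ideal V" using assms unit_powi by blast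
  then show False using assms by simp
qed

text \<open>The third clause is discreteness of the valuation. The definition of \<open>val\<close>
  does not contain it, so it has to be proved for each place before \<open>val\<close> can be
  evaluated at every element.\<close>

definition uniformizer :: "'h set \<Rightarrow> 'h \<Rightarrow> bool" where
  "uniformizer V t \<longleftrightarrow> t \<noteq> 0 \<and> max_ideal V = {t * v | v. v \<in> V} \<and>
     (\<forall>z\<in>F. z \<noteq> 0 \<longrightarrow> (\<exists>n u. u \<in> V - max_ideal V \<and> z = t powi n * u))"

lemma uniformizer_max_ideal: "place V \<Longrightarrow> uniformizer V t \<Longrightarrow> t \<in> max_ideal V"
  using subring_1[OF place_subring, of V] unfolding uniformizer_def
  by (metis (mono_tags, lifting) CollectI mult.right_neutral)

lemma uniformizer_powi_unit:
  assumes V: "place V" and t: "t \<in> max_ideal V" "t \<noteq> 0" and "t powi n \<in> V - max_ideal V"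
  shows "n = 0"
proof (rule ccontr)
  assume "n \<noteq> 0"
  have "t powi (int (nat \<bar>n\<bar>)) \<in> V - max_ideal V"
  proof (cases "n \<ge> 0")
    case False
    then have "t powi (int (nat \<bar>n\<bar>)) = inverse (t powi n)" by (simp add: power_int_minus[symmetric])
    then show ?thesis using assms unit_inverse by simp
  qed (use assms in auto)
  then have "t ^ nat \<bar>n\<bar> \<notin> max_ideal V" unfolding power_int_of_nat by simp
  then show False using max_ideal_power[OF V t(1), of "nat \<bar>n\<bar>"] \<open>n \<noteq> 0\<close> by simp
qed

text \<open>Two generators of the maximal ideal differ by a unit, so \<open>n\<close> and
  \<open>n'\<close> can be compared through the same \<open>t\<close>, and a power of
  \<open>t\<close> is a unit only for exponent 0.\<close>

lemma val_eq:
  assumes V: "place V" and t: "uniformizer V t" and u: "u \<in> V - max_ideal V"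
  shows "val V (t powi n * u) = n"
  unfolding val_def
proof (rule the_equality)
  show "\<exists>t' u'. max_ideal V = {t' * v |v. v \<in> V} \<and> u' \<in> V - max_ideal V \<and> t powi n * u = t' powi n * u'"
    using t u unfolding uniformizer_def by blast
next
  fix n' assume "\<exists>t' u'. max_ideal V = {t' * v |v. v \<in> V} \<and> u' \<in> V - max_ideal V \<and> t powi n * u = t' powi n' * u'"
  then obtain t' u' where t': "max_ideal V = {t' * v |v. v \<in> V}" and u': "u' \<in> V - max_ideal V"
    and eq: "t powi n * u = t' powi n' * u'" by blast
  have t0: "t \<noteq> 0" and tm: "max_ideal V = {t * v |v. v \<in> V}" using t by (auto simp: uniformizer_def)
  have "t \<in> max_ideal V" using uniformizer_max_ideal[OF V t] .
  then obtain a where a: "a \<in> V" "t = t' * a" using t' by auto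
  have "t' \<in> max_ideal V" unfolding t' using subring_1[OF place_subring[OF V]] by force
  then obtain b where b: "b \<in> V" "t' = t * b" using tm by auto
  have "a * b = 1" using a b t0 by (auto simp: mult.commute)
  then have b1: "b \<in> V - max_ideal V" unfolding unit_iff using a b
    by (metis inverse_unique mult.commute mult_zero_right zero_neq_one)
  have u0: "u \<noteq> 0" "u' \<noteq> 0" "b \<noteq> 0" using u u' b1 unfolding unit_iff by auto
  have "t powi (n - n') = b powi n' * (u' * inverse u)"
    using eq u0 t0 unfolding b(2) power_int_mult_distrib power_int_diff[OF disjI1[OF t0]]
    by (simp add: field_simps)
  also have "\<dots> \<in> V - max_ideal V"
    using V b1 u u' by (intro unit_mult unit_powi unit_inverse)
  finally have "n - n' = 0"
    using uniformizer_powi_unit[OF V \<open>t \<in> max_ideal V\<close> t0] by blast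
  then show "n' = n" by simp
qed

end

section \<open>Riemann--Roch spaces over a finite constant field\<close>

text \<open>Counting form of the inequality between a dimension and those of image and kernel;
  \<open>\<phi>\<close> may be an arbitrary choice of residues rather than a linear map.\<close>

lemma card_le_fibers:
  fixes S T :: "'a::ab_group_add set"
  assumes T: "finite T" and X: "finite X" and sub: "\<phi> ` S \<subseteq> X"
    and fib: "\<And>x y. x \<in> S \<Longrightarrow> y \<in> S \<Longrightarrow> \<phi> x = \<phi> y \<Longrightarrow> x - y \<in> T"
  shows "finite S" "card S \<le> card X * card T"
proof -
  have fb: "finite {s\<in>S. \<phi> s = x} \<and> card {s\<in>S. \<phi> s = x} \<le> card T" for x
  proof (cases "{s\<in>S. \<phi> s = x} = {}")
    case False
    then obtain s0 where s0: "s0 \<in> S" "\<phi> s0 = x" by auto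
    have sub: "{s\<in>S. \<phi> s = x} \<subseteq> (\<lambda>t. t + s0) ` T"
    proof
      fix s assume "s \<in> {s\<in>S. \<phi> s = x}"
      then have "s - s0 \<in> T" using fib s0 by auto
      then show "s \<in> (\<lambda>t. t + s0) ` T" by (intro image_eqI[of _ _ "s - s0"]) auto
    qed
    have "card {s\<in>S. \<phi> s = x} \<le> card ((\<lambda>t. t + s0) ` T)" using sub T by (intro card_mono) auto
    also have "\<dots> \<le> card T" using T by (rule card_image_le)
    finally show ?thesis using finite_subset[OF sub] T by auto
  next
    case True
    then show ?thesis by (simp only: card.empty finite.emptyI le0 simp_thms)
  qed
  have S: "S = (\<Union>x\<in>X. {s\<in>S. \<phi> s = x})" using sub by auto
  show "finite S" by (subst S) (use X fb in auto)
  have "card S \<le> (\<Sum>x\<in>X. card {s\<in>S. \<phi> s = x})" by (subst S) (rule card_UN_le[OF X])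
  also have "\<dots> \<le> (\<Sum>x\<in>X. card T)" using fb by (intro sum_mono) auto
  finally show "card S \<le> card X * card T" by simp
qed

lemma card_functions_zero_outside:
  assumes "finite B"
  shows "card {c :: 'b \<Rightarrow> 'k::{zero,finite}. \<forall>b. b \<notin> B \<longrightarrow> c b = 0} = card (UNIV :: 'k set) ^ card B"
    (is "card ?C = _")
proof -
  have "bij_betw (\<lambda>c. restrict c B) ?C (B \<rightarrow>\<^sub>E (UNIV :: 'k set))"
  proof (rule bij_betw_byWitness[where f' = "\<lambda>c b. if b \<in> B then c b else 0"])
    show "\<forall>c\<in>?C. (\<lambda>b. if b \<in> B then restrict c B b else 0) = c"
      by (intro ballI ext) auto
    show "\<forall>c\<in>B \<rightarrow>\<^sub>E UNIV. restrict (\<lambda>b. if b \<in> B then c b else 0) B = c"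
      by (intro ballI ext) (simp add: PiE_def extensional_def restrict_def)
  qed auto
  then have "card ?C = card (B \<rightarrow>\<^sub>E (UNIV :: 'k set))" by (rule bij_betw_same_card)
  then show ?thesis using assms by (simp add: card_PiE)
qed

lemma (in field_embedding) vector_space_scale: "vector_space (\<lambda>c z. \<iota> c * z)"
  by unfold_locales (auto simp: \<iota>_add \<iota>_mult algebra_simps)

lemma (in field_embedding) card_subspace:
  assumes fin: "finite S" and "card (UNIV :: 'k set) > 1"
    and "0 \<in> S" "\<And>a b. a \<in> S \<Longrightarrow> b \<in> S \<Longrightarrow> a + b \<in> S" "\<And>c a. a \<in> S \<Longrightarrow> \<iota> c * a \<in> S"
  shows "card S = card (UNIV :: 'k set) ^ vector_space.dim (\<lambda>c z. \<iota> c * z) S"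
proof -
  interpret vs: vector_space "\<lambda>c z. \<iota> c * z" by (rule vector_space_scale)
  have sub: "vs.subspace S" unfolding vs.subspace_def using assms by auto
  obtain B where B: "B \<subseteq> S" "vs.independent B" "S \<subseteq> vs.span B" "card B = vs.dim S"
    by (rule vs.basis_exists[of S]) auto
  have finB: "finite B" using B fin finite_subset by auto
  have finK: "finite (UNIV :: 'k set)" using assms(2) by (rule card_ge_0_finite[OF order.strict_trans[OF zero_less_one]])
  have S: "S = vs.span B" using B vs.span_minimal[OF B(1) sub] by auto
  let ?C = "B \<rightarrow>\<^sub>E (UNIV :: 'k set)"
  let ?f = "\<lambda>c. \<Sum>b\<in>B. \<iota> (c b) * b"
  have "inj_on ?f ?C"
  proof (rule inj_onI)
    fix c c' assume c: "c \<in> ?C" "c' \<in> ?C" "?f c = ?f c'"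
    then have "(\<Sum>b\<in>B. \<iota> (c b - c' b) * b) = 0"
      by (simp add: \<iota>_diff algebra_simps sum_subtractf)
    then have "\<forall>b\<in>B. c b - c' b = 0"
      using B(2) vs.dependent_finite[OF finB] by (auto dest!: spec[of _ "\<lambda>b. c b - c' b"])
    then show "c = c'" using c by (intro PiE_ext[of c B _ c']) auto
  qed
  moreover have "?f ` ?C = S"
    unfolding S vs.span_finite[OF finB]
  proof safe
    fix u
    have eq: "(\<Sum>v\<in>B. \<iota> (u v) * v) = ?f (restrict u B)" by (rule sum.cong) auto
    have "?f (restrict u B) \<in> ?f ` ?C" by (rule imageI) (simp add: PiE_iff extensional_def)
    then show "(\<Sum>v\<in>B. \<iota> (u v) * v) \<in> ?f ` ?C" by (simp only: eq)
  qed auto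
  ultimately have "card S = card ?C" using card_image[of ?f ?C] by (simp only:)
  then show ?thesis using finB B(4) by (simp add: card_PiE)
qed

text \<open>The two properties of places that give \<open>val\<close> and
  \<open>residue_degree\<close> their meaning. They are verified for the Kummer curve below, by
  different arguments at the finite places and at infinity.\<close>

locale discrete_field = extension_field \<iota> F
  for \<iota> :: "'k::{field,finite} \<Rightarrow> 'h::field" and F +
  assumes uniformizer_exists: "valuation_ring \<iota> F V \<Longrightarrow> \<exists>t. uniformizer V t"
    and finite_residues: "valuation_ring \<iota> F V \<Longrightarrow> \<exists>X. finite X \<and> (\<forall>z\<in>V. \<exists>x\<in>X. z - x \<in> max_ideal V)"
begin

definition \<kappa> :: nat where
  "\<kappa> = card (range \<iota>)"

lemma \<kappa>_eq [simp]: "card (UNIV :: 'k set) = \<kappa>"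
  unfolding \<kappa>_def by (rule card_image[symmetric]) (simp add: inj_def)

lemma \<kappa>_gt_1: "\<kappa> > 1"
proof -
  have "card {0::'k, 1} \<le> card (UNIV :: 'k set)" by (rule card_mono) auto
  then show ?thesis by simp
qed

definition unif :: "'h set \<Rightarrow> 'h" where
  "unif V = (SOME t. uniformizer V t)"

lemma unif: "place V \<Longrightarrow> uniformizer V (unif V)"
  unfolding unif_def by (rule someI_ex) (rule uniformizer_exists)

lemma unif_neq_0 [simp]: "place V \<Longrightarrow> unif V \<noteq> 0"
  using unif[of V] unfolding uniformizer_def by auto

lemma unif_max_ideal: "place V \<Longrightarrow> unif V \<in> max_ideal V"
  using unif uniformizer_max_ideal by blast

lemma val_decomp:
  assumes "place V" "z \<in> F" "z \<noteq> 0"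
  obtains u where "u \<in> V - max_ideal V" "z = unif V powi val V z * u"
proof -
  obtain n u where u: "u \<in> V - max_ideal V" "z = unif V powi n * u"
    using unif[OF assms(1)] assms unfolding uniformizer_def by blast
  then have "val V z = n" using val_eq[OF assms(1) unif[OF assms(1)]] by simp
  then show ?thesis using u that by simp
qed

lemma val_unit: "place V \<Longrightarrow> u \<in> V - max_ideal V \<Longrightarrow> val V u = 0"
  using val_eq[OF _ unif, of V u 0] by simp

lemma val_mult:
  assumes V: "place V" and a: "a \<in> F" "a \<noteq> 0" and b: "b \<in> F" "b \<noteq> 0"
  shows "val V (a * b) = val V a + val V b"
proof -
  obtain u where u: "u \<in> V - max_ideal V" "a = unif V powi val V a * u" using val_decomp[OF V a] .
  obtain v where v: "v \<in> V - max_ideal V" "b = unif V powi val V b * v" using val_decomp[OF V b] .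
  have "a * b = (unif V powi val V a * u) * (unif V powi val V b * v)"
    using u(2) v(2) by simp
  also have "\<dots> = unif V powi (val V a + val V b) * (u * v)"
    using V by (simp add: power_int_add)
  finally show ?thesis using val_eq[OF V unif[OF V] unit_mult[OF V u(1) v(1)]] by simp
qed

lemma val_1 [simp]: "place V \<Longrightarrow> val V 1 = 0"
  using val_unit[of V 1] max_ideal_1[of V] subring_1[OF place_subring] by auto

lemma val_power:
  assumes "place V" "a \<in> F" "a \<noteq> 0"
  shows "val V (a ^ n) = int n * val V a"
  by (induction n) (use assms in \<open>auto simp: val_mult subring_power F_subring algebra_simps\<close>)

lemma val_inverse: "place V \<Longrightarrow> a \<in> F \<Longrightarrow> a \<noteq> 0 \<Longrightarrow> val V (inverse a) = - val V a"
  using val_mult[of V a "inverse a"] subfield_inverse[OF subfield] by simp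

lemma val_unif: "place V \<Longrightarrow> val V (unif V) = 1"
  using val_eq[OF _ unif, of V 1 1] max_ideal_1[of V] subring_1[OF place_subring] by auto

lemma unif_F: "place V \<Longrightarrow> unif V \<in> F"
  using unif_max_ideal max_ideal_sub place_sub by blast

text \<open>The convention that 0 has infinite valuation; \<open>val V 0\<close> itself is
  unspecified.\<close>

definition vge :: "'h set \<Rightarrow> int \<Rightarrow> 'h \<Rightarrow> bool" where
  "vge V k z \<longleftrightarrow> z = 0 \<or> k \<le> val V z"

lemma unif_powi_in:
  assumes "place V" "n \<ge> 0"
  shows "unif V powi n \<in> V"
  using assms unif_max_ideal max_ideal_sub
  by (auto simp: power_int_def intro!: subring_power place_subring)

lemma vge_iff:
  assumes V: "place V" and z: "z \<in> F"
  shows "vge V k z \<longleftrightarrow> z * unif V powi (- k) \<in> V"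
proof (cases "z = 0")
  case True
  then show ?thesis using V by (auto simp: vge_def subring_0 place_subring)
next
  case False
  obtain u where u: "u \<in> V - max_ideal V" "z = unif V powi val V z * u" using val_decomp[OF V z False] .
  have "z * unif V powi (- k) = (unif V powi val V z * u) * unif V powi (- k)"
    using u(2) by simp
  also have "\<dots> = unif V powi (val V z - k) * u"
    using V by (simp add: power_int_diff power_int_minus field_simps)
  finally have eq: "z * unif V powi (- k) = unif V powi (val V z - k) * u" .
  show ?thesis
  proof (cases "k \<le> val V z")
    case True
    then show ?thesis unfolding eq vge_def using unif_powi_in[OF V, of "val V z - k"] u(1)
      by (auto intro!: subring_mult place_subring V)
  next
    case False
    have "unif V powi (val V z - k) * u \<notin> V"
    proof
      assume "unif V powi (val V z - k) * u \<in> V"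
      moreover have "inverse u \<in> V" using iffD1[OF unit_iff u(1)] by simp
      ultimately have "(unif V powi (val V z - k) * u) * inverse u \<in> V"
        by (rule subring_mult[OF place_subring[OF V]])
      then have "unif V powi (val V z - k) \<in> V"
        using iffD1[OF unit_iff u(1)] by (simp add: mult.assoc)
      moreover have "unif V powi (k - val V z) = inverse (unif V powi (val V z - k))"
        by (simp flip: power_int_minus)
      moreover have "unif V powi (k - val V z) \<in> max_ideal V"
        using max_ideal_power[OF V unif_max_ideal[OF V], of "nat (k - val V z)"] False
        by (simp add: power_int_def)
      moreover have "unif V powi (k - val V z) \<noteq> 0" using V by simp
      ultimately show False using max_ideal_inverse[of "unif V powi (k - val V z)" V] by simp
    qed
    then show ?thesis unfolding eq vge_def using False \<open>z \<noteq> 0\<close> by auto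
  qed
qed

lemma vge_0_iff: "place V \<Longrightarrow> z \<in> F \<Longrightarrow> vge V 0 z \<longleftrightarrow> z \<in> V"
  using vge_iff[of V z 0] by simp

lemma unif_mult_max_ideal_iff:
  assumes V: "place V"
  shows "unif V * a \<in> max_ideal V \<longleftrightarrow> a \<in> V"
proof
  assume "unif V * a \<in> max_ideal V"
  then obtain v where "v \<in> V" "unif V * a = unif V * v"
    using unif[OF V] unfolding uniformizer_def by auto
  then show "a \<in> V" using V by auto
next
  assume "a \<in> V"
  then show "unif V * a \<in> max_ideal V"
    using unif[OF V] unfolding uniformizer_def by auto
qed

lemma vge_Suc_iff:
  assumes V: "place V" and z: "z \<in> F"
  shows "vge V (k + 1) z \<longleftrightarrow> z * unif V powi (- k) \<in> max_ideal V"
proof -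
  have eq: "z * unif V powi (- k) = unif V * (z * unif V powi (- (k + 1)))"
    using V power_int_add_1'[of "unif V" "- (k+1)"] by simp
  show ?thesis unfolding eq unif_mult_max_ideal_iff[OF V] by (rule vge_iff[OF V z])
qed

lemma vge_1_iff: "place V \<Longrightarrow> z \<in> F \<Longrightarrow> vge V 1 z \<longleftrightarrow> z \<in> max_ideal V"
  using vge_Suc_iff[of V z 0] by simp

lemma vge_diff:
  assumes "place V" "a \<in> F" "b \<in> F" "vge V k a" "vge V k b"
  shows "vge V k (a - b)"
  using assms subring_diff[OF place_subring, of V "a * unif V powi (- k)" "b * unif V powi (- k)"]
  by (simp add: vge_iff F_subring subring_diff algebra_simps)

lemma vge_mult:
  assumes "place V" "a \<in> F" "b \<in> F" "vge V k a" "vge V l b"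
  shows "vge V (k + l) (a * b)"
  using assms val_mult[of V a b] unfolding vge_def by force

lemma vge_0: "vge V k 0"
  by (simp add: vge_def)

section \<open>Residue fields and their degrees\<close>

definition residue_system :: "'h set \<Rightarrow> 'h set \<Rightarrow> bool" where
  "residue_system V T \<longleftrightarrow> finite T \<and> T \<subseteq> V \<and> (\<forall>z\<in>V. \<exists>!x. x \<in> T \<and> z - x \<in> max_ideal V)"

lemma residue_system_card_le:
  assumes V: "place V" and T: "residue_system V T" and T': "residue_system V T'"
  shows "card T \<le> card T'"
proof -
  have "\<forall>x\<in>T. \<exists>y\<in>T'. x - y \<in> max_ideal V" using T T' unfolding residue_system_def by blast
  then obtain f where f: "\<And>x. x \<in> T \<Longrightarrow> f x \<in> T' \<and> x - f x \<in> max_ideal V" by metis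
  have "inj_on f T"
  proof (rule inj_onI)
    fix x y assume xy: "x \<in> T" "y \<in> T" "f x = f y"
    have "x - y = (x - f x) - (y - f y)" using xy by simp
    also have "\<dots> \<in> max_ideal V" by (rule max_ideal_diff[OF V]) (use f[OF xy(1)] f[OF xy(2)] in simp_all)
    finally have "x - y \<in> max_ideal V" .
    moreover have "x - x \<in> max_ideal V" using max_ideal_0[OF V] by simp
    ultimately show "x = y" using T xy unfolding residue_system_def by blast
  qed
  then show ?thesis using f T' unfolding residue_system_def by (intro card_inj_on_le) auto
qed

lemma residue_system_card_unique:
  "place V \<Longrightarrow> residue_system V T \<Longrightarrow> residue_system V T' \<Longrightarrow> card T = card T'"
  by (rule le_antisym) (rule residue_system_card_le; assumption)+

lemma residue_basis_system:
  assumes V: "place V" and B: "residue_basis \<iota> V B"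
  shows "\<exists>T. residue_system V T \<and> card T = \<kappa> ^ card B"
proof -
  let ?C = "{c :: 'h \<Rightarrow> 'k. \<forall>b. b \<notin> B \<longrightarrow> c b = 0}"
  let ?f = "\<lambda>c. \<Sum>b\<in>B. \<iota> (c b) * b"
  have B': "finite B" "B \<subseteq> V" and uni: "\<And>z. z \<in> V \<Longrightarrow> \<exists>!c. c \<in> ?C \<and> z - ?f c \<in> max_ideal V"
    using B unfolding residue_basis_def by auto
  have fV: "?f c \<in> V" for c
    using B'(2) V by (intro subring_sum subring_mult place_subring place_const) auto
  have inj: "inj_on ?f ?C"
  proof (rule inj_onI)
    fix c c' assume c: "c \<in> ?C" "c' \<in> ?C" "?f c = ?f c'"
    then have "?f c - ?f c \<in> max_ideal V" "?f c - ?f c' \<in> max_ideal V"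
      using max_ideal_0[OF V] by (simp_all only: diff_self)
    then show "c = c'" using c uni[OF fV[of c]] by blast
  qed
  have card: "card (?f ` ?C) = \<kappa> ^ card B"
    using card_image[OF inj] card_functions_zero_outside[where 'k = 'k, OF B'(1)] by simp
  have "finite (?f ` ?C)" using card \<kappa>_gt_1 by (intro card_ge_0_finite) auto
  moreover have "\<exists>!x. x \<in> ?f ` ?C \<and> z - x \<in> max_ideal V" if "z \<in> V" for z
    using uni[OF that] by blast
  ultimately have "residue_system V (?f ` ?C)" unfolding residue_system_def using fV by auto
  then show ?thesis using card by blast
qed

text \<open>The residues form a finite spanning set, and a spanning set of least size is
  independent: a relation with a nonzero coefficient would eliminate one element.\<close>

lemma residue_basis_exists:
  assumes V: "place V"
  shows "\<exists>B. residue_basis \<iota> V B"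
proof -
  let ?f = "\<lambda>B c. \<Sum>b\<in>B. \<iota> (c b) * b"
  define S where "S B \<longleftrightarrow> finite B \<and> B \<subseteq> V \<and> (\<forall>z\<in>V. \<exists>c. z - ?f B c \<in> max_ideal V)" for B
  obtain X where X: "finite X" "\<And>z. z \<in> V \<Longrightarrow> \<exists>x\<in>X. z - x \<in> max_ideal V"
    using finite_residues[OF V] by blast
  have "S (X \<inter> V)"
    unfolding S_def
  proof (intro conjI ballI)
    fix z assume z: "z \<in> V"
    then obtain x where x: "x \<in> X" "z - x \<in> max_ideal V" using X by blast
    have "z - (z - x) \<in> V" using x z max_ideal_sub place_subring[OF V] subring_diff by blast
    then have xV: "x \<in> V" by simp
    have "?f (X \<inter> V) (\<lambda>b. if b = x then 1 else 0) = (\<Sum>b\<in>X \<inter> V. if b = x then x else 0)"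
      by (rule sum.cong) auto
    also have "\<dots> = x" using x xV X by simp
    finally have "?f (X \<inter> V) (\<lambda>b. if b = x then 1 else 0) = x" .
    then show "\<exists>c. z - ?f (X \<inter> V) c \<in> max_ideal V" using x by (intro exI[of _ "\<lambda>b. if b = x then 1 else 0"]) simp
  qed (use X in auto)
  then obtain B where B: "S B" and min: "\<And>B'. S B' \<Longrightarrow> card B \<le> card B'"
    using ex_has_least_nat[of S "X \<inter> V" card] by blast
  have fB: "finite B" "B \<subseteq> V" using B by (auto simp: S_def)
  have ind: "c b0 = 0" if c: "?f B c \<in> max_ideal V" and b0: "b0 \<in> B" for c b0
  proof (rule ccontr)
    assume c0: "c b0 \<noteq> 0"
    have split: "?f B e = \<iota> (e b0) * b0 + ?f (B - {b0}) e" for e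
      by (rule sum.remove[OF fB(1) b0])
    have "S (B - {b0})"
      unfolding S_def
    proof (intro conjI ballI)
      fix z assume "z \<in> V"
      then obtain e where e: "z - ?f B e \<in> max_ideal V" using B by (auto simp: S_def)
      \<comment> \<open>The multiple of the relation \<open>c\<close> that removes \<open>b0\<close>
        from the expansion \<open>e\<close>.\<close>
      define r where "r = e b0 / c b0"
      have "\<iota> r * \<iota> (c b0) = \<iota> (e b0)" using c0 by (simp add: r_def flip: \<iota>_mult)
      then have r: "\<iota> r * (\<iota> (c b0) * b0) = \<iota> (e b0) * b0" by (simp flip: mult.assoc)
      have "?f (B - {b0}) (\<lambda>b. e b - r * c b) = ?f (B - {b0}) e - \<iota> r * ?f (B - {b0}) c"
        by (simp add: \<iota>_diff \<iota>_mult sum_distrib_left algebra_simps sum_subtractf)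
      also have "\<dots> = ?f B e - \<iota> r * ?f B c"
        unfolding split[of e] split[of c] using r by (simp add: algebra_simps)
      finally have "z - ?f (B - {b0}) (\<lambda>b. e b - r * c b) = (z - ?f B e) + \<iota> r * ?f B c"
        by simp
      also have "\<dots> \<in> max_ideal V"
        by (rule max_ideal_add[OF V e max_ideal_mult[OF V place_const[OF V] c]])
      finally show "\<exists>c. z - ?f (B - {b0}) c \<in> max_ideal V"
        by (rule exI[of _ "\<lambda>b. e b - r * c b"])
    qed (use fB in auto)
    then have "card B \<le> card (B - {b0})" by (rule min)
    moreover have "card (B - {b0}) < card B" using fB b0 by (intro psubset_card_mono) auto
    ultimately show False by simp
  qed
  have "residue_basis \<iota> V B"
    unfolding residue_basis_def
  proof (intro conjI ballI)
    fix z assume "z \<in> V"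
    then obtain e where e: "z - ?f B e \<in> max_ideal V" using B by (auto simp: S_def)
    show "\<exists>!c. (\<forall>b. b \<notin> B \<longrightarrow> c b = 0) \<and> z - ?f B c \<in> max_ideal V"
    proof (rule ex1I[of _ "\<lambda>b. if b \<in> B then e b else 0"])
      have "?f B (\<lambda>b. if b \<in> B then e b else 0) = ?f B e" by (rule sum.cong) auto
      then show "(\<forall>b. b \<notin> B \<longrightarrow> (if b \<in> B then e b else 0) = 0) \<and>
          z - ?f B (\<lambda>b. if b \<in> B then e b else 0) \<in> max_ideal V" using e by simp
    next
      fix c assume c: "(\<forall>b. b \<notin> B \<longrightarrow> c b = 0) \<and> z - ?f B c \<in> max_ideal V"
      have "?f B (\<lambda>b. c b - e b) = (z - ?f B e) - (z - ?f B c)"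
        by (simp add: \<iota>_diff algebra_simps sum_subtractf)
      also have "\<dots> \<in> max_ideal V" by (rule max_ideal_diff[OF V]) (use e c in auto)
      finally have "?f B (\<lambda>b. c b - e b) \<in> max_ideal V" .
      from ind[where c = "\<lambda>b. c b - e b", OF this] show "c = (\<lambda>b. if b \<in> B then e b else 0)" using c by auto
    qed
  qed (use fB in auto)
  then show ?thesis by blast
qed

text \<open>The number of residue classes does not depend on the representatives, and \<kappa> > 1
  recovers the exponent from it. This settles the \<open>THE\<close> in
  \<open>residue_degree\<close>.\<close>

lemma residue_degree_card:
  assumes V: "place V" and T: "residue_system V T"
  shows "card T = \<kappa> ^ residue_degree \<iota> V"
proof -
  have *: "card B = d" if Bd: "residue_basis \<iota> V B" "card T = \<kappa> ^ d" for B d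
  proof -
    obtain T' where T': "residue_system V T'" "card T' = \<kappa> ^ card B"
      using residue_basis_system[OF V Bd(1)] by blast
    have "card T = card T'" using residue_system_card_unique[OF V T T'(1)] .
    then show ?thesis using T' Bd \<kappa>_gt_1 by simp
  qed
  obtain B where B: "residue_basis \<iota> V B" using residue_basis_exists[OF V] by blast
  obtain T' where T': "residue_system V T'" "card T' = \<kappa> ^ card B"
    using residue_basis_system[OF V B] by blast
  have c: "card T = \<kappa> ^ card B" using residue_system_card_unique[OF V T T'(1)] T'(2) by simp
  have "residue_degree \<iota> V = card B"
    unfolding residue_degree_def by (rule the_equality) (use B * c in blast)+
  then show ?thesis using c by simp
qed

lemma residue_system_exists: "place V \<Longrightarrow> \<exists>T. residue_system V T"
  using residue_basis_exists[of V] residue_basis_system[of V] by blast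

section \<open>Riemann-Roch spaces\<close>

abbreviation L :: "('h set \<Rightarrow> int) \<Rightarrow> 'h set" where
  "L A \<equiv> riemann_roch_space \<iota> F A"

lemma L_iff: "z \<in> L A \<longleftrightarrow> z \<in> F \<and> (\<forall>V. place V \<longrightarrow> vge V (- A V) z)"
  unfolding riemann_roch_space_def vge_def by auto

lemma L_diff: "a \<in> L A \<Longrightarrow> b \<in> L A \<Longrightarrow> a - b \<in> L A"
  unfolding L_iff using vge_diff subring_diff[OF F_subring] by auto

lemma L_scale: "a \<in> L A \<Longrightarrow> \<iota> c * a \<in> L A"
proof -
  assume a: "a \<in> L A"
  have c: "\<iota> c \<in> F" using const by auto
  have "vge V (- A V) (\<iota> c * a)" if V: "place V" for V
    using vge_mult[OF V c, of a 0 "- A V"] a V vge_0_iff[OF V c] place_const[OF V]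
    unfolding L_iff by auto
  then show ?thesis using a c subring_mult[OF F_subring] unfolding L_iff by auto
qed

lemma card_L: "finite (L A) \<Longrightarrow> card (L A) = \<kappa> ^ ell \<iota> F A"
proof -
  assume fin: "finite (L A)"
  have 0: "0 \<in> L A" unfolding L_iff using subring_0[OF F_subring] vge_0 by auto
  have "a + b \<in> L A" if "a \<in> L A" "b \<in> L A" for a b
    using L_diff[of a A "0 - b"] L_diff[of 0 A b] 0 that by simp
  then show ?thesis unfolding ell_def using \<kappa>_gt_1
    by (subst card_subspace[OF fin _ 0]) (auto intro: L_scale)
qed

lemma vge_mono: "vge V k z \<Longrightarrow> l \<le> k \<Longrightarrow> vge V l z"
  unfolding vge_def by auto

lemma L_mono:
  assumes "\<And>V. A V \<le> A' V"
  shows "L A \<subseteq> L A'"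
proof
  fix z assume "z \<in> L A"
  then show "z \<in> L A'" unfolding L_iff using assms by (auto intro: vge_mono)
qed

text \<open>Taking the coefficient of the highest pole allowed at \<open>Q\<close> maps the larger
  space to the residue field of \<open>Q\<close>, with kernel \<open>L A\<close>.\<close>

lemma ell_step:
  assumes Q: "place Q" and fin: "finite (L (A(Q := A Q + 1)))"
  shows "ell \<iota> F (A(Q := A Q + 1)) \<le> ell \<iota> F A + residue_degree \<iota> Q"
proof -
  let ?A = "A(Q := A Q + 1)"
  let ?g = "\<lambda>z. z * unif Q powi (A Q + 1)"
  obtain T where T: "residue_system Q T" using residue_system_exists[OF Q] by blast
  then have finT: "finite T" and T1: "\<And>z. z \<in> Q \<Longrightarrow> \<exists>x\<in>T. z - x \<in> max_ideal Q"
    unfolding residue_system_def by blast+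
  have "\<exists>x\<in>T. ?g z - x \<in> max_ideal Q" if "z \<in> L ?A" for z
  proof -
    have "vge Q (- (A Q + 1)) z" "z \<in> F" using that Q unfolding L_iff by auto
    then show ?thesis using vge_iff[OF Q, of z "- (A Q + 1)"] T1[of "?g z"] by (simp add: add.commute)
  qed
  then obtain \<phi> where \<phi>: "\<And>z. z \<in> L ?A \<Longrightarrow> \<phi> z \<in> T \<and> ?g z - \<phi> z \<in> max_ideal Q" by metis
  have finA: "finite (L A)" by (rule finite_subset[OF L_mono fin]) simp
  have "card (L ?A) \<le> card T * card (L A)"
  proof (rule card_le_fibers(2)[OF finA finT])
    show "\<phi> ` L ?A \<subseteq> T" using \<phi> by auto
    fix x y assume xy: "x \<in> L ?A" "y \<in> L ?A" "\<phi> x = \<phi> y"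
    then have F: "x - y \<in> F" using L_diff L_iff by blast
    have "?g (x - y) = (?g x - \<phi> x) - (?g y - \<phi> y)" using xy by (simp add: algebra_simps)
    also have "\<dots> \<in> max_ideal Q" by (rule max_ideal_diff[OF Q]) (use \<phi>[OF xy(1)] \<phi>[OF xy(2)] in simp_all)
    finally have 1: "vge Q (- A Q) (x - y)"
      using vge_Suc_iff[OF Q F, of "- (A Q + 1)"] by (simp add: add.commute)
    have 2: "vge V (- ?A V) (x - y)" if "place V" for V
      using L_diff[OF xy(1,2)] that unfolding L_iff by blast
    have "vge V (- A V) (x - y)" if V: "place V" for V
    proof (cases "V = Q")
      case True
      then show ?thesis using 1 by simp
    next
      case False
      then show ?thesis using 2[OF V] by simp
    qed
    then show "x - y \<in> L A" unfolding L_iff using F by blast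
  qed
  then have "\<kappa> ^ ell \<iota> F ?A \<le> \<kappa> ^ (ell \<iota> F A + residue_degree \<iota> Q)"
    using card_L[OF fin] card_L[OF finA] residue_degree_card[OF Q T] by (simp add: power_add mult.commute)
  then show ?thesis using \<kappa>_gt_1 by simp
qed

lemma divisor_degree_superset:
  assumes "finite S" "{V. A V \<noteq> 0} \<subseteq> S"
  shows "divisor_degree \<iota> A = (\<Sum>V\<in>S. A V * int (residue_degree \<iota> V))"
  unfolding divisor_degree_def using assms by (intro sum.mono_neutral_left) auto

lemma divisor_degree_step:
  assumes "A \<in> divisors \<iota> F"
  shows "divisor_degree \<iota> (A(Q := A Q + 1)) = divisor_degree \<iota> A + int (residue_degree \<iota> Q)"
proof -
  let ?S = "insert Q {V. A V \<noteq> 0}"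
  have fin: "finite {V. A V \<noteq> 0}" using assms unfolding divisors_def by auto
  have "divisor_degree \<iota> (A(Q := A Q + 1)) = (\<Sum>V\<in>?S. (A(Q := A Q + 1)) V * int (residue_degree \<iota> V))"
    using fin by (intro divisor_degree_superset) auto
  also have "\<dots> = (\<Sum>V\<in>?S. A V * int (residue_degree \<iota> V) + (if V = Q then int (residue_degree \<iota> Q) else 0))"
    by (rule sum.cong) (auto simp: algebra_simps)
  also have "\<dots> = (\<Sum>V\<in>?S. A V * int (residue_degree \<iota> V)) + int (residue_degree \<iota> Q)"
    using fin by (simp add: sum.distrib)
  also have "(\<Sum>V\<in>?S. A V * int (residue_degree \<iota> V)) = divisor_degree \<iota> A"
    using fin by (intro divisor_degree_superset[symmetric]) auto
  finally show ?thesis .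
qed

text \<open>Passing from \<open>A\<close> to \<open>A'\<close> one place at a time, each step adds
  the residue degree to the degree and at most that much to the dimension. So deg A - ell A needs to
  be bounded only on suitable large divisors.\<close>

lemma degree_minus_ell_mono:
  assumes "A \<in> divisors \<iota> F" "A' \<in> divisors \<iota> F" "\<And>V. A V \<le> A' V" "finite (L A')"
  shows "divisor_degree \<iota> A - int (ell \<iota> F A) \<le> divisor_degree \<iota> A' - int (ell \<iota> F A')"
proof -
  let ?S = "\<lambda>A. {V. A V \<noteq> 0} \<union> {V. A' V \<noteq> 0}"
  have "\<forall>A. A \<in> divisors \<iota> F \<longrightarrow> (\<forall>V. A V \<le> A' V) \<longrightarrow> (\<Sum>V\<in>?S A. nat (A' V - A V)) = n \<longrightarrow>
    divisor_degree \<iota> A - int (ell \<iota> F A) \<le> divisor_degree \<iota> A' - int (ell \<iota> F A')" for n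
  proof (induction n)
    case 0
    show ?case
    proof (intro allI impI)
      fix A assume A: "A \<in> divisors \<iota> F" "\<forall>V. A V \<le> A' V" "(\<Sum>V\<in>?S A. nat (A' V - A V)) = 0"
      have "finite (?S A)" using A(1) assms(2) unfolding divisors_def by auto
      then have z: "\<forall>V\<in>?S A. nat (A' V - A V) = 0" by (rule iffD1[OF sum_eq_0_iff A(3)])
      have "A V = A' V" for V
      proof (cases "V \<in> ?S A")
        case True
        then have "nat (A' V - A V) = 0" by (rule bspec[OF z])
        then show ?thesis using A(2)[rule_format, of V] by simp
      qed auto
      then have "A = A'" by auto
      then show "divisor_degree \<iota> A - int (ell \<iota> F A) \<le> divisor_degree \<iota> A' - int (ell \<iota> F A')" by simp
    qed
  next
    case (Suc n)
    show ?case
    proof (intro allI impI)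
      fix A assume A: "A \<in> divisors \<iota> F" "\<forall>V. A V \<le> A' V" "(\<Sum>V\<in>?S A. nat (A' V - A V)) = Suc n"
      have finS: "finite (?S A)" using A(1) assms(2) unfolding divisors_def by auto
      have "\<exists>Q\<in>?S A. nat (A' Q - A Q) \<noteq> 0" 
      proof (rule ccontr)
        assume "\<not> (\<exists>Q\<in>?S A. nat (A' Q - A Q) \<noteq> 0)"
        then have "(\<Sum>V\<in>?S A. nat (A' V - A V)) = 0" by (intro sum.neutral) blast
        then show False using A(3) by simp
      qed
      then obtain Q where QS: "Q \<in> ?S A" and "nat (A' Q - A Q) \<noteq> 0" by (elim bexE)
      then have "A Q < A' Q" by linarith
      note Q = QS this
      have plQ: "place Q"
        using Q(2) A(1) assms(2) unfolding divisors_def by (cases "A Q = 0") auto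
      let ?B = "A(Q := A Q + 1)"
      have sub: "{V. ?B V \<noteq> 0} \<subseteq> ?S A" using Q by auto
      then have B: "?B \<in> divisors \<iota> F"
        using A(1) finite_subset[OF sub finS] plQ unfolding divisors_def by auto
      have le: "\<forall>V. ?B V \<le> A' V" using A(2) Q by auto
      \<comment> \<open>\<open>Q\<close> leaves the index set if \<open>A Q = -1\<close> and
        \<open>A' Q = 0\<close>; its term is then 0.\<close>
      have "(\<Sum>V\<in>?S ?B. nat (A' V - ?B V)) = (\<Sum>V\<in>?S A. nat (A' V - ?B V))"
        using finS Q by (intro sum.mono_neutral_left) auto
      also have "\<dots> = nat (A' Q - ?B Q) + (\<Sum>V\<in>?S A - {Q}. nat (A' V - ?B V))"
        using finS Q by (intro sum.remove) auto
      also have "(\<Sum>V\<in>?S A - {Q}. nat (A' V - ?B V)) = (\<Sum>V\<in>?S A - {Q}. nat (A' V - A V))"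
        by (rule sum.cong) auto
      also have "nat (A' Q - ?B Q) + \<dots> + 1 = nat (A' Q - A Q) + (\<Sum>V\<in>?S A - {Q}. nat (A' V - A V))"
        using Q by simp
      also have "\<dots> = (\<Sum>V\<in>?S A. nat (A' V - A V))"
        using finS Q by (intro sum.remove[symmetric]) auto
      finally have "(\<Sum>V\<in>?S ?B. nat (A' V - ?B V)) = n" using A(3) by simp
      then have "divisor_degree \<iota> ?B - int (ell \<iota> F ?B) \<le> divisor_degree \<iota> A' - int (ell \<iota> F A')"
        using Suc.IH B le by blast
      moreover have "finite (L ?B)" by (rule finite_subset[OF L_mono assms(4)]) (rule le[rule_format])
      then have "ell \<iota> F ?B \<le> ell \<iota> F A + residue_degree \<iota> Q" by (rule ell_step[OF plQ])
      ultimately show "divisor_degree \<iota> A - int (ell \<iota> F A) \<le> divisor_degree \<iota> A' - int (ell \<iota> F A')"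
        using divisor_degree_step[OF A(1), of Q] by linarith
    qed
  qed
  then show ?thesis using assms by blast
qed

end

section \<open>Linear relations and divisibility of polynomials\<close>

text \<open>Gaussian elimination without division, so that the relation has coefficients in the
  domain itself; it is applied over the polynomials.\<close>

lemma nontrivial_linear_relation:
  fixes v :: "'j \<Rightarrow> 'i \<Rightarrow> 'a::idom"
  assumes "finite I" "finite J" "card I < card J"
  shows "\<exists>c. (\<exists>j\<in>J. c j \<noteq> 0) \<and> (\<forall>i\<in>I. (\<Sum>j\<in>J. c j * v j i) = 0)"
  using assms
proof (induction I arbitrary: J v rule: finite_induct)
  case empty
  then have "J \<noteq> {}" by auto
  then show ?case by (intro exI[of _ "\<lambda>_. 1"]) auto
next
  case (insert i0 I)
  show ?case
  proof (cases "\<forall>j\<in>J. v j i0 = 0")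
    case True
    have "card I < card J" using insert by simp
    from insert.IH[OF insert.prems(1) this] obtain c where
      c: "\<exists>j\<in>J. c j \<noteq> 0" "\<forall>i\<in>I. (\<Sum>j\<in>J. c j * v j i) = 0" by blast
    have "(\<Sum>j\<in>J. c j * v j i0) = 0" using True by (intro sum.neutral) simp
    then show ?thesis using c by (intro exI[of _ c]) simp
  next
    case False
    then obtain r where r: "r \<in> J" "v r i0 \<noteq> 0" by blast
    let ?J = "J - {r}"
    \<comment> \<open>The vector \<open>v r\<close> is the pivot: the combinations
      \<open>?u j\<close> vanish at \<open>i0\<close>, and \<open>d r\<close> below collects the
      multiples of the pivot.\<close>
    let ?u = "\<lambda>j i. v r i0 * v j i - v j i0 * v r i"
    have "finite ?J" "card I < card ?J" using insert r by simp_all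
    from insert.IH[OF this, of ?u] obtain c where
      c: "\<exists>j\<in>?J. c j \<noteq> 0" "\<forall>i\<in>I. (\<Sum>j\<in>?J. c j * ?u j i) = 0" by blast
    define d where "d j = (if j = r then - (\<Sum>j\<in>?J. c j * v j i0) else c j * v r i0)" for j
    have eq: "(\<Sum>j\<in>J. d j * v j i) = (\<Sum>j\<in>?J. c j * ?u j i)" for i
    proof -
      have "(\<Sum>j\<in>J. d j * v j i) = d r * v r i + (\<Sum>j\<in>?J. d j * v j i)"
        by (rule sum.remove[OF insert.prems(1) r(1)])
      also have "(\<Sum>j\<in>?J. d j * v j i) = (\<Sum>j\<in>?J. c j * v r i0 * v j i)"
        by (rule sum.cong) (auto simp: d_def)
      also have "d r * v r i = - (\<Sum>j\<in>?J. c j * v j i0 * v r i)"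
        by (simp add: d_def sum_distrib_right)
      finally show ?thesis by (simp add: algebra_simps sum_subtractf)
    qed
    have "\<forall>i\<in>insert i0 I. (\<Sum>j\<in>J. d j * v j i) = 0"
      unfolding eq using c(2) by (simp add: mult.commute)
    moreover obtain j where "j \<in> ?J" "c j \<noteq> 0" using c(1) by blast
    then have "\<exists>j\<in>J. d j \<noteq> 0" using r by (intro bexI[of _ j]) (auto simp: d_def)
    ultimately show ?thesis by blast
  qed
qed

lemma poly_ideal_generator:
  fixes p :: "'a::field poly"
  assumes "p \<in> I" "p \<noteq> 0"
    and diff: "\<And>a b. a \<in> I \<Longrightarrow> b \<in> I \<Longrightarrow> a - b \<in> I" and mult: "\<And>a b. b \<in> I \<Longrightarrow> a * b \<in> I"
  shows "\<exists>d\<in>I. d \<noteq> 0 \<and> (\<forall>f\<in>I. d dvd f)"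
proof -
  obtain d where d: "d \<in> I \<and> d \<noteq> 0" and min: "\<And>e. e \<in> I \<and> e \<noteq> 0 \<Longrightarrow> degree d \<le> degree e"
    using ex_has_least_nat[of "\<lambda>p. p \<in> I \<and> p \<noteq> 0" p degree] assms by blast
  have "d dvd f" if f: "f \<in> I" for f
  proof (rule ccontr)
    assume n: "\<not> d dvd f"
    have "f - (f div d) * d \<in> I" using d f by (intro diff mult) auto
    then have "f mod d \<in> I" by (simp add: minus_div_mult_eq_mod)
    moreover have n0: "f mod d \<noteq> 0" using n by (simp add: dvd_eq_mod_eq_0)
    ultimately have "degree d \<le> degree (f mod d)" using min by blast
    then show False using degree_mod_less[of d f] n0 d by auto
  qed
  then show ?thesis using d by blast
qed

text \<open>A divisor of least positive degree is prime: by Bezout, its greatest common divisor with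
  \<open>b\<close> is either constant or associated to \<open>p\<close>.\<close>

lemma prime_factor_exists:
  fixes g :: "'a::field poly"
  assumes "degree g > 0"
  shows "\<exists>p. prime_elem p \<and> p dvd g"
proof -
  obtain p where p: "p dvd g \<and> degree p > 0"
    and min: "\<And>e. e dvd g \<and> degree e > 0 \<Longrightarrow> degree p \<le> degree e"
    using ex_has_least_nat[of "\<lambda>p. p dvd g \<and> degree p > 0" g degree] assms by auto
  have "prime_elem p"
  proof (rule prime_elemI)
    show p0: "p \<noteq> 0" using p by auto
    show "\<not> p dvd 1"
    proof
      assume "p dvd 1"
      then have "degree p \<le> degree (1 :: 'a poly)" by (rule dvd_imp_degree_le) simp
      then show False using p by simp
    qed
    fix a b assume ab: "p dvd a * b"
    show "p dvd a \<or> p dvd b"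
    proof (rule disjCI)
      assume nb: "\<not> p dvd b"
      let ?I = "{r * p + s * b | r s. True}"
      have "\<exists>d\<in>?I. d \<noteq> 0 \<and> (\<forall>f\<in>?I. d dvd f)"
      proof (rule poly_ideal_generator[OF _ p0])
        have "p = 1 * p + 0 * b" by simp
        then show "p \<in> ?I" by blast
        fix x y assume "x \<in> ?I" "y \<in> ?I"
        then obtain r s r' s' where "x = r * p + s * b" "y = r' * p + s' * b" by blast
        then have "x - y = (r - r') * p + (s - s') * b" by (simp add: algebra_simps)
        then show "x - y \<in> ?I" by blast
      next
        fix x y assume "y \<in> ?I"
        then obtain r s where "y = r * p + s * b" by blast
        then have "x * y = (x * r) * p + (x * s) * b" by (simp add: algebra_simps)
        then show "x * y \<in> ?I" by blast
      qed
      then obtain d r s where d: "d \<noteq> 0" "d = r * p + s * b" and dd: "\<And>f. f \<in> ?I \<Longrightarrow> d dvd f"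
        by blast
      have "p = 1 * p + 0 * b" "b = 0 * p + 1 * b" by simp_all
      then have dp: "d dvd p" and db: "d dvd b" using dd by blast+
      have "degree d = 0"
      proof (rule ccontr)
        assume "degree d \<noteq> 0"
        then have "degree p \<le> degree d" using min[of d] dp p dvd_trans by blast
        moreover obtain e where e: "p = d * e" using dp by (elim dvdE)
        ultimately have "degree e = 0" using p0 d(1) by (simp add: degree_mult_eq)
        then have "e dvd 1" using p0 e by (metis is_unit_iff_degree mult_zero_right)
        then have "p dvd d" unfolding e by (simp add: mult_unit_dvd_iff)
        then show False using db nb dvd_trans by blast
      qed
      then have "d dvd 1" using d(1) by (simp add: is_unit_iff_degree)
      moreover have "p dvd d * a"
        unfolding d(2) using ab by (simp add: ring_distribs mult.assoc mult.commute[of b])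
      ultimately show "p dvd a" by (metis dvd_mult_unit_iff mult.commute)
    qed
  qed
  then show ?thesis using p by blast
qed

text \<open>Induction on the prime factors of \<open>g\<close>, in place of a comparison of
  factorizations: a relation \<open>Q\<close> that survives cancelling a common prime and forces the
  primes of \<open>g\<close> into \<open>f\<close> implies divisibility.\<close>

lemma poly_dvd_by_primes:
  fixes g f :: "'a::field poly"
  assumes "g \<noteq> 0" "Q g f"
    and step: "\<And>p g f. prime_elem p \<Longrightarrow> g \<noteq> 0 \<Longrightarrow> Q (p * g) (p * f) \<Longrightarrow> Q g f"
    and prime: "\<And>p g f. prime_elem p \<Longrightarrow> g \<noteq> 0 \<Longrightarrow> p dvd g \<Longrightarrow> Q g f \<Longrightarrow> p dvd f"
  shows "g dvd f"
  using assms(1,2)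
proof (induction "degree g" arbitrary: g f rule: less_induct)
  case less
  show ?case
  proof (cases "degree g = 0")
    case True
    then have "g dvd 1" using less by (simp add: is_unit_iff_degree)
    then show ?thesis using dvd_trans one_dvd by blast
  next
    case False
    then obtain p where p: "prime_elem p" "p dvd g" using prime_factor_exists by blast
    then obtain f' g' where g': "g = p * g'" and f': "f = p * f'"
      using prime[OF p(1) less.prems(1) p(2) less.prems(2)] by (auto elim!: dvdE)
    have p0: "p \<noteq> 0" "\<not> p dvd 1" "g' \<noteq> 0" using p g' less.prems(1) by auto
    then have "degree p \<noteq> 0" using is_unit_iff_degree by blast
    then have "degree g' < degree g" using p0 by (simp add: g' degree_mult_eq)
    moreover have "Q g' f'" using step[OF p(1) p0(3)] less.prems g' f' by blast
    ultimately have "g' dvd f'" using less.hyps p0 by blast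
    then show ?thesis by (simp add: g' f')
  qed
qed

lemma prime_power_dvd_cancel:
  fixes p a b :: "'a::idom"
  assumes "prime_elem p" "\<not> p dvd a" "p ^ k dvd a * b"
  shows "p ^ k dvd b"
  using assms(3)
proof (induction k arbitrary: b)
  case (Suc k)
  have "p dvd a * b" using Suc.prems dvd_mult_left[of p "p ^ k"] by simp
  then have "p dvd b" using prime_elem_dvd_mult_iff[OF assms(1), of a b] assms(2) by simp
  then obtain b' where b': "b = p * b'" by (elim dvdE)
  have "p * p ^ k dvd p * (a * b')" using Suc.prems unfolding b' by (simp add: mult_ac)
  moreover have "p \<noteq> 0" using assms(1) by (auto simp: prime_elem_def)
  ultimately have "p ^ k dvd a * b'" by (simp only: dvd_mult_cancel_left) simp
  then have "p ^ k dvd b'" by (rule Suc.IH)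
  then show ?case by (simp add: b' mult_dvd_mono)
qed simp

text \<open>A prime of \<open>g\<close> not dividing \<open>f\<close> would enter \<open>M\<close>
  with its full N-th power. This is how denominators of integral elements are removed.\<close>

lemma dvd_of_power_dvd:
  fixes g f M :: "'a::field poly"
  assumes "g \<noteq> 0" "g ^ N dvd f ^ N * M" and M: "\<And>p. prime_elem p \<Longrightarrow> \<not> p ^ N dvd M"
  shows "g dvd f"
proof (rule poly_dvd_by_primes[where Q = "\<lambda>g f. g ^ N dvd f ^ N * M"])
  fix p g f :: "'a poly"
  assume p: "prime_elem p" and "g \<noteq> 0"
  have p0: "p \<noteq> 0" using p by (auto simp: prime_elem_def)
  {
    assume "(p * g) ^ N dvd (p * f) ^ N * M"
    then have "p ^ N * g ^ N dvd p ^ N * (f ^ N * M)" by (simp add: power_mult_distrib mult.assoc)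
    then show "g ^ N dvd f ^ N * M" using p0 by (simp add: dvd_mult_cancel_left)
  }
  assume g: "p dvd g" and d: "g ^ N dvd f ^ N * M"
  show "p dvd f"
  proof (rule ccontr)
    assume n: "\<not> p dvd f"
    then have nd: "\<not> p dvd f ^ N" using prime_elem_dvd_power[OF p] by blast
    have "p ^ N dvd f ^ N * M" by (rule dvd_trans[OF dvd_power_same[OF g] d])
    then have "p ^ N dvd M" by (rule prime_power_dvd_cancel[OF p nd])
    then show False using M[OF p] by simp
  qed
qed (use assms in auto)

lemma prime_elem_dvd_prod:
  fixes p :: "'a::comm_semiring_1"
  assumes "prime_elem p" "finite A" "p dvd prod f A"
  shows "\<exists>a\<in>A. p dvd f a"
  using assms(2,3)
proof (induction A rule: finite_induct)
  case empty
  then show ?case using assms(1) by (simp add: prime_elem_def)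
next
  case (insert a A)
  then show ?case using prime_elem_dvd_mult_iff[OF assms(1), of "f a" "prod f A"] by auto
qed

text \<open>A prime dividing the product is associated to a linear factor \<open>[:- a, 1:]\<close>,
  whose multiplicity \<open>s a\<close> is less than \<open>N\<close>.\<close>

lemma prime_power_not_dvd_linear_prod:
  fixes s :: "'a::field \<Rightarrow> nat"
  assumes A: "finite A" and s: "\<And>a. a \<in> A \<Longrightarrow> s a < N" and N: "N > 0" and p: "prime_elem p"
  shows "\<not> p ^ N dvd (\<Prod>a\<in>A. [:- a, 1:] ^ s a)"
proof
  assume d: "p ^ N dvd (\<Prod>a\<in>A. [:- a, 1:] ^ s a)"
  have "p dvd p ^ N" using N by (simp add: dvd_power)
  then have "p dvd (\<Prod>a\<in>A. [:- a, 1:] ^ s a)" using d by (rule dvd_trans)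
  then obtain a where a: "a \<in> A" "p dvd [:- a, 1:] ^ s a"
    using prime_elem_dvd_prod[OF p A] by blast
  then have pd: "p dvd [:- a, 1:]" using prime_elem_dvd_power[OF p] by blast
  then obtain e where e: "[:- a, 1:] = p * e" by (elim dvdE)
  have "p \<noteq> 0" "\<not> p dvd 1" using p by (auto simp: prime_elem_def)
  then have "degree p \<noteq> 0" using is_unit_iff_degree by blast
  moreover have "e \<noteq> 0" using e by auto
  then have "degree p + degree e = degree [:- a, 1:]" using e \<open>p \<noteq> 0\<close> by (simp add: degree_mult_eq)
  ultimately have "degree e = 0" by simp
  then have "e dvd 1" using \<open>e \<noteq> 0\<close> by (simp add: is_unit_iff_degree)
  then have "[:- a, 1:] dvd p" unfolding e by (simp add: mult_unit_dvd_iff)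
  then have "[:- a, 1:] ^ N dvd (\<Prod>a\<in>A. [:- a, 1:] ^ s a)"
    by (rule dvd_trans[OF dvd_power_same d])
  also have "(\<Prod>a\<in>A. [:- a, 1:] ^ s a) = [:- a, 1:] ^ s a * (\<Prod>c\<in>A - {a}. [:- c, 1:] ^ s c)"
    by (rule prod.remove[OF A a(1)])
  also have "[:- a, 1:] ^ N = [:- a, 1:] ^ s a * [:- a, 1:] ^ (N - s a)"
    using s[OF a(1)] by (simp flip: power_add)
  finally have "[:- a, 1:] ^ (N - s a) dvd (\<Prod>c\<in>A - {a}. [:- c, 1:] ^ s c)"
    by (subst (asm) dvd_mult_cancel_left) auto
  moreover have "[:- a, 1:] dvd [:- a, 1:] ^ (N - s a)" using s[OF a(1)] by (simp add: dvd_power)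
  ultimately have "[:- a, 1:] dvd (\<Prod>c\<in>A - {a}. [:- c, 1:] ^ s c)" by (rule dvd_trans[rotated])
  then have "poly (\<Prod>c\<in>A - {a}. [:- c, 1:] ^ s c) a = 0" by (simp only: poly_eq_0_iff_dvd)
  then show False using A by (auto simp: poly_prod)
qed

section \<open>Kummer extensions of a rational function field\<close>

lemma adjoin_subfield: "is_subfield (adjoin \<iota> S)"
  unfolding adjoin_def is_subfield_def by auto

lemma adjoin_const: "range \<iota> \<subseteq> adjoin \<iota> S" and adjoin_gen: "S \<subseteq> adjoin \<iota> S"
  unfolding adjoin_def by auto

lemma adjoin_least: "is_subfield F \<Longrightarrow> range \<iota> \<subseteq> F \<Longrightarrow> S \<subseteq> F \<Longrightarrow> adjoin \<iota> S \<subseteq> F"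
  unfolding adjoin_def by auto

context extension_field
begin

lemma poly_leading_term:
  assumes V: "place V" and z: "z \<in> F" "z \<notin> V" and p: "p \<noteq> 0"
  shows "poly (map_poly \<iota> p) z * inverse z ^ degree p - \<iota> (lead_coeff p) \<in> max_ideal V"
  using p
proof (induction p rule: pCons_induct)
  case (pCons a f)
  have iz: "inverse z \<in> max_ideal V" by (rule not_in_place[OF V z])
  have z0: "z \<noteq> 0" using z(2) subring_0[OF place_subring[OF V]] by auto
  show ?case
  proof (cases "f = 0")
    case True
    then show ?thesis using pCons max_ideal_0[OF V] by (simp add: map_poly_pCons)
  next
    case False
    then have IH: "poly (map_poly \<iota> f) z * inverse z ^ degree f - \<iota> (lead_coeff f) \<in> max_ideal V"
      using pCons by simp
    have "inverse z ^ (degree f + 1) \<in> max_ideal V"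
      by (rule max_ideal_power[OF V iz]) simp
    then have "\<iota> a * inverse z ^ (degree f + 1) \<in> max_ideal V"
      by (rule max_ideal_mult[OF V place_const[OF V]])
    from max_ideal_add[OF V this IH]
    have "\<iota> a * inverse z ^ (degree f + 1) + poly (map_poly \<iota> f) z * inverse z ^ degree f
        - \<iota> (lead_coeff f) \<in> max_ideal V"
      by (simp add: algebra_simps)
    moreover have "poly (map_poly \<iota> (pCons a f)) z * inverse z ^ degree (pCons a f) =
      \<iota> a * inverse z ^ (degree f + 1) + poly (map_poly \<iota> f) z * inverse z ^ degree f"
      using False z0 by (simp add: map_poly_pCons field_simps)
    ultimately show ?thesis using False by simp
  qed
qed simp

text \<open>At a place where \<open>z\<close> is infinite, p(z) divided by the power of z of degree
  deg p reduces to the leading coefficient, a nonzero constant and so a unit.\<close>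

lemma transcendental_not_in_place:
  assumes "place V" "z \<in> F" "z \<notin> V"
  shows "transcendental_over \<iota> z"
  unfolding transcendental_over_def
proof (intro allI impI notI)
  fix p :: "'k poly" assume "p \<noteq> 0" "poly (map_poly \<iota> p) z = 0"
  with poly_leading_term[OF assms] have "- \<iota> (lead_coeff p) \<in> max_ideal V" by fastforce
  then have "\<iota> (lead_coeff p) \<in> max_ideal V" using max_ideal_uminus[OF assms(1)] by fastforce
  then show False using max_ideal_const[OF assms(1)] \<open>p \<noteq> 0\<close> by simp
qed

end

locale transcendental_extension = field_embedding \<iota> for \<iota> :: "'k::field \<Rightarrow> 'h::field" +
  fixes P :: 'h
  assumes trans: "transcendental_over \<iota> P"
begin

definition ev :: "'k poly \<Rightarrow> 'h" where
  "ev f = poly (map_poly \<iota> f) P"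

lemma ev_pCons: "ev (pCons a f) = \<iota> a + P * ev f"
  by (simp add: ev_def map_poly_pCons)

lemma ev_0 [simp]: "ev 0 = 0" and ev_const: "ev [:c:] = \<iota> c"
  by (simp_all add: ev_def map_poly_pCons)

lemma ev_1 [simp]: "ev 1 = 1"
  using ev_const[of 1] by (simp add: one_pCons)

lemma ev_X: "ev [:0, 1:] = P"
  by (simp add: ev_pCons)

lemma ev_add: "ev (f + g) = ev f + ev g"
proof -
  have "map_poly \<iota> (f + g) = map_poly \<iota> f + map_poly \<iota> g"
    by (rule poly_eqI) (simp add: coeff_map_poly \<iota>_add)
  then show ?thesis by (simp add: ev_def)
qed

lemma ev_mult: "ev (f * g) = ev f * ev g"
proof -
  have "map_poly \<iota> (f * g) = map_poly \<iota> f * map_poly \<iota> g"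
    by (rule poly_eqI) (simp add: coeff_map_poly coeff_mult \<iota>_sum \<iota>_mult)
  then show ?thesis by (simp add: ev_def)
qed

lemma ev_uminus: "ev (- f) = - ev f"
  using ev_add[of f "- f"] by (simp add: eq_neg_iff_add_eq_0 add.commute)

lemma ev_diff: "ev (f - g) = ev f - ev g"
  using ev_add[of f "- g"] by (simp add: ev_uminus)

lemma ev_power: "ev (f ^ n) = ev f ^ n"
  by (induction n) (auto simp: ev_mult)

lemma ev_sum: "ev (sum f A) = (\<Sum>x\<in>A. ev (f x))"
  by (induction A rule: infinite_finite_induct) (auto simp: ev_add)

lemma ev_prod: "ev (prod f A) = (\<Prod>x\<in>A. ev (f x))"
  by (induction A rule: infinite_finite_induct) (auto simp: ev_mult)

lemma ev_eq_0_iff [simp]: "ev f = 0 \<longleftrightarrow> f = 0"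
  using trans unfolding transcendental_over_def ev_def by auto

lemma ev_eq_iff: "ev f = ev g \<longleftrightarrow> f = g"
  using ev_eq_0_iff[of "f - g"] by (simp add: ev_diff)

lemma P_neq_0: "P \<noteq> 0"
  using ev_eq_0_iff[of "[:0, 1:]"] by (simp add: ev_X)

lemma ev_in_subring:
  assumes "is_subring A" "range \<iota> \<subseteq> A" "P \<in> A"
  shows "ev f \<in> A"
  by (induction f) (use assms in \<open>auto simp: ev_pCons subring_0 intro!: subring_add subring_mult\<close>)

text \<open>Clearing denominators would give a nontrivial polynomial relation for the transcendental
  \<open>P\<close>. The lemma provides a place where \<open>P\<close> is infinite.\<close>

lemma P_not_integral: "P \<notin> adj_ring (range \<iota>) (inverse P)"
proof
  assume "P \<in> adj_ring (range \<iota>) (inverse P)"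
  then obtain p where p: "P = poly p (inverse P)" "\<forall>i. coeff p i \<in> range \<iota>"
    unfolding adj_ring_def by auto
  define c where "c i = inv_into UNIV \<iota> (coeff p i)" for i
  have c: "coeff p i = \<iota> (c i)" for i
    unfolding c_def by (rule f_inv_into_f[symmetric]) (rule p(2)[rule_format])
  let ?d = "degree p"
  define f where "f = monom 1 (Suc ?d) - (\<Sum>i\<le>?d. monom (c i) (?d - i))"
  have ev_monom: "ev (monom a n) = \<iota> a * P ^ n" for a n
    by (induction n) (auto simp: monom_0 ev_const monom_Suc ev_pCons)
  have "P ^ Suc ?d = poly p (inverse P) * P ^ ?d" by (simp flip: p(1))
  also have "\<dots> = (\<Sum>i\<le>?d. \<iota> (c i) * P ^ (?d - i))"
    unfolding poly_altdef sum_distrib_right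
  proof (rule sum.cong)
    fix i assume "i \<in> {..?d}"
    then have "P ^ ?d = P ^ i * P ^ (?d - i)" by (simp flip: power_add)
    then show "coeff p i * inverse P ^ i * P ^ ?d = \<iota> (c i) * P ^ (?d - i)"
      using P_neq_0 by (simp add: c field_simps)
  qed simp
  finally have "ev f = 0" by (simp add: f_def ev_diff ev_sum ev_monom)
  moreover have "coeff f (Suc ?d) = 1"
    by (simp add: f_def coeff_sum) (rule sum.neutral, auto)
  ultimately show False by auto
qed

end

text \<open>\<open>N_dvd\<close> puts the N-th roots of unity into the constant field and makes
  \<open>N\<close> invertible there. \<open>cop\<close> compares \<open>N\<close> with the degree of
  the right-hand side in \<open>P\<close>, which makes infinity totally ramified. Irreducibility of
  the equation is a consequence, drawn from the pole orders at infinity.\<close>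

locale kummer_curve = transcendental_extension \<iota> P
  for \<iota> :: "'k::{field,finite} \<Rightarrow> 'h::field" and P +
  fixes U :: 'h and Z :: "'k set" and N :: nat
  assumes eq: "U ^ N = P * (\<Prod>a\<in>Z. P - \<iota> a) ^ 2"
    and Z0: "0 \<notin> Z" and N_odd: "odd N" and cop: "coprime N (2 * card Z + 1)"
    and N_dvd: "N dvd card (UNIV :: 'k set) - 1"

sublocale kummer_curve \<subseteq> extension_field \<iota> "adjoin \<iota> {P, U}"
  by unfold_locales (rule adjoin_subfield, rule adjoin_const)

context kummer_curve
begin

abbreviation F :: "'h set" where
  "F \<equiv> adjoin \<iota> {P, U}"

definition n :: nat where
  "n = 2 * card Z + 1"

definition Epol :: "'k poly" where
  "Epol = (\<Prod>a\<in>Z. [:- a, 1:])"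

abbreviation E :: 'h where
  "E \<equiv> ev Epol"

lemma E_eq: "E = (\<Prod>a\<in>Z. P - \<iota> a)"
  unfolding Epol_def ev_prod by (rule prod.cong) (auto simp: ev_pCons \<iota>_uminus)

lemma Epol_monic: "lead_coeff Epol = 1"
  unfolding Epol_def lead_coeff_prod by simp

lemma degree_Epol: "degree Epol = card Z"
  unfolding Epol_def by (simp add: degree_prod_eq_sum_degree)

lemma E_neq_0 [simp]: "Epol \<noteq> 0"
  using Epol_monic by auto

lemma UN: "U ^ N = P * E ^ 2"
  by (simp add: eq E_eq)

lemma N_pos: "N > 0"
  using N_odd by (cases N) auto

lemma U_neq_0: "U \<noteq> 0"
  using UN P_neq_0 N_pos by (auto simp: zero_power)

text \<open>The elements \<open>w k\<close> with \<open>k < N\<close> form a basis of the integral closure of the polynomial ring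
  in \<open>P\<close>; the factor \<open>2\<close> in the exponent comes from the squares in \<open>U\<^sup>N = P E\<^sup>2\<close>.\<close>

definition w :: "nat \<Rightarrow> 'h" where
  "w k = U ^ k / E ^ (2 * k div N)"

lemma w_0 [simp]: "w 0 = 1"
  by (simp add: w_def)

text \<open>The floor of a sum exceeds the sum of the floors by 0 or 1, so the subtraction does not
  truncate.\<close>

definition carry :: "nat \<Rightarrow> nat \<Rightarrow> nat" where
  "carry i j = 2 * (i + j) div N - 2 * i div N - 2 * j div N"

lemma w_mult: "w i * w j = E ^ carry i j * w (i + j)"
proof -
  have "2 * i div N + 2 * j div N \<le> 2 * (i + j) div N"
    by (simp add: div_add1_eq[of "2*i" "2*j" N])
  then have "2 * (i + j) div N = carry i j + 2 * i div N + 2 * j div N"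
    by (simp add: carry_def)
  then show ?thesis by (simp add: w_def power_add)
qed

lemma w_add_N: "w (k + N) = P * w k"
proof -
  have "2 * (k + N) div N = 2 * k div N + 2"
    using N_pos by (simp add: add_mult_distrib2)
  then show ?thesis by (simp add: w_def power_add UN power2_eq_square field_simps)
qed

lemma w_add_mult_N: "w (k + l * N) = P ^ l * w k"
  by (induction l) (auto simp: w_add_N add.assoc[symmetric] add.commute[of N])

lemma w_mod: "w k = P ^ (k div N) * w (k mod N)"
  using w_add_mult_N[of "k mod N" "k div N"] by simp

text \<open>A polynomial in \<open>P\<close>, so \<open>w k\<close> is integral. For
  \<open>k < N\<close> all its exponents are below \<open>N\<close>, which is why no further
  polynomial can be divided out of \<open>w k\<close>.\<close>

lemma w_power: "w k ^ N = P ^ k * E ^ (2 * k mod N)"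
proof -
  have "w k ^ N * E ^ (2 * k div N * N) = (U ^ N) ^ k"
    by (simp add: w_def power_divide mult.commute flip: power_mult)
  also have "\<dots> = P ^ k * E ^ (2 * k)"
    by (simp add: UN power_mult_distrib flip: power_mult)
  also have "E ^ (2 * k) = E ^ (2 * k mod N) * E ^ (2 * k div N * N)"
    by (simp flip: power_add)
  finally show ?thesis by simp
qed

lemma U_w: "U ^ k = E ^ (2 * k div N) * w k"
  by (simp add: w_def)

lemma P_in_F: "P \<in> F" and U_in_F: "U \<in> F"
  using adjoin_gen[of "{P, U}" \<iota>] by auto

lemma ev_in_F: "ev f \<in> F"
  by (rule ev_in_subring[OF F_subring const P_in_F])

lemma w_in_F: "w k \<in> F"
  unfolding w_def by (intro subfield_divide subfield subring_power F_subring U_in_F ev_in_F)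

lemma ev_in_place: "place V \<Longrightarrow> P \<in> V \<Longrightarrow> ev f \<in> V"
  by (rule ev_in_subring) (auto simp: place_subring place_const)

lemma w_in_place:
  assumes V: "place V" "P \<in> V"
  shows "w k \<in> V"
proof (rule root_in_place[OF V(1) w_in_F _ N_pos])
  show "w k ^ N \<in> V" unfolding w_power
    by (intro subring_mult subring_power place_subring V ev_in_place)
qed

text \<open>For \<open>\<zeta> = 1\<close> a general element in coordinates; for another N-th root
  of unity its conjugate under U -> \<zeta> U, as \<open>w i\<close> is \<open>U ^ i\<close> up to a
  polynomial in \<open>P\<close>.\<close>

definition comb :: "'k \<Rightarrow> (nat \<Rightarrow> 'k poly) \<Rightarrow> 'h" where
  "comb \<zeta> a = (\<Sum>i<N. ev (a i) * \<iota> (\<zeta> ^ i) * w i)"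

lemma comb_in_F: "comb \<zeta> a \<in> F"
  unfolding comb_def using const
  by (intro subring_sum subring_mult F_subring ev_in_F w_in_F) auto

text \<open>At a place not containing \<open>P\<close> the element \<open>t\<close> below is a uniformizer: there
  \<open>P\<close> is \<open>t\<^sup>-\<^sup>N\<close> and \<open>U\<close> is \<open>t\<^sup>-\<^sup>n\<close> up to units congruent to 1.\<close>

definition bez :: "int \<times> int" where
  "bez = (SOME (a, b). a * int N + b * int n = - 1)"

abbreviation "\<alpha> \<equiv> fst bez"
abbreviation "\<beta> \<equiv> snd bez"

lemma bez: "\<alpha> * int N + \<beta> * int n = - 1"
proof -
  have "coprime (int N) (int n)" using cop unfolding n_def coprime_int_iff .
  then have "gcd (int N) (int n) = 1" by (simp only: coprime_iff_gcd_eq_1)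
  then obtain u v where "u * int N + v * int n = 1" by (metis bezout_int)
  then have "(- u) * int N + (- v) * int n = - 1" by simp
  then have "case (- u, - v) of (a, b) \<Rightarrow> a * int N + b * int n = - 1" by simp
  then have "case bez of (a, b) \<Rightarrow> a * int N + b * int n = - 1"
    unfolding bez_def by (rule someI)
  then show ?thesis by (simp add: case_prod_beta)
qed

definition t :: 'h where
  "t = P powi \<alpha> * U powi \<beta>"

lemma t_neq_0: "t \<noteq> 0"
  using P_neq_0 U_neq_0 by (simp add: t_def)

lemma t_in_F: "t \<in> F"
  unfolding t_def by (intro subring_mult F_subring subfield_powi subfield P_in_F U_in_F)

text \<open>Asymptotically z is c t^-k: a pole of order \<open>k\<close> (a zero for negative
  \<open>k\<close>) with leading coefficient \<open>c\<close>.\<close>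

definition lead :: "'h set \<Rightarrow> 'h \<Rightarrow> int \<Rightarrow> 'k \<Rightarrow> bool" where
  "lead V z k c \<longleftrightarrow> c \<noteq> 0 \<and> z * t powi k - \<iota> c \<in> max_ideal V"

text \<open>The order of the pole of \<open>w k\<close> at the infinite place.\<close>

definition pole :: "nat \<Rightarrow> int" where
  "pole k = int n * int k - int N * int (card Z) * int (2 * k div N)"

context
  fixes V assumes V: "place V" and PV: "P \<notin> V"
begin

lemma inverse_P: "inverse P \<in> max_ideal V"
  using not_in_place[OF V P_in_F PV] .

lemma lead_mult:
  assumes a: "lead V z k c" and b: "lead V z' k' c'"
  shows "lead V (z * z') (k + k') (c * c')"
proof -
  let ?a = "z * t powi k" and ?b = "z' * t powi k'"
  have m: "?a - \<iota> c \<in> max_ideal V" "?b - \<iota> c' \<in> max_ideal V" using a b by (auto simp: lead_def)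
  have "?b \<in> V"
    using subring_add[OF place_subring[OF V] max_ideal_sub[OF m(2)] place_const[OF V, of c']] by simp
  then have "?b * (?a - \<iota> c) + \<iota> c * (?b - \<iota> c') \<in> max_ideal V"
    by (intro max_ideal_add max_ideal_mult V m place_const)
  moreover have "?b * (?a - \<iota> c) + \<iota> c * (?b - \<iota> c') = z * z' * t powi (k + k') - \<iota> (c * c')"
    by (simp add: \<iota>_mult power_int_add t_neq_0 algebra_simps)
  ultimately show ?thesis using a b by (simp add: lead_def)
qed

lemma lead_unit:
  assumes "lead V z k c"
  shows "z * t powi k \<in> V - max_ideal V"
proof -
  have c: "\<iota> c \<in> V - max_ideal V"
    using assms place_const[OF V] max_ideal_const[OF V] by (simp add: lead_def)
  have "\<iota> c + (z * t powi k - \<iota> c) \<in> V - max_ideal V"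
    using assms by (intro unit_add_max_ideal[OF V c]) (simp add: lead_def)
  then show ?thesis by simp
qed

lemma lead_neq_0: "lead V z k c \<Longrightarrow> z \<noteq> 0"
  using iffD1[OF unit_iff lead_unit[of z k c]] by auto

lemma lead_inverse:
  assumes a: "lead V z k c"
  shows "lead V (inverse z) (- k) (inverse c)"
proof -
  let ?a = "z * t powi k"
  have c: "c \<noteq> 0" and m: "?a - \<iota> c \<in> max_ideal V" using a by (auto simp: lead_def)
  have u: "?a \<noteq> 0" "inverse ?a \<in> V" using iffD1[OF unit_iff lead_unit[OF a]] by auto
  have "- (inverse ?a * \<iota> (inverse c)) \<in> V"
    using u by (intro subring_uminus subring_mult place_subring V place_const)
  then have "- (inverse ?a * \<iota> (inverse c)) * (?a - \<iota> c) \<in> max_ideal V"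
    by (rule max_ideal_mult[OF V _ m])
  also have "- (inverse ?a * \<iota> (inverse c)) * (?a - \<iota> c) = inverse ?a - \<iota> (inverse c)"
    using c u(1) by (simp only: \<iota>_inverse) (simp add: field_simps)
  also have "inverse ?a = inverse z * t powi (- k)" by (simp add: power_int_minus)
  finally show ?thesis using c by (simp add: lead_def)
qed

lemma lead_1: "lead V 1 0 1"
  using max_ideal_0[OF V] by (simp add: lead_def)

lemma lead_power: "lead V z k c \<Longrightarrow> lead V (z ^ l) (int l * k) (c ^ l)"
proof (induction l)
  case 0
  then show ?case using lead_1 by simp
next
  case (Suc l)
  then show ?case using lead_mult[OF Suc.prems Suc.IH] by (simp add: algebra_simps)
qed

lemma lead_powi:
  assumes "lead V z k c"
  shows "lead V (z powi l) (l * k) (c powi l)"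
proof (cases "l \<ge> 0")
  case True
  then show ?thesis using lead_power[OF assms, of "nat l"] by (simp add: power_int_def)
next
  case False
  then show ?thesis using lead_power[OF lead_inverse[OF assms], of "nat (- l)"]
    by (simp add: power_int_def)
qed

lemma lead_ev_aux: "f \<noteq> 0 \<Longrightarrow> lead V (ev f * inverse P ^ degree f) 0 (lead_coeff f)"
  using poly_leading_term[OF V P_in_F PV, of f] by (simp add: lead_def ev_def)

text \<open>The right-hand side P E^2 of the curve equation is monic of degree \<open>n\<close> in
  \<open>P\<close>.\<close>

lemma lead_PU: "lead V (U ^ N * inverse P ^ n) 0 1"
proof -
  let ?D = "[:0, 1:] * Epol ^ 2"
  have D: "degree ?D = n"
    by (simp add: degree_mult_eq degree_power_eq degree_Epol n_def del: mult_pCons_left)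
  have lc: "lead_coeff ?D = 1" unfolding lead_coeff_mult lead_coeff_power Epol_monic by simp
  then have "?D \<noteq> 0" by (metis leading_coeff_0_iff one_neq_zero)
  from lead_ev_aux[OF this] show ?thesis
    unfolding lc unfolding D unfolding ev_mult ev_power ev_X UN .
qed

text \<open>The Bezout relation turns P t^N into the \<beta>-th power of U^N / P^n, which is
  congruent to 1; for \<open>lead_U\<close> the exponent is -\<alpha>.\<close>

lemma lead_P: "lead V P (int N) 1"
proof -
  have "P * t powi int N = P powi (1 + \<alpha> * int N) * U powi (\<beta> * int N)"
    unfolding t_def power_int_mult_distrib power_int_mult[symmetric]
    using power_int_add[of P 1 "\<alpha> * int N"] P_neq_0 by (simp add: mult.assoc)
  also have "1 + \<alpha> * int N = - (int n * \<beta>)" using bez by (simp add: algebra_simps)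
  also have "P powi (- (int n * \<beta>)) * U powi (\<beta> * int N) = (U ^ N * inverse P ^ n) powi \<beta>"
    by (simp add: power_int_mult_distrib power_int_minus power_int_mult power_int_inverse power_inverse mult.commute)
  finally show ?thesis using lead_powi[OF lead_PU, of \<beta>] by (simp add: lead_def)
qed

lemma lead_U: "lead V U (int n) 1"
proof -
  have "U * t powi int n = P powi (\<alpha> * int n) * U powi (1 + \<beta> * int n)"
    unfolding t_def power_int_mult_distrib power_int_mult[symmetric]
    using power_int_add[of U 1 "\<beta> * int n"] U_neq_0 by (simp add: mult_ac)
  also have "1 + \<beta> * int n = - (int N * \<alpha>)" using bez by (simp add: algebra_simps)
  also have "P powi (\<alpha> * int n) * U powi (- (int N * \<alpha>)) = (U ^ N * inverse P ^ n) powi (- \<alpha>)"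
    by (simp add: power_int_mult_distrib power_int_minus power_int_mult power_int_inverse power_inverse mult.commute)
  finally show ?thesis using lead_powi[OF lead_PU, of "- \<alpha>"] by (simp add: lead_def)
qed

lemma lead_ev:
  assumes "f \<noteq> 0"
  shows "lead V (ev f) (int N * int (degree f)) (lead_coeff f)"
proof -
  have eq: "ev f * inverse P ^ degree f * P ^ degree f = ev f"
    using P_neq_0 by (simp add: mult.assoc flip: power_mult_distrib)
  from lead_mult[OF lead_ev_aux[OF assms] lead_power[OF lead_P, of "degree f"]]
  show ?thesis unfolding eq by (simp add: mult.commute)
qed

lemma lead_w: "lead V (w k) (pole k) 1"
proof -
  have "lead V E (int N * int (card Z)) 1" using lead_ev[of Epol] Epol_monic degree_Epol by simp
  then have "lead V (inverse (E ^ (2 * k div N))) (- (int (2 * k div N) * (int N * int (card Z)))) 1"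
    using lead_inverse[OF lead_power] by fastforce
  from lead_mult[OF lead_power[OF lead_U, of k] this]
  show ?thesis by (simp add: w_def pole_def divide_inverse algebra_simps)
qed

lemma t_max_ideal: "t \<in> max_ideal V"
proof (rule max_ideal_root[OF V t_in_F _ N_pos])
  have "inverse P * (P * t powi int N) \<in> max_ideal V"
    using max_ideal_mult[OF V _ inverse_P, of "P * t powi int N"] lead_unit[OF lead_P]
    by (simp add: mult.commute)
  then show "t ^ N \<in> max_ideal V" using P_neq_0 by (simp flip: mult.assoc)
qed

lemma lead_smaller:
  assumes "lead V z k c" "k < l"
  shows "z * t powi l \<in> max_ideal V"
proof -
  have "t ^ nat (l - k) \<in> max_ideal V" using assms by (intro max_ideal_power V t_max_ideal) simp
  then have "(z * t powi k) * t ^ nat (l - k) \<in> max_ideal V"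
    using lead_unit[OF assms(1)] by (intro max_ideal_mult[OF V]) auto
  also have "(z * t powi k) * t ^ nat (l - k) = z * t powi l"
    using assms(2) t_neq_0 power_int_add[of t k "l - k"] by (simp add: power_int_def)
  finally show ?thesis .
qed

lemma lead_sum:
  assumes I: "finite I" "j \<in> I" and ld: "\<And>i. i \<in> I \<Longrightarrow> lead V (z i) (k i) (c i)"
    and less: "\<And>i. i \<in> I \<Longrightarrow> i \<noteq> j \<Longrightarrow> k i < k j"
  shows "lead V (sum z I) (k j) (c j)"
proof -
  have "(\<Sum>i\<in>I - {j}. z i * t powi k j) \<in> max_ideal V"
    by (intro max_ideal_sum V lead_smaller[OF ld less]) auto
  moreover have "z j * t powi k j - \<iota> (c j) \<in> max_ideal V" "c j \<noteq> 0"
    using ld[OF I(2)] by (auto simp: lead_def)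
  ultimately have "(z j * t powi k j - \<iota> (c j)) + (\<Sum>i\<in>I - {j}. z i * t powi k j) \<in> max_ideal V"
    by (intro max_ideal_add V)
  also have "(z j * t powi k j - \<iota> (c j)) + (\<Sum>i\<in>I - {j}. z i * t powi k j) = sum z I * t powi k j - \<iota> (c j)"
    unfolding sum.remove[OF I] sum_distrib_right[symmetric] by (simp add: algebra_simps)
  finally show ?thesis using \<open>c j \<noteq> 0\<close> by (simp add: lead_def)
qed

end

end

section \<open>Coordinates with respect to the elements \<open>w k\<close>\<close>

context kummer_curve
begin

definition comb_degree :: "(nat \<Rightarrow> 'k poly) \<Rightarrow> nat \<Rightarrow> int" where
  "comb_degree a i = int N * int (degree (a i)) + pole i"

text \<open>Modulo \<open>N\<close> the pole order of the i-th term is n i, and \<open>n\<close> is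
  invertible modulo \<open>N\<close>. So distinct terms of a combination have distinct pole orders
  and cannot cancel.\<close>

lemma comb_degree_inj:
  assumes "i < N" "j < N" "comb_degree a i = comb_degree b j"
  shows "i = j"
proof -
  have "int n * (int i - int j) = int N * (int (degree (b j)) - int (degree (a i)) +
      int (card Z) * (int (2 * i div N) - int (2 * j div N)))"
    using assms(3) by (simp add: comb_degree_def pole_def algebra_simps)
  then have "int N dvd int n * (int i - int j)" by simp
  moreover have "coprime (int N) (int n)" using cop unfolding n_def coprime_int_iff .
  ultimately have "int N dvd int i - int j" by (simp add: coprime_dvd_mult_right_iff)
  then have "int i mod int N = int j mod int N" by (simp add: mod_eq_dvd_iff)
  then show "i = j" using assms(1,2) by simp
qed

lemma comb_1: "comb 1 a = (\<Sum>i<N. ev (a i) * w i)"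
  by (simp add: comb_def)

text \<open>The dominating index \<open>j\<close> depends only on the degrees of the
  \<open>a i\<close> and the pole orders, hence is chosen before the place \<open>V\<close>; this
  later gives uniqueness of the place at infinity.\<close>

lemma comb_lead:
  assumes "i0 < N" "a i0 \<noteq> 0"
  shows "\<exists>j<N. a j \<noteq> 0 \<and> (\<forall>i<N. a i \<noteq> 0 \<longrightarrow> comb_degree a i \<le> comb_degree a j) \<and>
    (\<forall>V. place V \<longrightarrow> P \<notin> V \<longrightarrow> lead V (comb 1 a) (comb_degree a j) (lead_coeff (a j)))"
proof -
  let ?I = "{i. i < N \<and> a i \<noteq> 0}"
  let ?D = "comb_degree a"
  have I: "finite ?I" "?I \<noteq> {}" using assms by auto
  have "Max (?D ` ?I) \<in> ?D ` ?I" using I by (intro Max_in) auto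
  then obtain j where j: "j \<in> ?I" "?D j = Max (?D ` ?I)" by auto
  have max: "?D i \<le> ?D j" if "i \<in> ?I" for i
    unfolding j(2) using I that by (intro Max_ge) auto
  have "lead V (comb 1 a) (?D j) (lead_coeff (a j))" if V: "place V" "P \<notin> V" for V
  proof -
    have "comb 1 a = (\<Sum>i\<in>?I. ev (a i) * w i)"
      unfolding comb_1 by (rule sum.mono_neutral_right) auto
    moreover have "lead V (\<Sum>i\<in>?I. ev (a i) * w i) (?D j) (lead_coeff (a j))"
    proof (rule lead_sum[OF V I(1) j(1), where k = ?D and c = "\<lambda>i. lead_coeff (a i)"])
      fix i assume i: "i \<in> ?I"
      then show "lead V (ev (a i) * w i) (?D i) (lead_coeff (a i))"
        using lead_mult[OF V lead_ev[OF V, of "a i"] lead_w[OF V, of i]]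
        by (simp add: comb_degree_def)
      assume "i \<noteq> j"
      then have "?D i \<noteq> ?D j" using comb_degree_inj[of i j a a] i j by auto
      then show "?D i < ?D j" using max[OF i] by simp
    qed
    ultimately show ?thesis by simp
  qed
  then show ?thesis using j(1) max by blast
qed

lemma infinite_place_exists: "\<exists>V. place V \<and> P \<notin> V"
  using place_exists[OF subring_range _ const P_in_F P_not_integral] by blast

lemma comb_eq_0: "comb 1 a = 0 \<Longrightarrow> i < N \<Longrightarrow> a i = 0"
proof (rule ccontr)
  assume a: "comb 1 a = 0" "i < N" "a i \<noteq> 0"
  obtain V where V: "place V" "P \<notin> V" using infinite_place_exists by blast
  obtain j where "lead V (comb 1 a) (comb_degree a j) (lead_coeff (a j))"
    using comb_lead[of i a] a V by blast
  then show False using lead_neq_0[OF V] a(1) by blast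
qed

lemma comb_diff: "comb \<zeta> a - comb \<zeta> b = comb \<zeta> (\<lambda>i. a i - b i)"
  by (simp add: comb_def ev_diff left_diff_distrib sum_subtractf)

lemma comb_scale: "ev f * comb \<zeta> a = comb \<zeta> (\<lambda>i. f * a i)"
  by (simp add: comb_def ev_mult sum_distrib_left mult.assoc)

lemma comb_sum: "(\<Sum>x\<in>A. comb \<zeta> (a x)) = comb \<zeta> (\<lambda>i. \<Sum>x\<in>A. a x i)"
  unfolding comb_def ev_sum sum_distrib_right by (rule sum.swap)

lemma comb_cong: "(\<And>i. i < N \<Longrightarrow> a i = b i) \<Longrightarrow> comb \<zeta> a = comb \<zeta> b"
  unfolding comb_def by (rule sum.cong) auto

lemma comb_eq: "comb 1 a = comb 1 b \<Longrightarrow> i < N \<Longrightarrow> a i = b i"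
  using comb_eq_0[of "\<lambda>i. a i - b i" i] comb_diff[of 1 a b] by simp

lemma root_mod:
  assumes "\<zeta> ^ N = (1 :: 'k)"
  shows "\<zeta> ^ (l mod N) = \<zeta> ^ l"
proof -
  have "\<zeta> ^ l = \<zeta> ^ (N * (l div N) + l mod N)" by simp
  also have "\<dots> = \<zeta> ^ (l mod N)" unfolding power_add power_mult assms by simp
  finally show ?thesis by simp
qed

lemma comb_single:
  assumes "\<zeta> ^ N = 1"
  shows "ev f * \<iota> (\<zeta> ^ l) * w l = comb \<zeta> (\<lambda>i. if i = l mod N then f * [:0, 1:] ^ (l div N) else 0)"
proof -
  have "comb \<zeta> (\<lambda>i. if i = l mod N then f * [:0, 1:] ^ (l div N) else 0)
    = (\<Sum>i<N. if i = l mod N then ev (f * [:0, 1:] ^ (l div N)) * \<iota> (\<zeta> ^ i) * w i else 0)"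
    unfolding comb_def by (rule sum.cong) auto
  also have "\<dots> = ev (f * [:0, 1:] ^ (l div N)) * \<iota> (\<zeta> ^ (l mod N)) * w (l mod N)"
    using N_pos by simp
  also have "\<dots> = ev f * \<iota> (\<zeta> ^ l) * (P ^ (l div N) * w (l mod N))"
    unfolding ev_mult ev_power ev_X root_mod[OF assms] by (simp only: mult_ac)
  also have "P ^ (l div N) * w (l mod N) = w l" by (rule w_mod[symmetric])
  finally show ?thesis by simp
qed

text \<open>The product in coordinates, with i + j reduced modulo \<open>N\<close>. It does not
  involve \<zeta>, which is why conjugation is multiplicative.\<close>

definition cmul :: "(nat \<Rightarrow> 'k poly) \<Rightarrow> (nat \<Rightarrow> 'k poly) \<Rightarrow> nat \<Rightarrow> 'k poly" where
  "cmul a b l = (\<Sum>i<N. \<Sum>j<N. if l = (i + j) mod N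
     then (a i * b j * Epol ^ carry i j) * [:0, 1:] ^ ((i + j) div N) else 0)"

lemma comb_mult:
  assumes "\<zeta> ^ N = 1"
  shows "comb \<zeta> a * comb \<zeta> b = comb \<zeta> (cmul a b)"
proof -
  have "comb \<zeta> a * comb \<zeta> b =
    (\<Sum>i<N. \<Sum>j<N. (ev (a i) * \<iota> (\<zeta> ^ i) * w i) * (ev (b j) * \<iota> (\<zeta> ^ j) * w j))"
    unfolding comb_def by (rule sum_product)
  also have "\<dots> = (\<Sum>i<N. \<Sum>j<N. ev (a i * b j * Epol ^ carry i j) * \<iota> (\<zeta> ^ (i + j)) * w (i + j))"
  proof (intro sum.cong refl)
    fix i j
    have "(ev (a i) * \<iota> (\<zeta> ^ i) * w i) * (ev (b j) * \<iota> (\<zeta> ^ j) * w j) =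
      ev (a i) * ev (b j) * (\<iota> (\<zeta> ^ i) * \<iota> (\<zeta> ^ j)) * (w i * w j)" by (simp only: mult_ac)
    also have "\<dots> = ev (a i * b j * Epol ^ carry i j) * \<iota> (\<zeta> ^ (i + j)) * w (i + j)"
      unfolding w_mult ev_mult ev_power power_add \<iota>_mult by (simp only: mult_ac)
    finally show "(ev (a i) * \<iota> (\<zeta> ^ i) * w i) * (ev (b j) * \<iota> (\<zeta> ^ j) * w j) =
      ev (a i * b j * Epol ^ carry i j) * \<iota> (\<zeta> ^ (i + j)) * w (i + j)" .
  qed
  also have "\<dots> = comb \<zeta> (cmul a b)"
    unfolding comb_single[OF assms] comb_sum cmul_def ..
  finally show ?thesis .
qed

text \<open>The span of the \<open>w i\<close> over K(P), written with a common denominator; it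
  turns out to be all of \<open>F\<close>.\<close>

definition F' :: "'h set" where
  "F' = {z. \<exists>g a. g \<noteq> 0 \<and> ev g * z = comb 1 a}"

lemma F'I: "g \<noteq> 0 \<Longrightarrow> ev g * z = comb 1 a \<Longrightarrow> z \<in> F'"
  unfolding F'_def by blast

lemma ev_comb: "\<zeta> ^ N = 1 \<Longrightarrow> ev f = comb \<zeta> (\<lambda>i. if i = 0 then f else 0)"
  using comb_single[of \<zeta> f 0] unfolding div_0 mod_0 power_0 mult_1_right by simp

lemma comb_in_F': "comb 1 a \<in> F'"
  by (rule F'I[of 1]) simp_all

lemma F'_subring: "is_subring F'"
  unfolding is_subring_def
proof (intro conjI ballI)
  show "1 \<in> F'" using ev_comb[of 1 1] by (intro F'I[of 1]) simp_all
  fix x y assume "x \<in> F'" "y \<in> F'"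
  then obtain g a h b where x: "g \<noteq> 0" "ev g * x = comb 1 a" and y: "h \<noteq> 0" "ev h * y = comb 1 b"
    unfolding F'_def by blast
  have "ev (g * h) * (x - y) = ev h * (ev g * x) - ev g * (ev h * y)"
    by (simp add: ev_mult algebra_simps)
  also have "\<dots> = comb 1 (\<lambda>i. h * a i - g * b i)" unfolding x y comb_scale comb_diff ..
  finally show "x - y \<in> F'" using x y by (intro F'I[of "g * h"]) auto
  have "ev (g * h) * (x * y) = (ev g * x) * (ev h * y)"
    by (simp add: ev_mult algebra_simps)
  also have "\<dots> = comb 1 (cmul a b)" unfolding x y by (simp add: comb_mult)
  finally show "x * y \<in> F'" using x y by (intro F'I[of "g * h"]) auto
qed

text \<open>N + 1 powers of an element live in an N-dimensional space over K(P). Cancelling the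
  lowest power of \<open>z\<close> produces the nonzero constant term, which is what allows
  inversion.\<close>

lemma algebraic_relation_F':
  assumes z: "z \<in> F'" "z \<noteq> 0"
  shows "\<exists>c k. c 0 \<noteq> 0 \<and> (\<Sum>i\<le>k. ev (c i) * z ^ i) = 0"
proof -
  obtain g a where g: "g \<noteq> 0" "ev g * z = comb 1 a" using z unfolding F'_def by blast
  have "\<exists>p. \<forall>j. comb 1 a ^ j = comb 1 (p j)"
  proof (rule choice, rule allI)
    fix j show "\<exists>p. comb 1 a ^ j = comb 1 p"
    proof (induction j)
      case 0
      show ?case using ev_comb[of 1 1] by (intro exI) simp
    next
      case (Suc j)
      then obtain p where "comb 1 a ^ j = comb 1 p" by blast
      then have "comb 1 a ^ Suc j = comb 1 (cmul a p)" by (simp add: comb_mult)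
      then show ?case by blast
    qed
  qed
  then obtain p where p: "\<And>j. comb 1 a ^ j = comb 1 (p j)" by blast
  have "\<exists>c. (\<exists>j\<in>{..N}. c j \<noteq> 0) \<and> (\<forall>i\<in>{..<N}. (\<Sum>j\<in>{..N}. c j * p j i) = 0)"
    by (rule nontrivial_linear_relation) auto
  then obtain c where c: "\<exists>j\<le>N. c j \<noteq> 0" "\<And>i. i < N \<Longrightarrow> (\<Sum>j\<le>N. c j * p j i) = 0" by auto
  have "(\<Sum>j\<le>N. ev (c j * g ^ j) * z ^ j) = (\<Sum>j\<le>N. ev (c j) * comb 1 a ^ j)"
    unfolding g(2)[symmetric] ev_mult ev_power power_mult_distrib by (simp only: mult.assoc)
  also have "\<dots> = comb 1 (\<lambda>i. \<Sum>j\<le>N. c j * p j i)" unfolding p comb_scale comb_sum ..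
  also have "\<dots> = comb 1 (\<lambda>i. 0)" by (rule comb_cong) (rule c(2))
  also have "\<dots> = 0" by (simp add: comb_def)
  finally have rel: "(\<Sum>j\<le>N. ev (c j * g ^ j) * z ^ j) = 0" .
  define j0 where "j0 = (LEAST j. c j \<noteq> 0)"
  obtain j1 where j1: "j1 \<le> N" "c j1 \<noteq> 0" using c(1) by blast
  have j0: "c j0 \<noteq> 0" unfolding j0_def by (rule LeastI[of _ j1]) (rule j1)
  have "j0 \<le> j1" unfolding j0_def by (rule Least_le) (rule j1)
  then have j0N: "j0 \<le> N" using j1 by simp
  have below: "c j = 0" if "j < j0" for j using not_less_Least[of j "\<lambda>j. c j \<noteq> 0"] that by (auto simp: j0_def)
  have "(\<Sum>j\<le>N. ev (c j * g ^ j) * z ^ j) = (\<Sum>j\<in>{j0..N}. ev (c j * g ^ j) * z ^ j)"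
    by (rule sum.mono_neutral_right) (auto simp: below)
  also have "\<dots> = (\<Sum>i\<le>N - j0. ev (c (i + j0) * g ^ (i + j0)) * z ^ (i + j0))"
    by (rule sum.reindex_bij_witness[of _ "\<lambda>i. i + j0" "\<lambda>j. j - j0"]) (use j0N in auto)
  also have "\<dots> = z ^ j0 * (\<Sum>i\<le>N - j0. ev (c (i + j0) * g ^ (i + j0)) * z ^ i)"
    unfolding sum_distrib_left power_add by (simp only: mult_ac)
  finally have "(\<Sum>i\<le>N - j0. ev (c (i + j0) * g ^ (i + j0)) * z ^ i) = 0"
    using rel z by simp
  then show ?thesis using j0 g(1)
    by (intro exI[of _ "\<lambda>i. c (i + j0) * g ^ (i + j0)"] exI[of _ "N - j0"]) simp
qed

lemma relation_constant_term:
  fixes c :: "nat \<Rightarrow> 'h"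
  assumes "(\<Sum>i\<le>k. c i * z ^ i) = 0"
  shows "c 0 = - (z * (\<Sum>i<k. c (Suc i) * z ^ i))"
proof -
  have "(\<Sum>i\<le>k. c i * z ^ i) = c 0 + (\<Sum>i<k. c (Suc i) * z ^ Suc i)"
    by (simp add: lessThan_Suc_atMost[symmetric] sum.lessThan_Suc_shift del: sum.lessThan_Suc)
  also have "(\<Sum>i<k. c (Suc i) * z ^ Suc i) = z * (\<Sum>i<k. c (Suc i) * z ^ i)"
    unfolding sum_distrib_left power_Suc by (simp only: mult_ac)
  finally show ?thesis using assms by (simp add: eq_neg_iff_add_eq_0)
qed

text \<open>A relation with nonzero constant term writes \<open>1/z\<close> as a polynomial in
  \<open>z\<close>, so the span is a field; it contains \<open>P\<close> and
  \<open>U\<close>.\<close>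

lemma F'_eq: "F' = F"
proof
  show "F' \<subseteq> F"
  proof
    fix z assume "z \<in> F'"
    then obtain g a where g: "g \<noteq> 0" "ev g * z = comb 1 a" unfolding F'_def by blast
    then have "z = comb 1 a / ev g" by (simp add: field_simps)
    then show "z \<in> F" using subfield_divide[OF subfield comb_in_F ev_in_F] by simp
  qed
  have evF: "ev f \<in> F'" for f using comb_in_F' ev_comb[of 1 f] by simp
  have ievF: "inverse (ev f) \<in> F'" if "f \<noteq> 0" for f
    using that ev_comb[of 1 1] by (intro F'I[of f]) simp_all
  have "inverse z \<in> F'" if z: "z \<in> F'" for z
  proof (cases "z = 0")
    case True
    then show ?thesis using subring_0[OF F'_subring] by simp
  next
    case False
    obtain c k where c: "c 0 \<noteq> 0" "(\<Sum>i\<le>k. ev (c i) * z ^ i) = 0"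
      using algebraic_relation_F'[OF z False] by blast
    have "ev (c 0) = - (z * (\<Sum>i<k. ev (c (Suc i)) * z ^ i))"
      using relation_constant_term[OF c(2)] .
    then have *: "inverse z * ev (c 0) = - (\<Sum>i<k. ev (c (Suc i)) * z ^ i)"
      using False by (simp flip: mult.assoc)
    then have "inverse z = inverse (ev (c 0)) * - (\<Sum>i<k. ev (c (Suc i)) * z ^ i)"
      unfolding *[symmetric] using c(1) by simp
    also have "\<dots> \<in> F'"
      by (intro subring_mult subring_uminus subring_sum subring_power F'_subring ievF c evF z)
    finally show ?thesis .
  qed
  then have "is_subfield F'" using F'_subring unfolding is_subfield_def is_subring_def by blast
  moreover have "range \<iota> \<subseteq> F'" using evF[of "[:c:]" for c] by (auto simp: ev_const)
  moreover have "U \<in> F'"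
  proof -
    have "U = ev (Epol ^ (2 * 1 div N)) * \<iota> (1 ^ 1) * w 1"
      using U_w[of 1] by (simp only: ev_power power_one_right \<iota>_1 mult_1_right)
    also have "\<dots> \<in> F'" by (subst comb_single) (simp, rule comb_in_F')
    finally show ?thesis .
  qed
  moreover have "P \<in> F'" using evF[of "[:0, 1:]"] by (simp add: ev_X)
  ultimately show "F \<subseteq> F'" by (intro adjoin_least) auto
qed

lemma F_elem:
  assumes "z \<in> F"
  obtains g a where "g \<noteq> 0" "ev g * z = comb 1 a"
  using assms unfolding F'_eq[symmetric] F'_def by blast

lemma algebraic_relation:
  assumes "z \<in> F" "z \<noteq> 0"
  obtains c k where "c 0 \<noteq> 0" "(\<Sum>i\<le>k. ev (c i) * z ^ i) = 0"
  using algebraic_relation_F' assms unfolding F'_eq by blast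

text \<open>The Kummer automorphism that fixes \<open>P\<close> and maps \<open>U\<close> to \<open>\<zeta> U\<close>.\<close>

definition sig :: "'k \<Rightarrow> 'h \<Rightarrow> 'h" where
  "sig \<zeta> z = (SOME y. \<exists>g a. g \<noteq> 0 \<and> ev g * z = comb 1 a \<and> ev g * y = comb \<zeta> a)"

text \<open>Two representations of \<open>z\<close> agree after cross-multiplying the denominators,
  since coordinates are unique; so the \<open>SOME\<close> in \<open>sig\<close> does no
  harm.\<close>

lemma sig_eq:
  assumes g: "g \<noteq> 0" "ev g * z = comb 1 a"
  shows "ev g * sig \<zeta> z = comb \<zeta> a"
proof -
  have "ev g * (comb \<zeta> a / ev g) = comb \<zeta> a" using g by simp
  then have "\<exists>y g a. g \<noteq> 0 \<and> ev g * z = comb 1 a \<and> ev g * y = comb \<zeta> a" using g by blast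
  then have "\<exists>g a. g \<noteq> 0 \<and> ev g * z = comb 1 a \<and> ev g * sig \<zeta> z = comb \<zeta> a"
    unfolding sig_def by (rule someI_ex)
  then obtain h b where h: "h \<noteq> 0" "ev h * z = comb 1 b" "ev h * sig \<zeta> z = comb \<zeta> b" by blast
  have "comb 1 (\<lambda>i. h * a i) = ev h * (ev g * z)" unfolding g comb_scale ..
  also have "\<dots> = ev g * (ev h * z)" by (simp only: mult_ac)
  also have "\<dots> = comb 1 (\<lambda>i. g * b i)" unfolding h comb_scale ..
  finally have "h * a i = g * b i" if "i < N" for i using comb_eq that by blast
  then have "comb \<zeta> (\<lambda>i. h * a i) = comb \<zeta> (\<lambda>i. g * b i)" by (rule comb_cong)
  then have "ev h * comb \<zeta> a = ev g * (ev h * sig \<zeta> z)" unfolding h(3) comb_scale .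
  then have "ev h * comb \<zeta> a = ev h * (ev g * sig \<zeta> z)" by (simp only: mult_ac)
  then show ?thesis using h(1) by simp
qed

lemma sig_unique: "g \<noteq> 0 \<Longrightarrow> ev g * z = comb 1 a \<Longrightarrow> ev g * y = comb \<zeta> a \<Longrightarrow> sig \<zeta> z = y"
  using sig_eq[of g z a \<zeta>] by (metis ev_eq_0_iff mult_left_cancel)

lemma sig_in_F:
  assumes "z \<in> F"
  shows "sig \<zeta> z \<in> F"
proof -
  obtain g a where g: "g \<noteq> 0" "ev g * z = comb 1 a" using F_elem[OF assms] .
  from sig_eq[OF this, of \<zeta>] have "sig \<zeta> z = comb \<zeta> a / ev g" using g(1) by (simp add: field_simps)
  then show ?thesis using subfield_divide[OF subfield comb_in_F ev_in_F] by simp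
qed

lemma sig_ev:
  assumes "\<zeta> ^ N = 1"
  shows "sig \<zeta> (ev f) = ev f"
  using ev_comb[OF assms, of f] ev_comb[of 1 f] by (intro sig_unique[of 1]) simp_all

lemma sig_diff:
  assumes "x \<in> F" "y \<in> F"
  shows "sig \<zeta> (x - y) = sig \<zeta> x - sig \<zeta> y"
proof -
  obtain g a where x: "g \<noteq> 0" "ev g * x = comb 1 a" using F_elem[OF assms(1)] .
  obtain h b where y: "h \<noteq> 0" "ev h * y = comb 1 b" using F_elem[OF assms(2)] .
  have *: "ev (g * h) * (u - v) = ev h * (ev g * u) - ev g * (ev h * v)" for u v
    by (simp add: ev_mult algebra_simps)
  show ?thesis
  proof (rule sig_unique)
    show "g * h \<noteq> 0" using x y by simp
    show "ev (g * h) * (x - y) = comb 1 (\<lambda>i. h * a i - g * b i)"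
      unfolding * x(2) y(2) comb_scale comb_diff ..
    show "ev (g * h) * (sig \<zeta> x - sig \<zeta> y) = comb \<zeta> (\<lambda>i. h * a i - g * b i)"
      unfolding * sig_eq[OF x] sig_eq[OF y] comb_scale comb_diff ..
  qed
qed

lemma sig_mult:
  assumes \<zeta>: "\<zeta> ^ N = 1" and "x \<in> F" "y \<in> F"
  shows "sig \<zeta> (x * y) = sig \<zeta> x * sig \<zeta> y"
proof -
  obtain g a where x: "g \<noteq> 0" "ev g * x = comb 1 a" using F_elem[OF assms(2)] .
  obtain h b where y: "h \<noteq> 0" "ev h * y = comb 1 b" using F_elem[OF assms(3)] .
  have *: "ev (g * h) * (u * v) = (ev g * u) * (ev h * v)" for u v
    unfolding ev_mult by (simp only: mult_ac)
  show ?thesis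
  proof (rule sig_unique)
    show "g * h \<noteq> 0" using x y by simp
    show "ev (g * h) * (x * y) = comb 1 (cmul a b)"
      unfolding * x(2) y(2) by (rule comb_mult) simp
    show "ev (g * h) * (sig \<zeta> x * sig \<zeta> y) = comb \<zeta> (cmul a b)"
      unfolding * sig_eq[OF x] sig_eq[OF y] by (rule comb_mult[OF \<zeta>])
  qed
qed

lemma sig_sig:
  assumes "x \<in> F" "\<zeta> * \<zeta>' = 1"
  shows "sig \<zeta> (sig \<zeta>' x) = x"
proof -
  obtain g a where x: "g \<noteq> 0" "ev g * x = comb 1 a" using F_elem[OF assms(1)] .
  have 1: "comb \<zeta>' a = comb 1 (\<lambda>i. [:\<zeta>' ^ i:] * a i)"
    unfolding comb_def ev_mult ev_const by (simp add: mult_ac)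
  have "\<zeta>' ^ i * \<zeta> ^ i = 1" for i
    using assms(2) by (simp add: mult.commute flip: power_mult_distrib)
  then have 2: "\<iota> (\<zeta>' ^ i) * \<iota> (\<zeta> ^ i) = 1" for i by (simp flip: \<iota>_mult)
  have "comb \<zeta> (\<lambda>i. [:\<zeta>' ^ i:] * a i) = (\<Sum>i<N. ev (a i) * (\<iota> (\<zeta>' ^ i) * \<iota> (\<zeta> ^ i)) * w i)"
    unfolding comb_def ev_mult ev_const by (simp only: mult_ac)
  then have 3: "comb \<zeta> (\<lambda>i. [:\<zeta>' ^ i:] * a i) = ev g * x" unfolding 2 x(2) comb_1 by simp
  show ?thesis
    by (rule sig_unique[OF x(1)]) (use sig_eq[OF x, of \<zeta>'] 1 3 in auto)
qed

text \<open>The preimage of a place under an automorphism over the constants. As \<open>R\<close>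
  will be an intersection of places, this gives its stability under conjugation.\<close>

lemma sig_place:
  assumes V: "place V" and \<zeta>: "\<zeta> ^ N = 1"
  shows "place {z\<in>F. sig \<zeta> z \<in> V}"
  unfolding valuation_ring_def
proof (intro conjI ballI)
  let ?V = "{z\<in>F. sig \<zeta> z \<in> V}"
  obtain x where x: "x \<in> F" "x \<notin> V" using place_neq[OF V] by blast
  obtain \<zeta>' where z': "\<zeta> * \<zeta>' = 1"
    using \<zeta> N_pos by (metis gr0_implies_Suc power_Suc)
  have "sig \<zeta>' x \<in> F" "sig \<zeta>' x \<notin> ?V" using x sig_sig[OF x(1) z'] sig_in_F by auto
  then show "?V \<subset> F" by auto
  have sub: "range \<iota> \<subseteq> ?V"
    using sig_ev[OF \<zeta>, of "[:c:]" for c] const place_const[OF V] by (auto simp: ev_const)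
  fix a b assume a: "a \<in> ?V" and b: "b \<in> ?V"
  show "a - b \<in> ?V" using a b sig_diff[of a b \<zeta>] subring_diff[OF place_subring[OF V]]
      subring_diff[OF F_subring] by auto
  show "a * b \<in> ?V" using a b sig_mult[OF \<zeta>, of a b] subring_mult[OF place_subring[OF V]]
      subring_mult[OF F_subring] by auto
next
  let ?V = "{z\<in>F. sig \<zeta> z \<in> V}"
  fix z assume z: "z \<in> F"
  have sig_inverse: "sig \<zeta> (inverse z) = inverse (sig \<zeta> z)" if "z \<noteq> 0"
  proof -
    have "sig \<zeta> z * sig \<zeta> (inverse z) = sig \<zeta> (ev 1)"
      using sig_mult[OF \<zeta> z subfield_inverse[OF subfield z]] that by simp
    then have "sig \<zeta> z * sig \<zeta> (inverse z) = 1" unfolding sig_ev[OF \<zeta>] by simp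
    then show ?thesis by (rule inverse_unique[symmetric])
  qed
  show "z \<in> ?V \<or> inverse z \<in> ?V"
    using place_cases[OF V sig_in_F[OF z, of \<zeta>]] sig_inverse z subfield_inverse[OF subfield z]
      sig_ev[OF \<zeta>, of 0] subring_0[OF place_subring[OF V]]
    by (cases "z = 0") auto
next
  let ?V = "{z\<in>F. sig \<zeta> z \<in> V}"
  have sub: "range \<iota> \<subseteq> ?V"
    using sig_ev[OF \<zeta>, of "[:c:]" for c] const place_const[OF V] by (auto simp: ev_const)
  obtain x where x: "x \<in> V" "x \<notin> range \<iota>" using V unfolding valuation_ring_def by blast
  obtain \<zeta>' where z': "\<zeta> * \<zeta>' = 1"
    using \<zeta> N_pos by (metis gr0_implies_Suc power_Suc)
  have xF: "x \<in> F" using place_sub[OF V x(1)] .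
  have "sig \<zeta>' x \<in> ?V" using sig_in_F[OF xF] sig_sig[OF xF z'] x by simp
  moreover have "sig \<zeta>' x \<notin> range \<iota>"
  proof
    assume "sig \<zeta>' x \<in> range \<iota>"
    then obtain c where "sig \<zeta>' x = ev [:c:]" by (auto simp: ev_const)
    then have "x = ev [:c:]" using sig_sig[OF xF z'] sig_ev[OF \<zeta>] by simp
    then show False using x by (simp add: ev_const)
  qed
  ultimately show "range \<iota> \<subset> ?V" using sub by blast
qed

end

section \<open>The integral closure of the polynomial ring\<close>

lemma finite_field_power:
  fixes z :: "'k::{field,finite}"
  assumes "z \<noteq> 0"
  shows "z ^ (card (UNIV :: 'k set) - 1) = 1"
proof -
  let ?S = "UNIV - {0 :: 'k}"
  have "(\<Prod>y\<in>?S. z * y) = (\<Prod>y\<in>?S. y)"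
    by (rule prod.reindex_bij_witness[of _ "\<lambda>y. y / z" "\<lambda>y. z * y"]) (use assms in auto)
  then have "z ^ card ?S * (\<Prod>y\<in>?S. y) = (\<Prod>y\<in>?S. y)" by (simp add: prod.distrib)
  moreover have "(\<Prod>y\<in>?S. y) \<noteq> 0" by simp
  ultimately have "z ^ card ?S = 1" by simp
  then show ?thesis by (simp add: card_Diff_singleton)
qed

lemma card_power_eq_le:
  fixes c :: "'k::idom"
  assumes "h > 0"
  shows "card {z. z ^ h = c} \<le> h" "finite {z. z ^ h = c}"
proof -
  let ?p = "monom 1 h - [:c:]"
  have "coeff ?p h = 1" using assms by (cases h) auto
  then have p0: "?p \<noteq> 0" by (metis coeff_0 zero_neq_one)
  have "degree ?p \<le> h" by (rule degree_diff_le) (auto simp: degree_monom_le)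
  moreover have "{z. z ^ h = c} = {z. poly ?p z = 0}" by (auto simp: poly_monom)
  ultimately show "card {z. z ^ h = c} \<le> h" "finite {z. z ^ h = c}"
    using card_poly_roots_bound[OF p0] poly_roots_finite[OF p0] by auto
qed

text \<open>Instead of cyclicity of the multiplicative group: raising to the power \<open>h\<close>
  maps the nonzero elements to N-th roots of unity, and each fiber has at most \<open>h\<close>
  elements.\<close>

lemma card_roots_of_unity:
  assumes N: "N > 0" and dvd: "N dvd card (UNIV :: 'k::{field,finite} set) - 1"
  shows "card {z :: 'k. z ^ N = 1} = N"
proof (rule antisym)
  show "card {z :: 'k. z ^ N = 1} \<le> N" by (rule card_power_eq_le[OF N])
  have "card {0 :: 'k, 1} \<le> card (UNIV :: 'k set)" by (rule card_mono) auto
  then have q: "card (UNIV :: 'k set) - 1 > 0" by simp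
  obtain h where h: "card (UNIV :: 'k set) - 1 = N * h" using dvd by (elim dvdE)
  then have h0: "h > 0" using q by (cases h) auto
  have "UNIV - {0 :: 'k} \<subseteq> (\<Union>c\<in>{z :: 'k. z ^ N = 1}. {z. z ^ h = c})"
  proof
    fix z :: 'k assume "z \<in> UNIV - {0}"
    then have "z ^ (h * N) = 1" using finite_field_power[of z] h by (simp add: mult.commute)
    then show "z \<in> (\<Union>c\<in>{z :: 'k. z ^ N = 1}. {z. z ^ h = c})" by (simp add: power_mult)
  qed
  then have "card (UNIV - {0 :: 'k}) \<le> card (\<Union>c\<in>{z :: 'k. z ^ N = 1}. {z. z ^ h = c})"
    by (rule card_mono[rotated]) simp
  also have "\<dots> \<le> (\<Sum>c\<in>{z :: 'k. z ^ N = 1}. card {z. z ^ h = c})" by (rule card_UN_le) simp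
  also have "\<dots> \<le> (\<Sum>c\<in>{z :: 'k. z ^ N = 1}. h)" by (intro sum_mono card_power_eq_le h0)
  finally have "N * h \<le> card {z :: 'k. z ^ N = 1} * h" using h by (simp add: card_Diff_singleton)
  then show "N \<le> card {z :: 'k. z ^ N = 1}" using h0 by simp
qed

text \<open>Translation by 1 permutes the elements, so it does not change their sum.\<close>

lemma of_nat_card_field: "of_nat (card (UNIV :: 'k set)) = (0 :: 'k::{ring_1,finite})"
proof -
  have "(\<Sum>x\<in>UNIV. x + 1) = (\<Sum>x\<in>UNIV. x :: 'k)"
    by (rule sum.reindex_bij_witness[of _ "\<lambda>x. x - 1" "\<lambda>x. x + 1"]) auto
  then show ?thesis by (simp add: sum.distrib)
qed

lemma of_nat_dvd_card_neq_0:
  assumes "N dvd card (UNIV :: 'k set) - 1"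
  shows "of_nat N \<noteq> (0 :: 'k::{field,finite})"
proof
  assume "of_nat N = (0 :: 'k)"
  moreover obtain h where h: "card (UNIV :: 'k set) - 1 = N * h" using assms by (elim dvdE)
  moreover have "card (UNIV :: 'k set) > 0" by (rule finite_UNIV_card_ge_0) simp
  ultimately have "of_nat (card (UNIV :: 'k set)) = (1 :: 'k)"
    by (metis Suc_diff_1 add.right_neutral mult_zero_left of_nat_Suc of_nat_mult)
  then show False using of_nat_card_field[where 'k = 'k] by simp
qed

lemma sum_roots_of_unity:
  assumes N: "N > 0" "N dvd card (UNIV :: 'k::{field,finite} set) - 1"
  shows "(\<Sum>z\<in>{z :: 'k. z ^ N = 1}. z ^ k) = (if N dvd k then of_nat N else 0)"
proof (cases "N dvd k")
  case True
  then have "(\<Sum>z\<in>{z :: 'k. z ^ N = 1}. z ^ k) = (\<Sum>z\<in>{z :: 'k. z ^ N = 1}. 1)"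
    by (intro sum.cong) (auto elim!: dvdE simp: power_mult)
  then show ?thesis using True card_roots_of_unity[OF N] by simp
next
  case False
  let ?\<mu> = "{z :: 'k. z ^ N = 1}"
  have k: "k mod N > 0" "k mod N < N" using False N(1) by (auto simp: dvd_eq_mod_eq_0)
  \<comment> \<open>There are \<open>N\<close> roots of unity but at most \<open>k mod N\<close>
    solutions of the smaller equation. So some \<open>c\<close> has \<open>c ^ k\<close> different
    from 1, and scaling by \<open>c\<close> kills the sum.\<close>
  have "\<not> ?\<mu> \<subseteq> {z. z ^ (k mod N) = 1}"
  proof
    assume "?\<mu> \<subseteq> {z. z ^ (k mod N) = 1}"
    then have "card ?\<mu> \<le> card {z :: 'k. z ^ (k mod N) = 1}" by (rule card_mono[rotated]) simp
    then show False using card_power_eq_le(1)[OF k(1), of "1 :: 'k"] card_roots_of_unity[OF N] k(2)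
      by linarith
  qed
  then obtain c where c: "c ^ N = 1" "c ^ (k mod N) \<noteq> (1 :: 'k)" by blast
  have "c ^ k = c ^ (N * (k div N) + k mod N)" by simp
  also have "\<dots> = c ^ (k mod N)" unfolding power_add power_mult c(1) by simp
  finally have ck: "c ^ k \<noteq> 1" using c(2) by simp
  have c0: "c \<noteq> 0" using c(1) N(1) by (auto simp: zero_power)
  have "(\<Sum>z\<in>?\<mu>. z ^ k) = (\<Sum>z\<in>?\<mu>. (c * z) ^ k)"
    by (rule sum.reindex_bij_witness[of _ "\<lambda>z. c * z" "\<lambda>z. z / c"])
       (use c0 c(1) in \<open>auto simp: power_mult_distrib power_divide\<close>)
  then have "(c ^ k - 1) * (\<Sum>z\<in>?\<mu>. z ^ k) = 0"
    by (simp add: power_mult_distrib left_diff_distrib flip: sum_distrib_left)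
  then show ?thesis using ck False by simp
qed

text \<open>The zero polynomial is listed separately because its degree is 0 by convention; so
  \<open>d = 0\<close> leaves exactly 0.\<close>

definition polys_below :: "nat \<Rightarrow> 'a::zero poly set" where
  "polys_below d = {f. f = 0 \<or> degree f < d}"

lemma polys_below_card:
  "finite (polys_below d :: 'k::{zero,finite} poly set)"
  "card (polys_below d :: 'k poly set) = card (UNIV :: 'k set) ^ d"
proof (induction d)
  case (Suc d)
  let ?f = "\<lambda>(c, f). pCons c f"
  have eq: "polys_below (Suc d) = ?f ` (UNIV \<times> polys_below d :: ('k \<times> 'k poly) set)"
  proof
    show "polys_below (Suc d) \<subseteq> ?f ` (UNIV \<times> polys_below d :: ('k \<times> 'k poly) set)"
    proof
      fix p :: "'k poly" assume p: "p \<in> polys_below (Suc d)"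
      obtain c f where cf: "p = pCons c f" by (rule pCons_cases)
      then have "f \<in> polys_below d" using p by (auto simp: polys_below_def split: if_splits)
      then have "(c, f) \<in> UNIV \<times> polys_below d" by simp
      then show "p \<in> ?f ` (UNIV \<times> polys_below d)" using cf by (intro image_eqI[of _ _ "(c, f)"]) auto
    qed
  qed (auto simp: polys_below_def split: if_splits)
  have inj: "inj_on ?f (UNIV \<times> polys_below d :: ('k \<times> 'k poly) set)" by (auto simp: inj_on_def)
  {
    case 1
    show ?case unfolding eq using Suc by simp
  next
    case 2
    show ?case unfolding eq card_image[OF inj] using Suc by simp
  }
qed (auto simp: polys_below_def)

context kummer_curve
begin

text \<open>The integral closure of K[P] in \<open>F\<close>, given as the intersection of the
  places that contain \<open>P\<close>.\<close>

definition R :: "'h set" where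
  "R = {z\<in>F. \<forall>V. place V \<longrightarrow> P \<in> V \<longrightarrow> z \<in> V}"

lemma R_subring: "is_subring R"
  unfolding is_subring_def R_def
  using subringD[OF F_subring] subringD[OF place_subring] by auto

lemma ev_in_R: "ev f \<in> R"
  unfolding R_def using ev_in_F ev_in_place by auto

lemma w_in_R: "w k \<in> R"
  unfolding R_def using w_in_F w_in_place by auto

lemma const_in_R: "\<iota> c \<in> R"
  using ev_in_R[of "[:c:]"] by (simp add: ev_const)

lemma comb_in_R: "comb \<zeta> a \<in> R"
  unfolding comb_def by (intro subring_sum subring_mult R_subring ev_in_R w_in_R const_in_R)

lemma R_in_place: "z \<in> R \<Longrightarrow> place V \<Longrightarrow> P \<in> V \<Longrightarrow> z \<in> V"
  unfolding R_def by blast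

lemma R_in_F: "z \<in> R \<Longrightarrow> z \<in> F"
  unfolding R_def by blast

lemma sig_in_R:
  assumes "\<zeta> ^ N = 1" "z \<in> R"
  shows "sig \<zeta> z \<in> R"
proof -
  have zF: "z \<in> F" using assms R_in_F by blast
  have "sig \<zeta> z \<in> V" if V: "place V" "P \<in> V" for V
  proof -
    have "P \<in> {z\<in>F. sig \<zeta> z \<in> V}"
      using sig_ev[OF assms(1), of "[:0, 1:]"] V P_in_F by (simp add: ev_X)
    then show ?thesis using R_in_place[OF assms(2) sig_place[OF V(1) assms(1)]] by simp
  qed
  then show ?thesis unfolding R_def using sig_in_F[OF zF] by blast
qed

lemma range_ev_subring: "is_subring (range ev)"
  unfolding is_subring_def by (auto simp flip: ev_1 ev_diff ev_mult)

text \<open>If \<open>y\<close> were not integral over K[P], some place would contain K[P] but not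
  \<open>y\<close>. Membership in K[P][1/y] is an integral equation divided by a power of
  \<open>y\<close>.\<close>

lemma R_integral:
  assumes "y \<in> R"
  shows "y \<in> adj_ring (range ev) (inverse y)"
proof (rule ccontr)
  assume n: "y \<notin> adj_ring (range ev) (inverse y)"
  have "range \<iota> \<subseteq> range ev" by (auto simp flip: ev_const)
  moreover have "range ev \<subseteq> F" using ev_in_F by auto
  ultimately obtain V where V: "place V" "range ev \<subseteq> V" "y \<notin> V"
    using place_exists[OF range_ev_subring _ _ R_in_F[OF assms] n] by blast
  have "P \<in> V" using V(2) ev_X by (metis rangeI subsetD)
  then show False using V R_in_place[OF assms] by blast
qed

text \<open>K[P] is integrally closed: an integral equation for f/g shows that each prime of
  \<open>g\<close> divides a power of \<open>f\<close>.\<close>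

lemma dvd_of_ratio_in_R:
  assumes "g \<noteq> 0" "ev f / ev g \<in> R"
  shows "g dvd f"
proof (rule poly_dvd_by_primes[where Q = "\<lambda>g f. ev f / ev g \<in> R"])
  fix p g f :: "'k poly" assume p: "prime_elem p" and g0: "g \<noteq> 0"
  {
    assume "ev (p * f) / ev (p * g) \<in> R"
    moreover have "ev (p * f) / ev (p * g) = ev f / ev g"
      using p by (auto simp: ev_mult prime_elem_def)
    ultimately show "ev f / ev g \<in> R" by simp
  }
  assume pg: "p dvd g" and y: "ev f / ev g \<in> R"
  show "p dvd f"
  proof (cases "f = 0")
    case False
    let ?y = "ev f / ev g"
    obtain c where c: "?y = poly c (inverse ?y)" "\<forall>i. coeff c i \<in> range ev"
      using R_integral[OF y] unfolding adj_ring_def by blast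
    define b where "b i = inv_into UNIV ev (coeff c i)" for i
    have b: "coeff c i = ev (b i)" for i
      unfolding b_def by (rule f_inv_into_f[symmetric]) (rule c(2)[rule_format])
    let ?k = "degree c"
    have y': "?y = (\<Sum>i\<le>?k. ev (b i) * (ev g / ev f) ^ i)"
      using c(1) unfolding poly_altdef b by (simp add: divide_inverse mult.commute)
    have "?y * ev f ^ ?k = (\<Sum>i\<le>?k. ev (b i) * (ev g / ev f) ^ i) * ev f ^ ?k"
      by (rule arg_cong[where f = "\<lambda>x. x * ev f ^ ?k", OF y'])
    also have "\<dots> = (\<Sum>i\<le>?k. ev (b i) * (ev g / ev f) ^ i * ev f ^ ?k)"
      by (rule sum_distrib_right)
    also have "\<dots> = (\<Sum>i\<le>?k. ev (b i * g ^ i * f ^ (?k - i)))"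
    proof (rule sum.cong)
      fix i assume "i \<in> {..?k}"
      then have "ev f ^ ?k = ev f ^ i * ev f ^ (?k - i)" by (simp flip: power_add)
      then show "ev (b i) * (ev g / ev f) ^ i * ev f ^ ?k = ev (b i * g ^ i * f ^ (?k - i))"
        using False by (simp add: ev_mult ev_power power_divide)
    qed simp
    finally have "ev f * ev f ^ ?k = ev g * (\<Sum>i\<le>?k. ev (b i * g ^ i * f ^ (?k - i)))"
      using g0 by (simp add: field_simps)
    then have "ev (f ^ Suc ?k) = ev (g * (\<Sum>i\<le>?k. b i * g ^ i * f ^ (?k - i)))"
      by (simp only: ev_mult ev_power ev_sum power_Suc)
    then have "f ^ Suc ?k = g * (\<Sum>i\<le>?k. b i * g ^ i * f ^ (?k - i))" by (simp only: ev_eq_iff)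
    then have "g dvd f ^ Suc ?k" by (rule dvdI)
    with pg have "p dvd f ^ Suc ?k" by (rule dvd_trans)
    then show ?thesis by (rule prime_elem_dvd_power[OF p])
  qed simp
qed (use assms in auto)

text \<open>The \<open>N\<close>-th roots of unity in the constant field split an integral element into its
  components, and each component has its \<open>N\<close>-th power in the rational function field.\<close>

lemma component_in_R:
  assumes z: "z \<in> R" "g \<noteq> 0" "ev g * z = comb 1 a" and j: "j < N"
  shows "ev (a j) * w j / ev g \<in> R"
proof -
  let ?\<mu> = "{\<zeta> :: 'k. \<zeta> ^ N = 1}"
  \<comment> \<open>A discrete Fourier transform isolates the j-th component; the exponent
    \<open>N - j\<close> stands for -j.\<close>
  let ?y = "\<Sum>\<zeta>\<in>?\<mu>. \<iota> (\<zeta> ^ (N - j)) * sig \<zeta> z"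
  have s: "(\<Sum>\<zeta>\<in>?\<mu>. \<zeta> ^ (N - j + i)) = (if i = j then of_nat N else 0)" if "i < N" for i
  proof -
    have "N dvd N - j + i \<longleftrightarrow> i = j"
    proof
      assume "N dvd N - j + i"
      then obtain l where l: "N - j + i = N * l" by (elim dvdE)
      have "0 < N * l" "N * l < N * 2" using that j l by linarith+
      then have "l = 1" by simp
      then show "i = j" using l j by simp
    qed (use j in simp)
    then show ?thesis using sum_roots_of_unity[OF N_pos N_dvd, of "N - j + i"] by simp
  qed
  have "ev g * ?y = (\<Sum>\<zeta>\<in>?\<mu>. \<iota> (\<zeta> ^ (N - j)) * comb \<zeta> a)"
    unfolding sum_distrib_left using sig_eq[OF z(2,3)] by (intro sum.cong refl) (metis mult.left_commute)
  also have "\<dots> = (\<Sum>\<zeta>\<in>?\<mu>. \<Sum>i<N. ev (a i) * w i * \<iota> (\<zeta> ^ (N - j + i)))"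
    unfolding comb_def sum_distrib_left power_add \<iota>_mult by (simp only: mult_ac)
  also have "\<dots> = (\<Sum>i<N. \<Sum>\<zeta>\<in>?\<mu>. ev (a i) * w i * \<iota> (\<zeta> ^ (N - j + i)))" by (rule sum.swap)
  also have "\<dots> = (\<Sum>i<N. ev (a i) * w i * \<iota> (\<Sum>\<zeta>\<in>?\<mu>. \<zeta> ^ (N - j + i)))"
    unfolding \<iota>_sum sum_distrib_left ..
  also have "\<dots> = (\<Sum>i<N. if i = j then ev (a j) * w j * of_nat N else 0)"
    by (rule sum.cong) (auto simp: s \<iota>_of_nat)
  also have "\<dots> = ev (a j) * w j * of_nat N" using j by simp
  finally have *: "ev g * ?y = ev (a j) * w j * \<iota> (of_nat N)" by (simp add: \<iota>_of_nat)
  have N0: "of_nat N \<noteq> (0 :: 'k)" by (rule of_nat_dvd_card_neq_0[OF N_dvd])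
  have "?y * \<iota> (inverse (of_nat N)) \<in> R"
    by (intro subring_mult subring_sum R_subring const_in_R sig_in_R z) simp
  also have "?y * \<iota> (inverse (of_nat N)) = ev (a j) * w j / ev g"
  proof -
    have "ev g * (?y * \<iota> (inverse (of_nat N))) = ev (a j) * w j * (\<iota> (of_nat N) * \<iota> (inverse (of_nat N)))"
      using * by (simp only: mult.assoc[symmetric])
    also have "\<iota> (of_nat N) * \<iota> (inverse (of_nat N)) = 1" using N0 by (simp flip: \<iota>_mult)
    finally show ?thesis using z(2) by (simp add: field_simps)
  qed
  finally show ?thesis .
qed

text \<open>The N-th power of a component \<open>ev (a j) * w j / ev g\<close> is a fraction of
  polynomials lying in \<open>R\<close>, so g^N divides the product of a_j^N, P^j and E^(2j mod N).
  The last two factors together are free of N-th powers, hence \<open>g\<close> divides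
  \<open>a j\<close>.\<close>

lemma R_eq: "R = range (comb 1)"
proof
  show "range (comb 1) \<subseteq> R" using comb_in_R by auto
  show "R \<subseteq> range (comb 1)"
  proof
    fix z assume z: "z \<in> R"
    obtain g a where g: "g \<noteq> 0" "ev g * z = comb 1 a" using F_elem[OF R_in_F[OF z]] .
    have dvd: "g dvd a j" if j: "j < N" for j
    proof -
      let ?M = "[:0, 1:] ^ j * Epol ^ (2 * j mod N)"
      have "(ev (a j) * w j / ev g) ^ N \<in> R"
        using component_in_R[OF z g j] by (rule subring_power[OF R_subring])
      also have "(ev (a j) * w j / ev g) ^ N = ev (a j ^ N * ?M) / ev (g ^ N)"
        unfolding power_divide power_mult_distrib w_power ev_mult ev_power ev_X ..
      finally have d: "g ^ N dvd a j ^ N * ?M" using g(1) by (intro dvd_of_ratio_in_R) simp_all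
      \<comment> \<open>\<open>0 \<notin> Z\<close> keeps the factor \<open>P\<close> apart from
        those of \<open>Epol\<close>, so all exponents stay below \<open>N\<close>.\<close>
      let ?s = "\<lambda>c. if c = 0 then j else 2 * j mod N"
      have "?M = (\<Prod>c\<in>insert 0 Z. [:- c, 1:] ^ ?s c)"
      proof -
        have "(\<Prod>c\<in>insert 0 Z. [:- c, 1:] ^ ?s c) = [:0, 1:] ^ j * (\<Prod>c\<in>Z. [:- c, 1:] ^ ?s c)"
          using Z0 by simp
        also have "(\<Prod>c\<in>Z. [:- c, 1:] ^ ?s c) = (\<Prod>c\<in>Z. [:- c, 1:] ^ (2 * j mod N))"
          using Z0 by (intro prod.cong) auto
        also have "\<dots> = Epol ^ (2 * j mod N)" unfolding Epol_def by (rule prod_power_distrib[symmetric])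
        finally show ?thesis by simp
      qed
      then have "\<not> p ^ N dvd ?M" if "prime_elem p" for p
        using prime_power_not_dvd_linear_prod[of "insert 0 Z" ?s N p] that j N_pos by simp
      then show ?thesis using dvd_of_power_dvd[OF g(1) d] by blast
    qed
    have "ev g * z = comb 1 (\<lambda>i. g * (a i div g))"
      unfolding g(2) by (rule comb_cong) (use dvd in auto)
    then have "ev g * z = ev g * comb 1 (\<lambda>i. a i div g)" by (simp only: comb_scale)
    then have "z = comb 1 (\<lambda>i. a i div g)" using g(1) by simp
    then show "z \<in> range (comb 1)" by blast
  qed
qed

end

section \<open>The places of the Kummer extension\<close>

context kummer_curve
begin

text \<open>If \<open>s\<close> is the last index for which the coefficient \<open>c s\<close> of an equation of \<open>z\<close> is a unit, then
  \<open>u = (\<Sum>i\<ge>s. c i * z ^ (i - s))\<close> is a unit and \<open>u * z\<close> is a polynomial in \<open>1 / z\<close>. Hence every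
  place containing \<open>P\<close> contains both \<open>u\<close> and \<open>u * z\<close>, whether it contains \<open>z\<close> or \<open>1 / z\<close>.\<close>

lemma R_fraction:
  assumes V: "place V" "P \<in> V" and z: "z \<in> V"
  shows "\<exists>u\<in>R. u \<notin> max_ideal V \<and> u * z \<in> R"
proof (cases "z = 0")
  case True
  then show ?thesis using subring_1[OF R_subring] subring_0[OF R_subring] max_ideal_1[OF V(1)]
    by (intro bexI[of _ 1]) auto
next
  case False
  have zF: "z \<in> F" using place_sub[OF V(1) z] .
  \<comment> \<open>Normalization of the equation: the polynomials in the maximal ideal of
    \<open>V\<close> form a nonzero principal ideal; dividing out its generator repeatedly leaves a
    coefficient that is a unit at \<open>V\<close>. The degree of the constant term drops with each
    division.\<close>
  have norm: "\<forall>c :: nat \<Rightarrow> 'k poly. degree (c 0) = d \<longrightarrow> c 0 \<noteq> 0 \<longrightarrow> (\<Sum>i\<le>k. ev (c i) * z ^ i) = 0 \<longrightarrow>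
      (\<exists>c. (\<Sum>i\<le>k. ev (c i) * z ^ i) = 0 \<and> (\<exists>i\<le>k. ev (c i) \<notin> max_ideal V))" for d k
  proof (induction d rule: less_induct)
    case (less d)
    show ?case
    proof (intro allI impI)
      fix c :: "nat \<Rightarrow> 'k poly"
      assume c: "degree (c 0) = d" "c 0 \<noteq> 0" "(\<Sum>i\<le>k. ev (c i) * z ^ i) = 0"
      show "\<exists>c. (\<Sum>i\<le>k. ev (c i) * z ^ i) = 0 \<and> (\<exists>i\<le>k. ev (c i) \<notin> max_ideal V)"
      proof (cases "\<exists>i\<le>k. ev (c i) \<notin> max_ideal V")
        case False
        then have cm: "ev (c i) \<in> max_ideal V" if "i \<le> k" for i using that by blast
        let ?I = "{f. ev f \<in> max_ideal V}"
        have "\<exists>p\<in>?I. p \<noteq> 0 \<and> (\<forall>f\<in>?I. p dvd f)"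
        proof (rule poly_ideal_generator[of "c 0"])
          show "c 0 \<in> ?I" using cm[of 0] by simp
          show "c 0 \<noteq> 0" by (rule c(2))
          fix f g assume f: "f \<in> ?I" and g: "g \<in> ?I"
          show "f - g \<in> ?I" using max_ideal_diff[OF V(1)] f g by (simp add: ev_diff)
        next
          fix f g assume g: "g \<in> ?I"
          show "f * g \<in> ?I" using max_ideal_mult[OF V(1) ev_in_place[OF V]] g by (simp add: ev_mult)
        qed
        then obtain p where p: "ev p \<in> max_ideal V" "p \<noteq> 0" "\<And>f. ev f \<in> max_ideal V \<Longrightarrow> p dvd f"
          by blast
        have dp: "degree p \<noteq> 0"
        proof
          assume "degree p = 0"
          then obtain e where e: "p = [:e:]" by (rule degree_eq_zeroE)
          then show False using p(1,2) max_ideal_const[OF V(1), of e] by (simp add: ev_const)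
        qed
        define c' where "c' i = c i div p" for i
        have cc: "c i = p * c' i" if "i \<le> k" for i
          using p(3)[OF cm[OF that]] by (simp add: c'_def)
        have "ev p * (\<Sum>i\<le>k. ev (c' i) * z ^ i) = (\<Sum>i\<le>k. ev (c i) * z ^ i)"
          unfolding sum_distrib_left by (rule sum.cong) (simp_all add: cc ev_mult mult.assoc)
        then have rel: "(\<Sum>i\<le>k. ev (c' i) * z ^ i) = 0" using c(3) p(2) by simp
        have "c' 0 \<noteq> 0" using cc[of 0] c(2) by auto
        moreover from this have "degree (c' 0) < d"
          using c(1) cc[of 0] p(2) dp by (simp add: degree_mult_eq)
        ultimately show ?thesis using less.IH rel by blast
      next
        case True
        then show ?thesis using c(3) by (intro exI[of _ c] conjI)
      qed
    qed
  qed
  obtain c0 k where c0: "c0 0 \<noteq> 0" "(\<Sum>i\<le>k. ev (c0 i) * z ^ i) = 0"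
    using algebraic_relation[OF zF False] .
  obtain c where c: "(\<Sum>i\<le>k. ev (c i) * z ^ i) = 0" "\<exists>i\<le>k. ev (c i) \<notin> max_ideal V"
    using norm[of "degree (c0 0)" k] c0 by blast
  define s where "s = Max {i. i \<le> k \<and> ev (c i) \<notin> max_ideal V}"
  have fin: "finite {i. i \<le> k \<and> ev (c i) \<notin> max_ideal V}" by (rule finite_subset[of _ "{..k}"]) auto
  have "s \<in> {i. i \<le> k \<and> ev (c i) \<notin> max_ideal V}"
    unfolding s_def using c(2) fin by (intro Max_in) auto
  then have s: "s \<le> k" "ev (c s) \<notin> max_ideal V" by auto
  have above: "ev (c i) \<in> max_ideal V" if "i \<le> k" "s < i" for i
  proof (rule ccontr)
    assume "ev (c i) \<notin> max_ideal V"
    then have "i \<le> s" unfolding s_def using that fin by (intro Max_ge) auto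
    then show False using that by simp
  qed
  define u where "u = (\<Sum>i\<in>{s..k}. ev (c i) * z ^ (i - s))"
  have u_eq: "u = ev (c s) + (\<Sum>i\<in>{Suc s..k}. ev (c i) * z ^ (i - s))"
    unfolding u_def using s(1) by (simp add: sum.atLeast_Suc_atMost)
  have tail: "(\<Sum>i\<in>{Suc s..k}. ev (c i) * z ^ (i - s)) \<in> max_ideal V"
  proof (rule max_ideal_sum[OF V(1)])
    fix i assume "i \<in> {Suc s..k}"
    then have "z ^ (i - s) * ev (c i) \<in> max_ideal V"
      using above z by (intro max_ideal_mult V subring_power place_subring) auto
    then show "ev (c i) * z ^ (i - s) \<in> max_ideal V" by (simp add: mult.commute)
  qed
  have um: "u \<notin> max_ideal V"
  proof
    assume "u \<in> max_ideal V"
    from max_ideal_diff[OF V(1) this tail] show False using s(2) by (simp add: u_eq)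
  qed
  have split: "(\<Sum>i\<le>k. ev (c i) * z ^ i) = (\<Sum>i<s. ev (c i) * z ^ i) + (\<Sum>i\<in>{s..k}. ev (c i) * z ^ i)"
  proof -
    have "{..k} = {..<s} \<union> {s..k}" using s(1) by auto
    then show ?thesis by (simp only:) (rule sum.union_disjoint, auto)
  qed
  have "(\<Sum>i\<in>{s..k}. ev (c i) * z ^ i) = u * z ^ s"
    unfolding u_def sum_distrib_right by (rule sum.cong) (auto simp: mult.assoc simp flip: power_add)
  then have us: "u * z ^ s = - (\<Sum>i<s. ev (c i) * z ^ i)" using split c(1)
    by (simp add: eq_neg_iff_add_eq_0 add.commute)
  have s0: "s > 0"
  proof (rule ccontr)
    assume "\<not> s > 0"
    then have "u = 0" using us by simp
    then show False using um max_ideal_0[OF V(1)] by simp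
  qed
  have "u * z = - (\<Sum>i<s. ev (c i) * inverse z ^ (s - 1 - i))"
  proof -
    have zs: "z ^ s = z * z ^ (s - 1)" using s0 by (cases s) auto
    have "(u * z) * z ^ (s - 1) = - (\<Sum>i<s. ev (c i) * z ^ i)" using us zs by (simp add: mult.assoc)
    also have "(\<Sum>i<s. ev (c i) * z ^ i) = (\<Sum>i<s. ev (c i) * inverse z ^ (s - 1 - i)) * z ^ (s - 1)"
      unfolding sum_distrib_right
    proof (rule sum.cong)
      fix i assume "i \<in> {..<s}"
      then have "z ^ (s - 1) = z ^ (s - 1 - i) * z ^ i" by (simp flip: power_add)
      then show "ev (c i) * z ^ i = ev (c i) * inverse z ^ (s - 1 - i) * z ^ (s - 1)"
        using False by (simp add: field_simps)
    qed simp
    finally have "(u * z) * z ^ (s - 1) = (- (\<Sum>i<s. ev (c i) * inverse z ^ (s - 1 - i))) * z ^ (s - 1)"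
      by simp
    then show ?thesis using False by (simp only: mult_cancel_right) simp
  qed
  note uz = this
  have both: "u \<in> W \<and> u * z \<in> W" if W: "place W" "P \<in> W" for W
  proof (cases "z \<in> W")
    case True
    then have "u \<in> W"
      unfolding u_def by (intro subring_sum subring_mult subring_power place_subring ev_in_place W)
    then show ?thesis using True subring_mult[OF place_subring[OF W(1)]] by blast
  next
    case zW: False
    then have iz: "inverse z \<in> W" using place_cases[OF W(1) zF] by simp
    have "u * z \<in> W"
      unfolding uz using iz by (intro subring_uminus subring_sum subring_mult subring_power place_subring ev_in_place W)
    moreover from this have "(u * z) * inverse z \<in> W" using iz by (rule subring_mult[OF place_subring[OF W(1)]])
    ultimately show ?thesis using False by (simp add: mult.assoc)
  qed
  have uF: "u \<in> F"
    unfolding u_def by (intro subring_sum subring_mult subring_power F_subring ev_in_F zF)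
  have "u \<in> R" "u * z \<in> R" unfolding R_def using both uF subring_mult[OF F_subring uF zF] by auto
  then show ?thesis using um by blast
qed

definition combs_below :: "(nat \<Rightarrow> nat) \<Rightarrow> 'h set" where
  "combs_below d = comb 1 ` (PiE {..<N} (\<lambda>i. polys_below (d i)))"

lemma combs_below_finite: "finite (combs_below d)"
  unfolding combs_below_def by (intro finite_imageI finite_PiE polys_below_card) simp

lemma combs_below_card: "card (combs_below d) = card (UNIV :: 'k set) ^ (\<Sum>i<N. d i)"
proof -
  have "inj_on (comb 1) (PiE {..<N} (\<lambda>i. polys_below (d i)))"
  proof (rule inj_onI)
    fix a b :: "nat \<Rightarrow> 'k poly"
    assume ab: "a \<in> PiE {..<N} (\<lambda>i. polys_below (d i))" "b \<in> PiE {..<N} (\<lambda>i. polys_below (d i))"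
      "comb 1 a = comb 1 b"
    show "a = b" by (rule PiE_ext[OF ab(1,2)]) (use comb_eq[OF ab(3)] in auto)
  qed
  then have "card (combs_below d) = card (PiE {..<N} (\<lambda>i. polys_below (d i) :: 'k poly set))"
    unfolding combs_below_def by (rule card_image)
  also have "\<dots> = (\<Prod>i<N. card (UNIV :: 'k set) ^ d i)"
    by (simp add: card_PiE polys_below_card)
  finally show ?thesis by (simp add: power_sum)
qed

lemma combs_belowI: "(\<And>i. i < N \<Longrightarrow> a i \<in> polys_below (d i)) \<Longrightarrow> comb 1 a \<in> combs_below d"
proof -
  assume a: "\<And>i. i < N \<Longrightarrow> a i \<in> polys_below (d i)"
  have "comb 1 a = comb 1 (restrict a {..<N})" by (rule comb_cong) simp
  moreover have "restrict a {..<N} \<in> PiE {..<N} (\<lambda>i. polys_below (d i))"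
    using a by (intro restrict_PiE_iff[THEN iffD2]) auto
  ultimately show ?thesis unfolding combs_below_def by simp
qed

lemma combs_below_R: "combs_below d \<subseteq> R"
  unfolding combs_below_def using comb_in_R by auto

abbreviation residues :: "'k poly \<Rightarrow> 'h set" where
  "residues g \<equiv> combs_below (\<lambda>_. degree g)"

text \<open>\<open>R\<close> is free over K[P] on the \<open>w i\<close>, so R/gR is represented by
  reducing coordinates modulo \<open>g\<close>. Its finiteness is the source of the pigeonhole and
  counting arguments below.\<close>

lemma R_mod:
  assumes "r \<in> R" "g \<noteq> 0"
  shows "\<exists>\<rho>\<in>residues g. \<exists>s\<in>R. r = \<rho> + ev g * s"
proof -
  obtain a where a: "r = comb 1 a" using assms R_eq by auto
  have "r = comb 1 (\<lambda>i. a i mod g - g * (- (a i div g)))"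
    unfolding a by (rule comb_cong) (simp add: mult.commute)
  also have "\<dots> = comb 1 (\<lambda>i. a i mod g) - ev g * comb 1 (\<lambda>i. - (a i div g))"
    by (simp only: comb_scale comb_diff)
  also have "\<dots> = comb 1 (\<lambda>i. a i mod g) + ev g * (- comb 1 (\<lambda>i. - (a i div g)))" by simp
  finally have eq: "r = comb 1 (\<lambda>i. a i mod g) + ev g * (- comb 1 (\<lambda>i. - (a i div g)))" .
  have "comb 1 (\<lambda>i. a i mod g) \<in> residues g"
    using degree_mod_less[OF assms(2)] by (intro combs_belowI) (auto simp: polys_below_def)
  moreover have "- comb 1 (\<lambda>i. - (a i div g)) \<in> R" by (intro subring_uminus R_subring comb_in_R)
  ultimately show ?thesis using eq by blast
qed

text \<open>Pigeonhole in the finite ring R/gR. For an element that is a unit at a place it yields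
  an inverse modulo \<open>g\<close>.\<close>

lemma power_collision:
  assumes "r \<in> R" "g \<noteq> 0"
  shows "\<exists>k l s. k < l \<and> s \<in> R \<and> r ^ k - r ^ l = ev g * s"
proof -
  have "\<forall>k. \<exists>\<rho>. \<rho> \<in> residues g \<and> (\<exists>s\<in>R. r ^ k = \<rho> + ev g * s)"
    using R_mod[OF subring_power[OF R_subring assms(1)] assms(2)] by blast
  then obtain \<rho> where \<rho>: "\<And>k. \<rho> k \<in> residues g" "\<And>k. \<exists>s\<in>R. r ^ k = \<rho> k + ev g * s"
    using choice[of "\<lambda>k \<rho>. \<rho> \<in> residues g \<and> (\<exists>s\<in>R. r ^ k = \<rho> + ev g * s)"] by blast
  have "finite (range \<rho>)" by (rule finite_subset[OF _ combs_below_finite]) (use \<rho>(1) in auto)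
  then have "\<not> inj \<rho>" using finite_imageD infinite_UNIV_nat by blast
  then obtain i j where "i \<noteq> j" "\<rho> i = \<rho> j" by (auto simp: inj_def)
  then obtain k l where kl: "k < l" "\<rho> k = \<rho> l" by (metis linorder_neqE_nat)
  obtain s where s: "s \<in> R" "r ^ k = \<rho> k + ev g * s" using \<rho>(2) by blast
  obtain s' where s': "s' \<in> R" "r ^ l = \<rho> l + ev g * s'" using \<rho>(2) by blast
  have "r ^ k - r ^ l = ev g * (s - s')" unfolding s(2) s'(2) kl(2) by (simp add: algebra_simps)
  then show ?thesis using kl(1) subring_diff[OF R_subring s(1) s'(1)] by blast
qed

section \<open>Finite places: uniformizers and residues\<close>

context
  fixes V assumes V: "place V" and PV: "P \<in> V"
begin

lemma R_in_V: "r \<in> R \<Longrightarrow> r \<in> V"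
  using R_in_place V PV by blast

text \<open>V = R + gV. With the denominator \<open>u\<close> from \<open>R_fraction\<close>, the
  collision makes \<open>u ^ Suc e\<close> congruent to 1 modulo gV, so \<open>z\<close> is
  congruent to \<open>(u * z) * u ^ e\<close>, which lies in \<open>R\<close>.\<close>

lemma place_mod:
  assumes z: "z \<in> V" and g: "g \<noteq> 0"
  shows "\<exists>\<rho>\<in>residues g. \<exists>v\<in>V. z = \<rho> + ev g * v"
proof -
  obtain u where u: "u \<in> R" "u \<notin> max_ideal V" "u * z \<in> R" using R_fraction[OF V PV z] by blast
  have uu: "u \<in> V - max_ideal V" using u R_in_V by blast
  have u0: "u \<noteq> 0" and iu: "inverse u \<in> V" using iffD1[OF unit_iff uu] by auto
  obtain k l s where kl: "k < l" "s \<in> R" "u ^ k - u ^ l = ev g * s"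
    using power_collision[OF u(1) g] by blast
  define e where "e = l - k - 1"
  have l: "l = k + Suc e" using kl(1) by (simp add: e_def)
  have "u ^ k * (1 - u * u ^ e) = ev g * s"
    using kl(3) unfolding l power_add by (simp add: algebra_simps)
  then have "1 - u * u ^ e = ev g * (s * inverse u ^ k)"
    using u0 by (simp add: field_simps)
  then have "(1 - u * u ^ e) * z = ev g * (s * inverse u ^ k) * z" by simp
  then have z_eq: "z = (u * z) * u ^ e + ev g * (s * inverse u ^ k * z)"
    by (simp add: algebra_simps)
  have "(u * z) * u ^ e \<in> R"
    by (rule subring_mult[OF R_subring u(3) subring_power[OF R_subring u(1)]])
  then obtain \<rho> s' where \<rho>: "\<rho> \<in> residues g" "s' \<in> R" "(u * z) * u ^ e = \<rho> + ev g * s'"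
    using R_mod[OF _ g] by blast
  note z_eq
  also have "(u * z) * u ^ e + ev g * (s * inverse u ^ k * z) = \<rho> + ev g * (s' + s * inverse u ^ k * z)"
    unfolding \<rho>(3) by (simp only: distrib_left add.assoc)
  finally have "z = \<rho> + ev g * (s' + s * inverse u ^ k * z)" .
  moreover have "s' + s * inverse u ^ k * z \<in> V"
    using R_in_V[OF \<rho>(2)] R_in_V[OF kl(2)] z iu
    by (intro subring_add subring_mult subring_power place_subring V)
  ultimately show ?thesis using \<rho>(1) by blast
qed

lemma divides_poly:
  assumes z: "z \<in> V" "z \<noteq> 0"
  shows "\<exists>g. g \<noteq> 0 \<and> (\<exists>v\<in>V. ev g = z * v)"
proof -
  obtain c k where c: "c 0 \<noteq> 0" "(\<Sum>i\<le>k. ev (c i) * z ^ i) = 0"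
    using algebraic_relation[OF place_sub[OF V z(1)] z(2)] .
  have "ev (c 0) = z * - (\<Sum>i<k. ev (c (Suc i)) * z ^ i)"
    using relation_constant_term[OF c(2)] by simp
  moreover have "- (\<Sum>i<k. ev (c (Suc i)) * z ^ i) \<in> V"
    using z by (intro subring_uminus subring_sum subring_mult subring_power place_subring V ev_in_place PV)
  ultimately show ?thesis using c(1) by blast
qed

lemma max_ideal_poly: "\<exists>g. g \<noteq> 0 \<and> ev g \<in> max_ideal V"
proof -
  obtain x where x: "x \<in> F" "x \<notin> V" using place_neq[OF V] by blast
  have m: "inverse x \<in> max_ideal V" by (rule not_in_place[OF V x])
  have "inverse x \<noteq> 0" using x subring_0[OF place_subring[OF V]] by auto
  then obtain g v where g: "g \<noteq> 0" "v \<in> V" "ev g = inverse x * v"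
    using divides_poly[OF max_ideal_sub[OF m]] by blast
  then have "ev g \<in> max_ideal V" using max_ideal_mult[OF V g(2) m] by (simp add: mult.commute)
  then show ?thesis using g by blast
qed

lemma common_divisor:
  assumes "finite S" "S \<noteq> {}" "S \<subseteq> V" "0 \<notin> S"
  shows "\<exists>t\<in>S. \<forall>s\<in>S. s / t \<in> V"
  using assms
proof (induction S rule: finite_ne_induct)
  case (singleton x)
  then show ?case using subring_1[OF place_subring[OF V]] by simp
next
  case (insert x S)
  then obtain t where t: "t \<in> S" "\<forall>s\<in>S. s / t \<in> V" by auto
  have nz: "x \<noteq> 0" "t \<noteq> 0" "x \<in> V" "t \<in> V" using insert t by auto
  have "x / t \<in> F" using nz V by (intro subfield_divide subfield) (auto intro: place_sub)
  then consider "x / t \<in> V" | "t / x \<in> V" using place_cases[OF V, of "x / t"] by auto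
  then show ?case
  proof cases
    case 1
    then show ?thesis using t by (intro bexI[of _ t]) auto
  next
    case 2
    have "s / x \<in> V" if "s \<in> S" for s
    proof -
      have "s / t \<in> V" using t that by blast
      from subring_mult[OF place_subring[OF V] this 2] show ?thesis using nz by simp
    qed
    then show ?thesis using nz subring_1[OF place_subring[OF V]] by (intro bexI[of _ x]) auto
  qed
qed

text \<open>By V = R + gV with \<open>g\<close> in the maximal ideal, that ideal is generated by
  \<open>g\<close> and the finitely many residues in it; among finitely many nonzero elements of a
  valuation ring one divides all others.\<close>

lemma max_ideal_principal: "\<exists>t. t \<noteq> 0 \<and> max_ideal V = {t * v | v. v \<in> V}"
proof -
  obtain g where g: "g \<noteq> 0" "ev g \<in> max_ideal V" using max_ideal_poly by blast
  let ?S = "insert (ev g) ((residues g \<inter> max_ideal V) - {0})"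
  have "finite ?S" using combs_below_finite by auto
  moreover have "?S \<subseteq> V" using g max_ideal_sub by auto
  moreover have "0 \<notin> ?S" using g(1) by (metis Diff_iff ev_eq_0_iff insertCI insertE)
  ultimately obtain t where t: "t \<in> ?S" "\<And>s. s \<in> ?S \<Longrightarrow> s / t \<in> V"
    using common_divisor[of ?S] by blast
  have tm: "t \<in> max_ideal V" and t0: "t \<noteq> 0" using t g \<open>0 \<notin> ?S\<close> by blast+
  have "z \<in> {t * v | v. v \<in> V}" if z: "z \<in> max_ideal V" for z
  proof -
    obtain \<rho> v where \<rho>: "\<rho> \<in> residues g" "v \<in> V" "z = \<rho> + ev g * v"
      using place_mod[OF max_ideal_sub[OF z] g(1)] by blast
    have "v * ev g \<in> max_ideal V" by (rule max_ideal_mult[OF V \<rho>(2) g(2)])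
    from max_ideal_diff[OF V z this] have "\<rho> \<in> max_ideal V" using \<rho>(3) by (simp add: mult.commute)
    then have "\<rho> / t \<in> V" using t(2)[of \<rho>] \<rho>(1) subring_0[OF place_subring[OF V]] by (cases "\<rho> = 0") auto
    moreover have "ev g / t \<in> V" using t(2) by blast
    ultimately have "\<rho> / t + ev g / t * v \<in> V"
      using \<rho>(2) by (intro subring_add subring_mult place_subring V)
    moreover have "z = t * (\<rho> / t + ev g / t * v)" using t0 \<rho>(3) by (simp add: field_simps)
    ultimately show ?thesis by blast
  qed
  moreover have "t * v \<in> max_ideal V" if "v \<in> V" for v
    using max_ideal_mult[OF V that tm] by (simp add: mult.commute)
  ultimately show ?thesis using t0 by blast
qed

text \<open>Some \<open>g\<close> is a multiple of \<open>z\<close>. A collision of powers of \<pi>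
  modulo \<open>g\<close> puts \<pi>^k (1 - \<pi>^(l-k)) into gV; if \<open>z\<close> were divisible
  by \<pi>^(k+1), then 1 would lie in the maximal ideal.\<close>

lemma not_infinitely_divisible:
  assumes \<pi>: "\<pi> \<in> max_ideal V" "\<pi> \<noteq> 0" and z: "z \<in> V" "z \<noteq> 0"
  shows "\<exists>k. z / \<pi> ^ k \<notin> V"
proof (rule ccontr)
  assume "\<nexists>k. z / \<pi> ^ k \<notin> V"
  then have zt: "z / \<pi> ^ k \<in> V" for k by blast
  note S = place_subring[OF V]
  obtain g v where g: "g \<noteq> 0" "v \<in> V" "ev g = z * v" using divides_poly[OF z] by blast
  have "\<forall>k. \<exists>\<rho>. \<rho> \<in> residues g \<and> (\<exists>v\<in>V. \<pi> ^ k = \<rho> + ev g * v)"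
    using place_mod[OF subring_power[OF place_subring[OF V] max_ideal_sub[OF \<pi>(1)]] g(1)] by blast
  then obtain \<rho> where \<rho>: "\<And>k. \<rho> k \<in> residues g" "\<And>k. \<exists>v\<in>V. \<pi> ^ k = \<rho> k + ev g * v"
    using choice[of "\<lambda>k \<rho>. \<rho> \<in> residues g \<and> (\<exists>v\<in>V. \<pi> ^ k = \<rho> + ev g * v)"] by blast
  have "finite (range \<rho>)" by (rule finite_subset[OF _ combs_below_finite]) (use \<rho>(1) in auto)
  then have "\<not> inj \<rho>" using finite_imageD infinite_UNIV_nat by blast
  then obtain i j where "i \<noteq> j" "\<rho> i = \<rho> j" by (auto simp: inj_def)
  then obtain k l where kl: "k < l" "\<rho> k = \<rho> l" by (metis linorder_neqE_nat)
  obtain s where s: "s \<in> V" "\<pi> ^ k = \<rho> k + ev g * s" using \<rho>(2) by blast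
  obtain s' where s': "s' \<in> V" "\<pi> ^ l = \<rho> l + ev g * s'" using \<rho>(2) by blast
  define e where "e = l - k - 1"
  have l: "l = k + Suc e" using kl(1) by (simp add: e_def)
  have "\<pi> ^ k - \<pi> ^ l = ev g * (s - s')" unfolding s(2) s'(2) kl(2) by (simp add: algebra_simps)
  then have "\<pi> ^ k * (1 - \<pi> * \<pi> ^ e) = ev g * (s - s')"
    unfolding l power_add by (simp add: algebra_simps)
  also have "ev g = \<pi> ^ k * (\<pi> * (z / \<pi> ^ Suc k) * v)" using \<pi>(2) unfolding g(3) by (simp add: field_simps)
  finally have "\<pi> ^ k * (1 - \<pi> * \<pi> ^ e) = \<pi> ^ k * (\<pi> * (z / \<pi> ^ Suc k) * v * (s - s'))"
    by (simp only: mult.assoc)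
  moreover have "\<pi> ^ k \<noteq> 0" using \<pi>(2) by simp
  ultimately have "1 - \<pi> * \<pi> ^ e = \<pi> * (z / \<pi> ^ Suc k) * v * (s - s')"
    using mult_left_cancel by blast
  then have "1 = \<pi> * \<pi> ^ e + \<pi> * (z / \<pi> ^ Suc k) * v * (s - s')" by (simp only: diff_eq_eq add.commute)
  also have "\<dots> = (\<pi> ^ e + (z / \<pi> ^ Suc k) * v * (s - s')) * \<pi>"
    unfolding distrib_right by (simp only: mult_ac)
  finally have one: "1 = (\<pi> ^ e + (z / \<pi> ^ Suc k) * v * (s - s')) * \<pi>" .
  have "\<pi> ^ e + (z / \<pi> ^ Suc k) * v * (s - s') \<in> V"
    by (rule subring_add[OF S subring_power[OF S max_ideal_sub[OF \<pi>(1)]]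
          subring_mult[OF S subring_mult[OF S zt g(2)] subring_diff[OF S s(1) s'(1)]]])
  from max_ideal_mult[OF V this \<pi>(1)] have "1 \<in> max_ideal V" unfolding one[symmetric] .
  then show False using max_ideal_1[OF V] by simp
qed

lemma finite_place_uniformizer: "\<exists>t. uniformizer V t"
proof -
  obtain t where t: "t \<noteq> 0" "max_ideal V = {t * v | v. v \<in> V}" using max_ideal_principal by blast
  have "t * 1 \<in> max_ideal V" unfolding t(2) using subring_1[OF place_subring[OF V]] by blast
  then have tm: "t \<in> max_ideal V" by simp
  have inV: "\<exists>n u. u \<in> V - max_ideal V \<and> z = t powi n * u" if z: "z \<in> V" "z \<noteq> 0" for z
  proof -
    define k where "k = (LEAST k. z / t ^ k \<notin> V)"
    have k: "z / t ^ k \<notin> V"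
      unfolding k_def using not_infinitely_divisible[OF tm t(1) z] by (rule LeastI_ex)
    have "k \<noteq> 0" using k z by (intro notI) simp
    then obtain j where j: "k = Suc j" by (cases k) auto
    have jV: "z / t ^ j \<in> V" using not_less_Least[of j "\<lambda>k. z / t ^ k \<notin> V"] j by (auto simp: k_def)
    have "z / t ^ j \<notin> max_ideal V"
    proof
      assume "z / t ^ j \<in> max_ideal V"
      then obtain v where v: "v \<in> V" "z / t ^ j = t * v" using t(2) by blast
      have "z / t ^ k = (z / t ^ j) / t" using t(1) by (simp add: j field_simps)
      also have "\<dots> = v" unfolding v(2) using t(1) by simp
      finally show False using k v(1) by simp
    qed
    then show ?thesis using jV t(1) by (intro exI[of _ "int j"] exI[of _ "z / t ^ j"]) simp
  qed
  have "\<exists>n u. u \<in> V - max_ideal V \<and> z = t powi n * u" if z: "z \<in> F" "z \<noteq> 0" for z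
  proof (cases "z \<in> V")
    case False
    then have "inverse z \<in> V" "inverse z \<noteq> 0" using place_cases[OF V z(1)] z by auto
    from inV[OF this] obtain n u where u: "u \<in> V - max_ideal V" "inverse z = t powi n * u" by blast
    have "z = t powi (- n) * inverse u" by (metis inverse_inverse_eq inverse_mult_distrib power_int_minus u(2))
    then show ?thesis using unit_inverse[OF u(1)] by blast
  qed (use inV z in blast)
  then have "uniformizer V t" unfolding uniformizer_def using t by blast
  then show ?thesis by blast
qed

lemma finite_place_residues: "\<exists>X. finite X \<and> (\<forall>z\<in>V. \<exists>x\<in>X. z - x \<in> max_ideal V)"
proof -
  obtain g where g: "g \<noteq> 0" "ev g \<in> max_ideal V" using max_ideal_poly by blast
  have "\<exists>x\<in>residues g. z - x \<in> max_ideal V" if z: "z \<in> V" for z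
  proof -
    obtain \<rho> v where \<rho>: "\<rho> \<in> residues g" "v \<in> V" "z = \<rho> + ev g * v"
      using place_mod[OF z g(1)] by blast
    have "z - \<rho> \<in> max_ideal V" using max_ideal_mult[OF V \<rho>(2) g(2)] \<rho>(3) by (simp add: mult.commute)
    then show ?thesis using \<rho>(1) by blast
  qed
  then show ?thesis using combs_below_finite by blast
qed

end

section \<open>The place at infinity\<close>

lemma infinite_lead:
  assumes "z \<in> F" "z \<noteq> 0"
  shows "\<exists>k c. \<forall>V. place V \<longrightarrow> P \<notin> V \<longrightarrow> lead V z k c"
proof -
  obtain g a where g: "g \<noteq> 0" "ev g * z = comb 1 a" using F_elem[OF assms(1)] .
  have nz: "comb 1 a \<noteq> 0" using g assms(2) by (metis ev_eq_0_iff mult_eq_0_iff)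
  have "\<exists>i<N. a i \<noteq> 0"
  proof (rule ccontr)
    assume "\<not> (\<exists>i<N. a i \<noteq> 0)"
    then have "comb 1 a = 0" unfolding comb_1 by (intro sum.neutral) auto
    then show False using nz by simp
  qed
  then obtain j where j: "\<And>V. place V \<Longrightarrow> P \<notin> V \<Longrightarrow> lead V (comb 1 a) (comb_degree a j) (lead_coeff (a j))"
    using comb_lead[of _ a] by blast
  have z: "z = comb 1 a * inverse (ev g)" using g by (simp add: field_simps)
  show ?thesis
  proof (intro exI allI impI)
    fix V assume V: "place V" "P \<notin> V"
    show "lead V z (comb_degree a j + - (int N * int (degree g))) (lead_coeff (a j) * inverse (lead_coeff g))"
      unfolding z by (rule lead_mult[OF V j[OF V] lead_inverse[OF V lead_ev[OF V g(1)]]])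
  qed
qed

lemma lead_in_place_iff:
  assumes V: "place V" "P \<notin> V" and z: "lead V z k c" "z \<in> F"
  shows "z \<in> V \<longleftrightarrow> k \<le> 0" "z \<in> max_ideal V \<longleftrightarrow> k < 0"
proof -
  have eq: "z = (z * t powi k) * t powi (- k)" using t_neq_0 by (simp add: power_int_minus)
  note u = lead_unit[OF V z(1)]
  have pos: "z \<in> max_ideal V" if "k < 0"
    using lead_smaller[OF V z(1) that] by simp
  have neg: "z \<notin> V" if "k > 0"
  proof
    assume "z \<in> V"
    have "t ^ nat k \<in> max_ideal V" using that by (intro max_ideal_power V t_max_ideal) simp
    then have "t powi k \<in> max_ideal V" using that by (simp add: power_int_def)
    then have "z * t powi k \<in> max_ideal V" by (rule max_ideal_mult[OF V(1) \<open>z \<in> V\<close>])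
    then show False using u by simp
  qed
  have zero: "z \<in> V - max_ideal V" if "k = 0" using u that by simp
  show "z \<in> V \<longleftrightarrow> k \<le> 0" "z \<in> max_ideal V \<longleftrightarrow> k < 0"
    using pos neg zero max_ideal_sub[of z V] by (cases k "0 :: int" rule: linorder_cases; auto)+
qed

text \<open>By \<open>infinite_lead\<close> the pole order of an element is the same at all places
  where \<open>P\<close> is infinite, and its sign decides membership.\<close>

lemma infinite_place_unique:
  assumes "place V" "P \<notin> V" "place W" "P \<notin> W"
  shows "V = W"
proof -
  have "z \<in> V \<longleftrightarrow> z \<in> W" if z: "z \<in> F" for z
  proof (cases "z = 0")
    case True
    then show ?thesis using assms subring_0[OF place_subring] by blast
  next
    case False
    obtain k c where k: "\<And>V. place V \<Longrightarrow> P \<notin> V \<Longrightarrow> lead V z k c" using infinite_lead[OF z False] by blast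
    show ?thesis using lead_in_place_iff(1)[OF _ _ k z] assms by simp
  qed
  then show ?thesis using place_sub assms by blast
qed

lemma infinite_place_uniformizer:
  assumes V: "place V" "P \<notin> V"
  shows "uniformizer V t"
  unfolding uniformizer_def
proof (intro conjI ballI impI)
  show "t \<noteq> 0" by (rule t_neq_0)
  have "z \<in> {t * v | v. v \<in> V}" if z: "z \<in> max_ideal V" for z
  proof (cases "z = 0")
    case True
    then show ?thesis using subring_0[OF place_subring[OF V(1)]] by (intro CollectI exI[of _ 0]) simp
  next
    case False
    have zF: "z \<in> F" using place_sub[OF V(1) max_ideal_sub[OF z]] .
    obtain k c where k: "lead V z k c" using infinite_lead[OF zF False] V by blast
    then have "k < 0" using lead_in_place_iff(2)[OF V k zF] z by simp
    then have "t ^ nat (- k - 1) \<in> V"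
      using max_ideal_sub[OF t_max_ideal[OF V]] by (intro subring_power place_subring V)
    moreover have "z * t powi k \<in> V" using lead_unit[OF V k] by simp
    ultimately have "(z * t powi k) * t ^ nat (- k - 1) \<in> V"
      using subring_mult[OF place_subring[OF V(1)]] by blast
    moreover have "z = t * ((z * t powi k) * t ^ nat (- k - 1))"
    proof -
      have "t powi k * t ^ nat (- k - 1) = t powi (k + (- k - 1))"
        using \<open>k < 0\<close> t_neq_0 by (subst power_int_add) (auto simp: power_int_def)
      also have "\<dots> = inverse t" by (simp add: power_int_minus)
      finally have "t powi k * t ^ nat (- k - 1) = inverse t" .
      then show ?thesis using t_neq_0 by (simp add: mult.assoc)
    qed
    ultimately show ?thesis by blast
  qed
  moreover have "t * v \<in> max_ideal V" if "v \<in> V" for v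
    using max_ideal_mult[OF V(1) that t_max_ideal[OF V]] by (simp add: mult.commute)
  ultimately show "max_ideal V = {t * v | v. v \<in> V}" by blast
  fix z assume z: "z \<in> F" "z \<noteq> 0"
  obtain k c where k: "lead V z k c" using infinite_lead[OF z] V by blast
  have "z = t powi (- k) * (z * t powi k)" using t_neq_0 by (simp add: power_int_minus)
  then show "\<exists>n u. u \<in> V - max_ideal V \<and> z = t powi n * u" using lead_unit[OF V k] by blast
qed

lemma infinite_place_residues:
  assumes V: "place V" "P \<notin> V" and z: "z \<in> V"
  shows "\<exists>x\<in>range \<iota>. z - x \<in> max_ideal V"
proof (cases "z \<in> max_ideal V")
  case True
  then show ?thesis by (intro bexI[of _ "\<iota> 0"]) simp_all
next
  case False
  then have "z \<noteq> 0" using max_ideal_0[OF V(1)] by auto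
  have zF: "z \<in> F" using place_sub[OF V(1) z] .
  obtain k c where k: "lead V z k c" using infinite_lead[OF zF \<open>z \<noteq> 0\<close>] V by blast
  then have "k = 0" using lead_in_place_iff[OF V k zF] z False by simp
  then show ?thesis using k by (intro bexI[of _ "\<iota> c"]) (simp_all add: lead_def)
qed

end

sublocale kummer_curve \<subseteq> discrete_field \<iota> "adjoin \<iota> {P, U}"
proof
  fix V assume V: "valuation_ring \<iota> (adjoin \<iota> {P, U}) V"
  show "\<exists>t. uniformizer V t"
    using finite_place_uniformizer[OF V] infinite_place_uniformizer[OF V] by blast
  show "\<exists>X. finite X \<and> (\<forall>z\<in>V. \<exists>x\<in>X. z - x \<in> max_ideal V)"
  proof (cases "P \<in> V")
    case True
    then show ?thesis by (rule finite_place_residues[OF V])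
  next
    case False
    then show ?thesis using infinite_place_residues[OF V] by (intro exI[of _ "range \<iota>"]) simp
  qed
qed

section \<open>The zero divisor of a polynomial\<close>

context kummer_curve
begin

definition Vinf :: "'h set" where
  "Vinf = (THE V. place V \<and> P \<notin> V)"

lemma Vinf: "place Vinf" "P \<notin> Vinf"
proof -
  have "\<exists>!V. place V \<and> P \<notin> V" using infinite_place_exists infinite_place_unique by blast
  then have "place Vinf \<and> P \<notin> Vinf" unfolding Vinf_def by (rule theI')
  then show "place Vinf" "P \<notin> Vinf" by auto
qed

lemma place_neq_Vinf: "place V \<Longrightarrow> V \<noteq> Vinf \<Longrightarrow> P \<in> V"
  using infinite_place_unique[OF _ _ Vinf] by blast

lemma val_Vinf:
  assumes "lead Vinf z k c"
  shows "val Vinf z = - k"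
proof -
  have eq: "z = t powi (- k) * (z * t powi k)" using t_neq_0 by (simp add: power_int_minus)
  show ?thesis
    using val_eq[OF Vinf(1) infinite_place_uniformizer[OF Vinf] lead_unit[OF Vinf assms], of "- k"]
    unfolding eq[symmetric] .
qed

lemma residue_degree_Vinf: "residue_degree \<iota> Vinf = 1"
proof -
  have "\<exists>!x. x \<in> range \<iota> \<and> z - x \<in> max_ideal Vinf" if z: "z \<in> Vinf" for z
  proof -
    obtain c where c: "z - \<iota> c \<in> max_ideal Vinf" using infinite_place_residues[OF Vinf z] by blast
    have "x = \<iota> c" if x: "x \<in> range \<iota>" "z - x \<in> max_ideal Vinf" for x
    proof -
      obtain e where e: "x = \<iota> e" using x(1) by blast
      have "(z - \<iota> c) - (z - x) \<in> max_ideal Vinf" by (rule max_ideal_diff[OF Vinf(1) c x(2)])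
      then have "\<iota> (e - c) \<in> max_ideal Vinf" by (simp add: e \<iota>_diff)
      then show ?thesis using max_ideal_const[OF Vinf(1)] e by simp
    qed
    note uniq = this
    show ?thesis by (rule ex1I[of _ "\<iota> c"]) (use c in simp, rule uniq, auto)
  qed
  then have "residue_system Vinf (range \<iota>)"
    unfolding residue_system_def using place_const[OF Vinf(1)] by auto
  then have "card (range \<iota>) = \<kappa> ^ residue_degree \<iota> Vinf" by (rule residue_degree_card[OF Vinf(1)])
  then have "\<kappa> ^ 1 = \<kappa> ^ residue_degree \<iota> Vinf" unfolding \<kappa>_def[symmetric] power_one_right .
  then show ?thesis unfolding power_inject_exp[OF \<kappa>_gt_1] by (rule sym)
qed

abbreviation finite_place :: "'h set \<Rightarrow> bool" where
  "finite_place V \<equiv> place V \<and> P \<in> V"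

text \<open>An element \<open>x\<close> of \<open>V\<close> outside \<open>W\<close> has a pole at
  \<open>W\<close>. By discreteness any \<open>z\<close> of \<open>F\<close> enters \<open>W\<close>
  after multiplication by a power of \<open>1/x\<close>; multiplying back by \<open>x\<close> stays
  inside \<open>V\<close>, which would then be all of \<open>F\<close>.\<close>

lemma places_maximal:
  assumes V: "place V" and W: "place W" and sub: "W \<subseteq> V"
  shows "W = V"
proof (rule ccontr)
  assume "W \<noteq> V"
  then obtain x where x: "x \<in> V" "x \<notin> W" using sub by blast
  have xF: "x \<in> F" using place_sub[OF V x(1)] .
  have x0: "x \<noteq> 0" using x subring_0[OF place_subring[OF W]] by auto
  have neg: "val W x < 0" using vge_0_iff[OF W xF] x x0 by (simp add: vge_def)
  have "z \<in> V" if z: "z \<in> F" for z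
  proof (cases "z = 0")
    case False
    define k where "k = nat \<bar>val W z\<bar>"
    have ix: "inverse x \<in> F" "inverse x \<noteq> 0" using subfield_inverse[OF subfield xF] x0 by auto
    have ixk: "inverse x ^ k \<in> F" "inverse x ^ k \<noteq> 0" using ix subring_power[OF F_subring] by auto
    have "val W (inverse x ^ k) = int k * - val W x"
      using val_power[OF W ix] val_inverse[OF W xF x0] by simp
    moreover have "int k * - val W x \<ge> int k * 1" using neg by (intro mult_left_mono) auto
    ultimately have "val W (z * inverse x ^ k) \<ge> 0"
      using val_mult[OF W z False ixk] by (simp add: k_def)
    then have "vge W 0 (z * inverse x ^ k)" by (simp add: vge_def)
    then have "z * inverse x ^ k \<in> W"
      using vge_0_iff[OF W subring_mult[OF F_subring z ixk(1)]] by simp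
    then have "z * inverse x ^ k \<in> V" using sub by blast
    then have "(z * inverse x ^ k) * x ^ k \<in> V"
      by (rule subring_mult[OF place_subring[OF V] _ subring_power[OF place_subring[OF V] x(1)]])
    then show ?thesis using x0 by (simp add: power_inverse mult.assoc)
  qed (simp add: subring_0 place_subring V)
  then show False using place_neq[OF V] by blast
qed

text \<open>By \<open>R_fraction\<close> a finite place is the localization of \<open>R\<close> at
  the prime it cuts out. So an inclusion of primes gives the reverse inclusion of places, and places
  are maximal.\<close>

lemma finite_places_eq:
  assumes V: "finite_place V" and W: "finite_place W"
    and sub: "\<And>a. a \<in> R \<Longrightarrow> a \<in> max_ideal V \<Longrightarrow> a \<in> max_ideal W"
  shows "V = W"
proof -
  have "W \<subseteq> V"
  proof
    fix z assume z: "z \<in> W"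
    obtain u where u: "u \<in> R" "u \<notin> max_ideal W" "u * z \<in> R" using R_fraction[of W z] W z by blast
    have "u \<in> V - max_ideal V" using u sub R_in_place V by blast
    then have "u \<noteq> 0" "inverse u \<in> V" unfolding unit_iff by auto
    moreover have "u * z \<in> V" using u R_in_place V by blast
    ultimately have "(u * z) * inverse u \<in> V" using subring_mult[OF place_subring] V by blast
    moreover have "(u * z) * inverse u = z" using \<open>u \<noteq> 0\<close> by (simp add: field_simps)
    ultimately show "z \<in> V" by simp
  qed
  then show ?thesis using places_maximal V W by blast
qed

lemma R_uniformizer:
  assumes V: "finite_place V"
  shows "\<exists>a\<in>R. a \<noteq> 0 \<and> val V a = 1"
proof -
  have pV: "place V" using V by blast
  have um: "unif V \<in> V" using unif_max_ideal[OF pV] max_ideal_sub by blast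
  obtain u where u: "u \<in> R" "u \<notin> max_ideal V" "u * unif V \<in> R"
    using R_fraction[of V "unif V"] V um by blast
  have uu: "u \<in> V - max_ideal V" using u R_in_place V by blast
  then have u0: "u \<noteq> 0" unfolding unit_iff by simp
  have "val V (u * unif V) = 1"
    using val_mult[OF pV R_in_F[OF u(1)] u0 unif_F[OF pV] unif_neq_0[OF pV]] val_unit[OF pV uu] val_unif[OF pV]
    by simp
  then show ?thesis using u(3) u0 unif_neq_0[OF pV] by (intro bexI[of _ "u * unif V"]) auto
qed

lemma R_residues:
  assumes V: "finite_place V"
  shows "\<exists>Y\<subseteq>R. finite Y \<and> card Y = \<kappa> ^ residue_degree \<iota> V \<and>
    (\<forall>x\<in>Y. \<forall>y\<in>Y. x - y \<in> max_ideal V \<longrightarrow> x = y)"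
proof -
  have pV: "place V" and PV: "P \<in> V" using V by blast+
  obtain T where T: "residue_system V T" using residue_system_exists[OF pV] by blast
  obtain g where g: "g \<noteq> 0" "ev g \<in> max_ideal V" using max_ideal_poly[OF pV PV] by blast
  have "\<exists>r\<in>R. x - r \<in> max_ideal V" if "x \<in> T" for x
  proof -
    have "x \<in> V" using T that by (auto simp: residue_system_def)
    then obtain \<rho> v where \<rho>: "\<rho> \<in> residues g" "v \<in> V" "x = \<rho> + ev g * v"
      using place_mod[OF pV PV _ g(1)] by blast
    have "x - \<rho> \<in> max_ideal V" using max_ideal_mult[OF pV \<rho>(2) g(2)] \<rho>(3) by (simp add: mult.commute)
    then show ?thesis using \<rho>(1) combs_below_R by blast
  qed
  then obtain f where f: "\<And>x. x \<in> T \<Longrightarrow> f x \<in> R" "\<And>x. x \<in> T \<Longrightarrow> x - f x \<in> max_ideal V" by metis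
  have uni: "x = y" if xy: "x \<in> T" "y \<in> T" "f x - f y \<in> max_ideal V" for x y
  proof -
    have "(x - f x) + (f x - f y) \<in> max_ideal V" by (rule max_ideal_add[OF pV f(2)[OF xy(1)] xy(3)])
    from max_ideal_diff[OF pV this f(2)[OF xy(2)]] have "x - y \<in> max_ideal V" by simp
    moreover have "x - x \<in> max_ideal V" using max_ideal_0[OF pV] by simp
    moreover have "x \<in> V" using T xy(1) by (auto simp: residue_system_def)
    ultimately show ?thesis using T xy unfolding residue_system_def by blast
  qed
  have "inj_on f T"
  proof (rule inj_onI)
    fix x y assume "x \<in> T" "y \<in> T" "f x = f y"
    then show "x = y" using uni max_ideal_0[OF pV] by simp
  qed
  then have "card (f ` T) = \<kappa> ^ residue_degree \<iota> V"
    using card_image residue_degree_card[OF pV T] by metis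
  moreover have "finite (f ` T)" using T by (simp add: residue_system_def)
  moreover have "\<forall>x\<in>f ` T. \<forall>y\<in>f ` T. x - y \<in> max_ideal V \<longrightarrow> x = y" using uni by blast
  moreover have "f ` T \<subseteq> R" using f by blast
  ultimately show ?thesis by blast
qed

lemma vge_power:
  assumes V: "place V" and a: "a \<in> max_ideal V"
  shows "vge V (int k) (a ^ k)"
proof (induction k)
  case 0
  then show ?case using vge_0_iff[OF V, of 1] subring_1[OF F_subring] subring_1[OF place_subring[OF V]] by simp
next
  case (Suc k)
  have aF: "a \<in> F" using place_sub[OF V max_ideal_sub[OF a]] .
  have "vge V 1 a" using vge_1_iff[OF V aF] a by simp
  from vge_mult[OF V aF subring_power[OF F_subring aF] this Suc] show ?case by (simp add: add.commute)
qed

lemma vge_R: "a \<in> R \<Longrightarrow> finite_place V \<Longrightarrow> vge V 0 a"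
  using vge_0_iff[of V a] R_in_F R_in_place by blast

text \<open>The element is a power of a uniformizer at \<open>Q\<close> times powers of elements
  that vanish at one other place of \<open>S\<close> but not at \<open>Q\<close>; these exist by
  \<open>finite_places_eq\<close>. Only the order at \<open>Q\<close> is exact.\<close>

lemma R_approximation:
  assumes S: "finite S" "\<And>V. V \<in> S \<Longrightarrow> finite_place V" and Q: "Q \<in> S"
  shows "\<exists>a\<in>R. a \<noteq> 0 \<and> val Q a = int (B Q) \<and> (\<forall>V\<in>S. vge V (int (B V)) a)"
proof -
  have pQ: "place Q" "P \<in> Q" using S(2)[OF Q] by blast+
  obtain p where p: "p \<in> R" "p \<noteq> 0" "val Q p = 1" using R_uniformizer[OF S(2)[OF Q]] by blast
  have "\<exists>s\<in>R. s \<in> max_ideal V \<and> s \<notin> max_ideal Q" if "V \<in> S - {Q}" for V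
  proof (rule ccontr)
    assume "\<not> (\<exists>s\<in>R. s \<in> max_ideal V \<and> s \<notin> max_ideal Q)"
    then have "V = Q" by (intro finite_places_eq) (use S(2) Q that in blast)+
    then show False using that by blast
  qed
  then obtain s where s: "\<And>V. V \<in> S - {Q} \<Longrightarrow> s V \<in> R" "\<And>V. V \<in> S - {Q} \<Longrightarrow> s V \<in> max_ideal V"
    "\<And>V. V \<in> S - {Q} \<Longrightarrow> s V \<notin> max_ideal Q" by metis
  define b where "b = (\<Prod>V\<in>S - {Q}. s V ^ B V)"
  have bR: "b \<in> R" unfolding b_def using s(1) by (intro subring_prod subring_power R_subring)
  have bu: "b \<in> Q - max_ideal Q"
  proof -
    have "(\<Prod>V\<in>T. s V ^ B V) \<in> Q - max_ideal Q" if "finite T" "T \<subseteq> S - {Q}" for T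
      using that
    proof (induction T rule: finite_induct)
      case empty
      then show ?case using max_ideal_1[OF pQ(1)] subring_1[OF place_subring[OF pQ(1)]] by simp
    next
      case (insert V T)
      have V: "V \<in> S - {Q}" using insert by blast
      have "s V \<in> Q - max_ideal Q" using s[OF V] R_in_place pQ by blast
      from unit_powi[OF pQ(1) this, of "int (B V)"] have "s V ^ B V \<in> Q - max_ideal Q" by simp
      moreover have "(\<Prod>V\<in>T. s V ^ B V) \<in> Q - max_ideal Q" using insert by blast
      ultimately have "s V ^ B V * (\<Prod>V\<in>T. s V ^ B V) \<in> Q - max_ideal Q" by (rule unit_mult[OF pQ(1)])
      then show ?case using insert by simp
    qed
    then show ?thesis unfolding b_def using S(1) by blast
  qed
  then have b0: "b \<noteq> 0" unfolding unit_iff by simp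
  let ?a = "p ^ B Q * b"
  have aR: "?a \<in> R" using p bR by (intro subring_mult subring_power R_subring)
  have pk: "p ^ B Q \<in> F" "p ^ B Q \<noteq> 0" using p R_in_F subring_power[OF R_subring] by auto
  have va: "val Q ?a = int (B Q)"
    using val_mult[OF pQ(1) pk R_in_F[OF bR] b0] val_power[OF pQ(1) R_in_F[OF p(1)] p(2)] p(3)
      val_unit[OF pQ(1) bu] by simp
  have "vge V (int (B V)) ?a" if V: "V \<in> S" for V
  proof (cases "V = Q")
    case True
    then show ?thesis using va by (simp add: vge_def)
  next
    case False
    then have VS: "V \<in> S - {Q}" using V by blast
    have pV: "place V" using S(2)[OF V] by blast
    let ?r = "\<Prod>V\<in>S - {Q} - {V}. s V ^ B V"
    have "b = s V ^ B V * ?r" unfolding b_def by (rule prod.remove) (use S(1) VS in auto)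
    then have eq: "?a = s V ^ B V * (p ^ B Q * ?r)" by (simp add: mult_ac)
    have rR: "?r \<in> R" using s(1) by (intro subring_prod subring_power R_subring) blast
    have "p ^ B Q * ?r \<in> R" using p by (intro subring_mult subring_power R_subring rR)
    note m = this
    have sR: "s V ^ B V \<in> R" using s(1)[OF VS] subring_power[OF R_subring] by blast
    show ?thesis
      using vge_mult[OF pV R_in_F[OF sR] R_in_F[OF m] vge_power[OF pV s(2)[OF VS]] vge_R[OF m S(2)[OF V]]]
      unfolding eq by simp
  qed
  then show ?thesis using aR va p b0 by (intro bexI[of _ ?a]) auto
qed

text \<open>A counting version of the Chinese remainder theorem.\<close>

lemma incongruent_set:
  assumes S: "finite S" "\<And>V. V \<in> S \<Longrightarrow> finite_place V"
  shows "\<exists>X\<subseteq>R. finite X \<and> card X = \<kappa> ^ (\<Sum>V\<in>S. B V * residue_degree \<iota> V) \<and>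
    (\<forall>x\<in>X. \<forall>y\<in>X. (\<forall>V\<in>S. vge V (int (B V)) (x - y)) \<longrightarrow> x = y)"
proof (induction "\<Sum>V\<in>S. B V" arbitrary: B)
  case 0
  then have "\<forall>V\<in>S. B V = 0" using S(1) by simp
  then have "(\<Sum>V\<in>S. B V * residue_degree \<iota> V) = 0" by simp
  then show ?case using subring_0[OF R_subring] by (intro exI[of _ "{0}"]) auto
next
  case (Suc k)
  have "\<exists>Q\<in>S. B Q \<noteq> 0"
  proof (rule ccontr)
    assume "\<not> (\<exists>Q\<in>S. B Q \<noteq> 0)"
    then have "(\<Sum>V\<in>S. B V) = 0" by simp
    then show False using Suc.hyps(2) by simp
  qed
  then obtain Q where Q: "Q \<in> S" "B Q \<noteq> 0" by blast
  define B' where "B' = B(Q := B Q - 1)"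
  have B'Q: "B Q = Suc (B' Q)" using Q(2) by (simp add: B'_def)
  have B'V: "B V = B' V" if "V \<noteq> Q" for V using that by (simp add: B'_def)
  have sums: "(\<Sum>V\<in>S. f V (B V)) = f Q (B Q) + (\<Sum>V\<in>S-{Q}. f V (B' V))"
    "(\<Sum>V\<in>S. f V (B' V)) = f Q (B' Q) + (\<Sum>V\<in>S-{Q}. f V (B' V))" for f :: "'h set \<Rightarrow> nat \<Rightarrow> nat"
  proof -
    have "(\<Sum>V\<in>S-{Q}. f V (B V)) = (\<Sum>V\<in>S-{Q}. f V (B' V))" by (rule sum.cong) (auto simp: B'V)
    then show "(\<Sum>V\<in>S. f V (B V)) = f Q (B Q) + (\<Sum>V\<in>S-{Q}. f V (B' V))"
      using sum.remove[OF S(1) Q(1), of "\<lambda>V. f V (B V)"] by simp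
    show "(\<Sum>V\<in>S. f V (B' V)) = f Q (B' Q) + (\<Sum>V\<in>S-{Q}. f V (B' V))"
      by (rule sum.remove[OF S(1) Q(1)])
  qed
  have "k = (\<Sum>V\<in>S. B' V)" using Suc.hyps(2) sums[of "\<lambda>_ b. b"] B'Q by simp
  from Suc.hyps(1)[OF this] obtain X where X: "X \<subseteq> R" "finite X"
    "card X = \<kappa> ^ (\<Sum>V\<in>S. B' V * residue_degree \<iota> V)"
    "\<forall>x\<in>X. \<forall>y\<in>X. (\<forall>V\<in>S. vge V (int (B' V)) (x - y)) \<longrightarrow> x = y"
    by (elim exE conjE) (rule that)
  have deg: "(\<Sum>V\<in>S. B V * residue_degree \<iota> V) = (\<Sum>V\<in>S. B' V * residue_degree \<iota> V) + residue_degree \<iota> Q"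
    using sums[of "\<lambda>V b. b * residue_degree \<iota> V"] B'Q by simp
  have pQ: "finite_place Q" using S(2) Q by blast
  from R_residues[OF pQ] obtain Y where Y: "Y \<subseteq> R" "finite Y" "card Y = \<kappa> ^ residue_degree \<iota> Q"
    "\<forall>x\<in>Y. \<forall>y\<in>Y. x - y \<in> max_ideal Q \<longrightarrow> x = y"
    by (elim exE conjE) (rule that)
  obtain a where a: "a \<in> R" "a \<noteq> 0" "val Q a = int (B' Q)" "\<And>V. V \<in> S \<Longrightarrow> vge V (int (B' V)) a"
    using R_approximation[OF S Q(1), of B'] by blast
  \<comment> \<open>\<open>a\<close> has order exactly \<open>B' Q\<close> at \<open>Q\<close>, so
    \<open>y\<close> supplies the one further residue by which \<open>B\<close> exceeds
    \<open>B'\<close> there.\<close>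
  let ?f = "\<lambda>(x, y). x + a * y"
  have uni: "x = x' \<and> y = y'"
    if x: "x \<in> X" "x' \<in> X" and y: "y \<in> Y" "y' \<in> Y"
      and cong: "\<And>V. V \<in> S \<Longrightarrow> vge V (int (B V)) ((x + a * y) - (x' + a * y'))" for x x' y y'
  proof -
    let ?D = "(x + a * y) - (x' + a * y')"
    have xR: "x \<in> R" "x' \<in> R" and yR: "y \<in> R" "y' \<in> R" using x y X(1) Y(1) by auto
    have yyR: "y - y' \<in> R" using yR subring_diff[OF R_subring] by blast
    have aR: "a * (y - y') \<in> R" by (rule subring_mult[OF R_subring a(1) yyR])
    have DF: "?D \<in> F"
      using xR yR a(1) by (intro R_in_F subring_diff subring_add subring_mult R_subring)
    have "vge V (int (B' V)) (x - x')" if V: "V \<in> S" for V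
    proof -
      have pV: "place V" using S(2)[OF V] by blast
      have 1: "vge V (int (B' V)) ?D"
        using cong[OF V] by (rule vge_mono) (use B'Q B'V[of V] in \<open>cases "V = Q"; simp\<close>)
      have 2: "vge V (int (B' V)) (a * (y - y'))"
        using vge_mult[OF pV R_in_F[OF a(1)] R_in_F[OF yyR] a(4)[OF V] vge_R[OF yyR S(2)[OF V]]] by simp
      have eq: "?D - a * (y - y') = x - x'" by (simp add: algebra_simps)
      show ?thesis using vge_diff[OF pV DF R_in_F[OF aR] 1 2] unfolding eq .
    qed
    then have xx: "x = x'" using bspec[OF bspec[OF X(4) x(1)] x(2)] by simp
    then have D: "?D = a * (y - y')" by (simp add: algebra_simps)
    have "y = y'"
    proof (rule ccontr)
      assume "y \<noteq> y'"
      then have "y - y' \<noteq> 0" by simp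
      then have "val Q (a * (y - y')) = int (B' Q) + val Q (y - y')"
        using val_mult[OF _ R_in_F[OF a(1)] a(2) R_in_F[OF yyR]] pQ a(3) by simp
      moreover have "vge Q (int (B Q)) (a * (y - y'))" using cong[OF Q(1)] unfolding D .
      ultimately have "vge Q 1 (y - y')" using a(2) B'Q \<open>y - y' \<noteq> 0\<close> by (simp add: vge_def)
      then have "y - y' \<in> max_ideal Q" using vge_1_iff[OF _ R_in_F[OF yyR]] pQ by blast
      then show False using bspec[OF bspec[OF Y(4) y(1)] y(2)] \<open>y \<noteq> y'\<close> by simp
    qed
    then show ?thesis using xx by blast
  qed
  have inj: "inj_on ?f (X \<times> Y)"
  proof (rule inj_onI)
    fix u v assume uv: "u \<in> X \<times> Y" "v \<in> X \<times> Y" "?f u = ?f v"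
    obtain x y x' y' where xy: "u = (x, y)" "v = (x', y')" by (metis surj_pair)
    have "x = x' \<and> y = y'" by (rule uni) (use uv xy vge_0 in auto)
    then show "u = v" using xy by simp
  qed
  have "card (?f ` (X \<times> Y)) = \<kappa> ^ (\<Sum>V\<in>S. B V * residue_degree \<iota> V)"
    unfolding card_image[OF inj] deg power_add using X(3) Y(3) by (simp add: card_cartesian_product)
  moreover have "?f ` (X \<times> Y) \<subseteq> R"
  proof
    fix v assume "v \<in> ?f ` (X \<times> Y)"
    then obtain x y where "v = x + a * y" "x \<in> R" "y \<in> R" using X(1) Y(1) by auto
    then show "v \<in> R" using a(1) by (auto intro!: subring_add subring_mult R_subring)
  qed
  moreover have "finite (?f ` (X \<times> Y))" using X(2) Y(2) by blast
  moreover have "\<forall>u\<in>?f ` (X \<times> Y). \<forall>v\<in>?f ` (X \<times> Y). (\<forall>V\<in>S. vge V (int (B V)) (u - v)) \<longrightarrow> u = v"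
  proof (intro ballI impI)
    fix u v assume uv: "u \<in> ?f ` (X \<times> Y)" "v \<in> ?f ` (X \<times> Y)" and c: "\<forall>V\<in>S. vge V (int (B V)) (u - v)"
    obtain x y where u: "u = x + a * y" "x \<in> X" "y \<in> Y" using uv(1) by auto
    obtain x' y' where v: "v = x' + a * y'" "x' \<in> X" "y' \<in> Y" using uv(2) by auto
    have "x = x' \<and> y = y'" by (rule uni[OF u(2) v(2) u(3) v(3)]) (use c u(1) v(1) in blast)
    then show "u = v" using u v by simp
  qed
  ultimately show ?case by (intro exI[of _ "?f ` (X \<times> Y)"] conjI)
qed

definition zero_places :: "'k poly \<Rightarrow> 'h set set" where
  "zero_places g = {V. finite_place V \<and> ev g \<in> max_ideal V}"

text \<open>A zero of \<open>g\<close> corresponds to an ideal of the finite ring R/gR, and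
  \<open>finite_places_eq\<close> recovers the place from it.\<close>

lemma zero_places_finite:
  assumes g: "g \<noteq> 0"
  shows "finite (zero_places g)"
proof -
  have "inj_on (\<lambda>V. max_ideal V \<inter> residues g) (zero_places g)"
  proof (rule inj_onI)
    fix V W assume V: "V \<in> zero_places g" and W: "W \<in> zero_places g"
      and eq: "max_ideal V \<inter> residues g = max_ideal W \<inter> residues g"
    have V': "finite_place V" "ev g \<in> max_ideal V" and W': "finite_place W" "ev g \<in> max_ideal W"
      using V W by (auto simp: zero_places_def)
    show "V = W"
    proof (rule finite_places_eq[OF V'(1) W'(1)])
      fix a assume a: "a \<in> R" "a \<in> max_ideal V"
      obtain \<rho> s where \<rho>: "\<rho> \<in> residues g" "s \<in> R" "a = \<rho> + ev g * s" using R_mod[OF a(1) g] by blast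
      have gs: "s * ev g \<in> max_ideal V'" if "finite_place V'" "ev g \<in> max_ideal V'" for V'
        using max_ideal_mult[OF _ R_in_place[OF \<rho>(2)] that(2)] that(1) by blast
      have "a - s * ev g \<in> max_ideal V" using max_ideal_diff[OF _ a(2) gs[OF V']] V' by blast
      then have "\<rho> \<in> max_ideal V" using \<rho>(3) by (simp add: mult.commute)
      then have "\<rho> \<in> max_ideal W" using eq \<rho>(1) by blast
      then have "\<rho> + s * ev g \<in> max_ideal W" using max_ideal_add[OF _ _ gs[OF W']] W' by blast
      then show "a \<in> max_ideal W" using \<rho>(3) by (simp add: mult.commute)
    qed
  qed
  moreover have "finite ((\<lambda>V. max_ideal V \<inter> residues g) ` zero_places g)"
    by (rule finite_subset[of _ "Pow (residues g)"]) (auto simp: combs_below_finite)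
  ultimately show ?thesis using finite_imageD by blast
qed

lemma val_zero_places: "V \<in> zero_places g \<Longrightarrow> g \<noteq> 0 \<Longrightarrow> val V (ev g) \<ge> 1"
  using vge_1_iff[of V "ev g"] ev_in_F[of g] by (auto simp: zero_places_def vge_def)

lemma val_not_zero_places: "finite_place V \<Longrightarrow> V \<notin> zero_places g \<Longrightarrow> val V (ev g) = 0"
  using ev_in_place[of V g] by (intro val_unit) (auto simp: zero_places_def)

text \<open>Elements congruent modulo \<open>g\<close> are congruent at every zero of
  \<open>g\<close> to the order of that zero. So a set that is incongruent there injects into R/gR,
  and the two cardinalities are compared.\<close>

lemma degree_zero_divisor_le:
  assumes g: "g \<noteq> 0"
  shows "(\<Sum>V\<in>zero_places g. val V (ev g) * int (residue_degree \<iota> V)) \<le> int N * int (degree g)"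
proof -
  let ?S = "zero_places g"
  let ?B = "\<lambda>V. nat (val V (ev g))"
  have fin: "finite ?S" and S: "\<And>V. V \<in> ?S \<Longrightarrow> finite_place V"
    using zero_places_finite[OF g] by (auto simp: zero_places_def)
  have "\<exists>X\<subseteq>R. finite X \<and> card X = \<kappa> ^ (\<Sum>V\<in>?S. ?B V * residue_degree \<iota> V) \<and>
    (\<forall>x\<in>X. \<forall>y\<in>X. (\<forall>V\<in>?S. vge V (int (?B V)) (x - y)) \<longrightarrow> x = y)"
    by (rule incongruent_set[OF fin S])
  then obtain X where X: "X \<subseteq> R" "finite X"
    "card X = \<kappa> ^ (\<Sum>V\<in>?S. ?B V * residue_degree \<iota> V)"
    "\<forall>x\<in>X. \<forall>y\<in>X. (\<forall>V\<in>?S. vge V (int (?B V)) (x - y)) \<longrightarrow> x = y"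
    by (elim exE conjE) (rule that)
  have "\<forall>x\<in>X. \<exists>\<rho>. \<rho> \<in> residues g \<and> (\<exists>s\<in>R. x = \<rho> + ev g * s)" using X(1) R_mod[OF _ g] by blast
  then obtain f where f: "\<And>x. x \<in> X \<Longrightarrow> f x \<in> residues g" "\<And>x. x \<in> X \<Longrightarrow> \<exists>s\<in>R. x = f x + ev g * s"
    by metis
  have "inj_on f X"
  proof (rule inj_onI)
    fix x y assume xy: "x \<in> X" "y \<in> X" "f x = f y"
    obtain s where s: "s \<in> R" "x = f x + ev g * s" using f(2) xy by blast
    obtain s' where s': "s' \<in> R" "y = f y + ev g * s'" using f(2) xy by blast
    have d: "x - y = ev g * (s - s')" by (subst s(2), subst s'(2)) (simp add: xy(3) algebra_simps)
    have ssR: "s - s' \<in> R" using s s' subring_diff[OF R_subring] by blast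
    show "x = y"
    proof (rule bspec[OF bspec[OF X(4) xy(1)] xy(2), rule_format])
      fix V assume V: "V \<in> ?S"
      have "vge V (int (?B V)) (ev g)" using val_zero_places[OF V g] by (simp add: vge_def)
      then show "vge V (int (?B V)) (x - y)"
        using vge_mult[OF _ ev_in_F R_in_F[OF ssR] _ vge_R[OF ssR S[OF V]]] S[OF V] unfolding d by fastforce
    qed
  qed
  then have "card X \<le> card (residues g)"
    using f(1) combs_below_finite by (intro card_inj_on_le[of f]) auto
  then have "\<kappa> ^ (\<Sum>V\<in>?S. ?B V * residue_degree \<iota> V) \<le> \<kappa> ^ (N * degree g)"
    unfolding X(3) combs_below_card by simp
  then have "(\<Sum>V\<in>?S. ?B V * residue_degree \<iota> V) \<le> N * degree g"
    by (rule power_le_imp_le_exp[OF \<kappa>_gt_1])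
  then have "int (\<Sum>V\<in>?S. ?B V * residue_degree \<iota> V) \<le> int (N * degree g)" by (rule of_nat_mono)
  moreover have "int (\<Sum>V\<in>?S. ?B V * residue_degree \<iota> V) = (\<Sum>V\<in>?S. val V (ev g) * int (residue_degree \<iota> V))"
    unfolding of_nat_sum using val_zero_places[OF _ g] by (intro sum.cong) force+
  ultimately show ?thesis by simp
qed

end

section \<open>The genus of the Kummer extension\<close>

lemma ceiling_div_le_iff:
  fixes p y :: int
  assumes "k > 0"
  shows "(p + k - 1) div k \<le> y \<longleftrightarrow> p \<le> k * y"
proof
  define c r where "c = (p + k - 1) div k" and "r = (p + k - 1) mod k"
  have eq: "p + k - 1 = k * c + r" by (simp add: c_def r_def)
  have r: "0 \<le> r" "r < k" using assms by (simp_all add: r_def)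
  {
    assume "(p + k - 1) div k \<le> y"
    then have "k * c \<le> k * y" using assms by (simp add: c_def)
    then show "p \<le> k * y" using eq r by linarith
  }
  assume p: "p \<le> k * y"
  show "(p + k - 1) div k \<le> y"
  proof (rule ccontr)
    assume "\<not> (p + k - 1) div k \<le> y"
    then have "k * (y + 1) \<le> k * c" using assms by (intro mult_left_mono) (auto simp: c_def)
    then show False using eq r p by (simp add: distrib_left)
  qed
qed

context kummer_curve
begin

text \<open>The quotient of the pole order of \<open>w i\<close> by \<open>N\<close>, rounded up: \<open>f w\<^sub>i\<close> with a polynomial
  \<open>f\<close> in \<open>P\<close> has pole order at most \<open>N M\<close> if and only if \<open>f\<close> has degree at most \<open>M - gap i\<close>.\<close>

definition gap :: "nat \<Rightarrow> int" where
  "gap i = (pole i + int N - 1) div int N"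

text \<open>This is (N - 1)(n - 1)/4, since \<open>Z\<close> has (n - 1)/2 elements;
  \<open>N\<close> is odd, so the division is exact.\<close>

definition \<gamma> :: nat where
  "\<gamma> = (N - 1) * card Z div 2"

lemma gap_0: "gap 0 = 0"
  using N_pos by (simp add: gap_def pole_def)

text \<open>The floors of 2i/N and 2(N-i)/N add up to 1, so the two pole orders add up to N (card Z
  + 1). As neither is a multiple of \<open>N\<close>, rounding both up adds one more.\<close>

lemma gap_pair:
  assumes i: "0 < i" "i < N"
  shows "gap i + gap (N - i) = int (card Z) + 2"
proof -
  let ?z = "int (card Z)" and ?N = "int N"
  have Npos: "?N > 0" using N_pos by simp
  have floors: "int (2 * i div N) + int (2 * (N - i) div N) = 1"
  proof (cases "2 * i < N")
    case True
    then have eq: "N + (N - 2 * i) = 2 * (N - i)" and "N - 2 * i < N" using i by auto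
    moreover have "(N + (N - 2 * i)) div N = (N - 2 * i) div N + 1" using N_pos by (intro div_add_self1) simp
    ultimately have "2 * (N - i) div N = 1" unfolding eq by simp
    then show ?thesis using True by simp
  next
    case False
    moreover have "2 * i \<noteq> N" using N_odd by auto
    ultimately have eq: "N + (2 * i - N) = 2 * i" and "2 * i - N < N" "2 * (N - i) < N" using i by auto
    moreover have "(N + (2 * i - N)) div N = (2 * i - N) div N + 1" using N_pos by (intro div_add_self1) simp
    ultimately have "2 * i div N = 1" unfolding eq by simp
    then show ?thesis using \<open>2 * (N - i) < N\<close> by simp
  qed
  have "pole i + pole (N - i) = int n * (int i + int (N - i)) -
      ?N * ?z * (int (2 * i div N) + int (2 * (N - i) div N))"
    by (simp add: pole_def algebra_simps)
  also have "\<dots> = ?N * (?z + 1)"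
    unfolding floors using i by (simp add: n_def algebra_simps of_nat_diff)
  finally have sum: "pole (N - i) = ?N * (?z + 1) - pole i" by simp
  define c r where "c = pole i div ?N" and "r = pole i mod ?N"
  have pole_i: "pole i = ?N * c + r" by (simp add: c_def r_def)
  have r: "0 \<le> r" "r < ?N" using Npos by (simp_all add: r_def)
  have "r \<noteq> 0"
  proof
    assume "r = 0"
    then have "?N dvd pole i" using pole_i by simp
    then have "?N dvd pole i + ?N * (?z * int (2 * i div N))" by (intro dvd_add) simp_all
    then have "?N dvd int n * int i" by (simp add: pole_def mult.assoc)
    moreover have "coprime ?N (int n)" using cop unfolding n_def coprime_int_iff .
    ultimately have "?N dvd int i" by (simp add: coprime_dvd_mult_right_iff)
    then have "N dvd i" by (simp only: int_dvd_int_iff)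
    then show False using i by (auto dest: dvd_imp_le)
  qed
  have "pole i + ?N - 1 = (r - 1) + ?N * (c + 1)" using pole_i by (simp add: algebra_simps)
  then have 1: "gap i = c + 1" unfolding gap_def using r \<open>r \<noteq> 0\<close> Npos
    by (simp only:) (subst div_mult_self2, auto simp: div_pos_pos_trivial)
  have "pole (N - i) + ?N - 1 = (?N - r - 1) + ?N * (?z + 1 - c)"
    unfolding sum pole_i by (simp add: algebra_simps)
  then have 2: "gap (N - i) = ?z + 1 - c" unfolding gap_def using r Npos
    by (simp only:) (subst div_mult_self2, auto simp: div_pos_pos_trivial)
  show ?thesis using 1 2 by simp
qed

lemma sum_gap: "(\<Sum>i<N. gap i) = int N - 1 + int \<gamma>"
proof -
  have N1: "{..<N} = insert 0 {1..<N}" using N_pos by auto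
  have "(\<Sum>i\<in>{1..<N}. gap (N - i)) = (\<Sum>i\<in>{1..<N}. gap i)"
    by (rule sum.reindex_bij_witness[of _ "\<lambda>i. N - i" "\<lambda>i. N - i"]) auto
  then have "2 * (\<Sum>i\<in>{1..<N}. gap i) = (\<Sum>i\<in>{1..<N}. gap i + gap (N - i))"
    by (simp add: sum.distrib)
  also have "\<dots> = (\<Sum>i\<in>{1..<N}. int (card Z) + 2)" by (rule sum.cong) (auto simp: gap_pair)
  also have "\<dots> = int (N - 1) * (int (card Z) + 2)" by simp
  finally have 2: "2 * (\<Sum>i\<in>{1..<N}. gap i) = int (N - 1) * (int (card Z) + 2)" .
  have "even ((N - 1) * card Z)" using N_odd by simp
  then have "2 * \<gamma> = (N - 1) * card Z" by (simp add: \<gamma>_def)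
  then have "2 * int \<gamma> = int (N - 1) * int (card Z)" by (metis of_nat_mult of_nat_numeral)
  moreover have "int (N - 1) = int N - 1" using N_pos by (simp add: of_nat_diff)
  ultimately have "2 * (\<Sum>i\<in>{1..<N}. gap i) = 2 * (int N - 1 + int \<gamma>)" using 2 by (simp add: algebra_simps)
  then show ?thesis unfolding N1 using gap_0 by simp
qed

text \<open>\<open>M\<close> times the pole divisor of \<open>P\<close>, whose only pole is at
  infinity and has order \<open>N\<close>.\<close>

definition Ainf :: "int \<Rightarrow> 'h set \<Rightarrow> int" where
  "Ainf M V = (if V = Vinf then int N * M else 0)"

lemma Ainf_divisor: "Ainf M \<in> divisors \<iota> F"
proof -
  have "{V. Ainf M V \<noteq> 0} \<subseteq> {Vinf}" by (auto simp: Ainf_def split: if_splits)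
  then have "finite {V. Ainf M V \<noteq> 0}" by (rule finite_subset) simp
  then show ?thesis unfolding divisors_def using Vinf(1) by (auto simp: Ainf_def split: if_splits)
qed

lemma Ainf_degree: "divisor_degree \<iota> (Ainf M) = int N * M"
proof -
  have "divisor_degree \<iota> (Ainf M) = (\<Sum>V\<in>{Vinf}. Ainf M V * int (residue_degree \<iota> V))"
    by (rule divisor_degree_superset) (auto simp: Ainf_def split: if_splits)
  then show ?thesis by (simp add: Ainf_def residue_degree_Vinf)
qed

text \<open>Absence of finite poles means membership in \<open>R\<close>, and the pole order of a
  combination at infinity is the largest among its terms. So the condition splits into degree bounds
  for the coordinates.\<close>

lemma L_Ainf: "L (Ainf M) = combs_below (\<lambda>i. nat (M + 1 - gap i))"
proof -
  have Npos: "int N > 0" using N_pos by simp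
  have below: "a i \<noteq> 0 \<Longrightarrow> a i \<in> polys_below (nat (M + 1 - gap i)) \<longleftrightarrow> comb_degree a i \<le> int N * M"
    for a :: "nat \<Rightarrow> 'k poly" and i
  proof -
    assume "a i \<noteq> 0"
    then have "a i \<in> polys_below (nat (M + 1 - gap i)) \<longleftrightarrow> gap i \<le> M - int (degree (a i))"
      by (auto simp: polys_below_def)
    also have "\<dots> \<longleftrightarrow> pole i \<le> int N * (M - int (degree (a i)))"
      unfolding gap_def by (rule ceiling_div_le_iff[OF Npos])
    finally show ?thesis by (simp add: comb_degree_def algebra_simps)
  qed
  have lead_case: "vge Vinf (- (int N * M)) (comb 1 a) \<longleftrightarrow> (\<forall>i<N. a i \<in> polys_below (nat (M + 1 - gap i)))" for a
  proof (cases "\<exists>i<N. a i \<noteq> 0")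
    case False
    then have "comb 1 a = 0" unfolding comb_1 by (intro sum.neutral) auto
    then show ?thesis using False by (auto simp: vge_0 polys_below_def)
  next
    case True
    then obtain j where j: "j < N" "a j \<noteq> 0"
      and max: "\<And>i. i < N \<Longrightarrow> a i \<noteq> 0 \<Longrightarrow> comb_degree a i \<le> comb_degree a j"
      and ld: "lead Vinf (comb 1 a) (comb_degree a j) (lead_coeff (a j))"
      using comb_lead[of _ a] Vinf by blast
    have "vge Vinf (- (int N * M)) (comb 1 a) \<longleftrightarrow> comb_degree a j \<le> int N * M"
      using lead_neq_0[OF Vinf ld] val_Vinf[OF ld] by (simp add: vge_def)
    also have "\<dots> \<longleftrightarrow> (\<forall>i<N. a i \<noteq> 0 \<longrightarrow> comb_degree a i \<le> int N * M)"
      using j max by (meson order_trans)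
    also have "\<dots> \<longleftrightarrow> (\<forall>i<N. a i \<in> polys_below (nat (M + 1 - gap i)))"
    proof (intro iff_allI imp_cong refl)
      fix i
      show "(a i \<noteq> 0 \<longrightarrow> comb_degree a i \<le> int N * M) \<longleftrightarrow> a i \<in> polys_below (nat (M + 1 - gap i))"
        using below[of a i] by (cases "a i = 0") (auto simp: polys_below_def)
    qed
    finally show ?thesis .
  qed
  have L: "z \<in> L (Ainf M) \<longleftrightarrow> z \<in> R \<and> vge Vinf (- (int N * M)) z" for z
  proof
    assume z: "z \<in> L (Ainf M)"
    then have zF: "z \<in> F" and v: "\<And>V. place V \<Longrightarrow> vge V (- Ainf M V) z" unfolding L_iff by auto
    have "z \<in> V" if V: "place V" "P \<in> V" for V
    proof -
      have "V \<noteq> Vinf" using V Vinf by blast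
      then show ?thesis using v[OF V(1)] vge_0_iff[OF V(1) zF] by (simp add: Ainf_def)
    qed
    then show "z \<in> R \<and> vge Vinf (- (int N * M)) z"
      using v[OF Vinf(1)] zF by (simp add: R_def Ainf_def)
  next
    assume z: "z \<in> R \<and> vge Vinf (- (int N * M)) z"
    have "vge V (- Ainf M V) z" if V: "place V" for V
    proof (cases "V = Vinf")
      case False
      then show ?thesis using vge_R[of z V] z V place_neq_Vinf[OF V] by (simp add: Ainf_def)
    qed (use z in \<open>simp add: Ainf_def\<close>)
    then show "z \<in> L (Ainf M)" unfolding L_iff using z R_in_F by blast
  qed
  show ?thesis
  proof (intro equalityI subsetI)
    fix z assume "z \<in> L (Ainf M)"
    then have z: "z \<in> R" "vge Vinf (- (int N * M)) z" using L by blast+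
    then obtain a where a: "z = comb 1 a" using R_eq by blast
    then show "z \<in> combs_below (\<lambda>i. nat (M + 1 - gap i))"
      using z(2) lead_case[of a] by (auto intro: combs_belowI)
  next
    fix z assume z: "z \<in> combs_below (\<lambda>i. nat (M + 1 - gap i))"
    then obtain a where a: "z = comb 1 a" "a \<in> PiE {..<N} (\<lambda>i. polys_below (nat (M + 1 - gap i)))"
      unfolding combs_below_def by blast
    have "\<forall>i<N. a i \<in> polys_below (nat (M + 1 - gap i))" using a(2) by (auto simp: PiE_def Pi_def)
    then have "vge Vinf (- (int N * M)) z" using lead_case[of a] a(1) by simp
    then show "z \<in> L (Ainf M)" using L z combs_below_R by blast
  qed
qed

lemma L_Ainf_finite: "finite (L (Ainf M))"
  unfolding L_Ainf by (rule combs_below_finite)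

lemma ell_Ainf:
  assumes "\<And>i. i < N \<Longrightarrow> gap i \<le> M + 1"
  shows "int (ell \<iota> F (Ainf M)) = int N * M + 1 - int \<gamma>"
proof -
  have "\<kappa> ^ ell \<iota> F (Ainf M) = \<kappa> ^ (\<Sum>i<N. nat (M + 1 - gap i))"
    using card_L[OF L_Ainf_finite, of M] combs_below_card[of "\<lambda>i. nat (M + 1 - gap i)"]
    unfolding L_Ainf by simp
  then have "ell \<iota> F (Ainf M) = (\<Sum>i<N. nat (M + 1 - gap i))"
    by (rule power_inject_exp[OF \<kappa>_gt_1, THEN iffD1])
  then have "int (ell \<iota> F (Ainf M)) = (\<Sum>i<N. int (nat (M + 1 - gap i)))" by simp
  \<comment> \<open>The assumption on \<open>M\<close> keeps \<open>nat\<close> from cutting off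
    negative values.\<close>
  also have "\<dots> = (\<Sum>i<N. M + 1 - gap i)" by (rule sum.cong) (use assms in auto)
  also have "\<dots> = int N * (M + 1) - (\<Sum>i<N. gap i)" by (simp add: sum_subtractf)
  finally show ?thesis unfolding sum_gap by (simp add: algebra_simps)
qed

lemma val_ev_Vinf: "g \<noteq> 0 \<Longrightarrow> val Vinf (ev g) = - (int N * int (degree g))"
  by (rule val_Vinf[OF lead_ev[OF Vinf]])

text \<open>Every divisor is bounded by one of the form \<open>A'\<close> that differs from a multiple of the infinite place
  by the divisor of a polynomial \<open>g\<close>.\<close>

lemma degree_minus_ell_le:
  assumes A: "A \<in> divisors \<iota> F"
  shows "divisor_degree \<iota> A - int (ell \<iota> F A) + 1 \<le> int \<gamma>"
proof -
  let ?S = "{V. A V \<noteq> 0} - {Vinf}"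
  have finS: "finite ?S" and plS: "\<And>V. V \<in> ?S \<Longrightarrow> finite_place V"
    using A place_neq_Vinf unfolding divisors_def by auto
  have "\<forall>V\<in>?S. \<exists>g. g \<noteq> 0 \<and> ev g \<in> max_ideal V" using max_ideal_poly plS by blast
  then obtain p where p: "\<And>V. V \<in> ?S \<Longrightarrow> p V \<noteq> 0" "\<And>V. V \<in> ?S \<Longrightarrow> ev (p V) \<in> max_ideal V" by metis
  \<comment> \<open>\<open>g\<close> vanishes at each finite place of the support to order at least
    \<open>A V\<close>; a negative \<open>A V\<close> gives exponent 0.\<close>
  define g where "g = (\<Prod>V\<in>?S. p V ^ nat (A V))"
  have g0: "g \<noteq> 0" unfolding g_def using p(1) finS by simp
  have A_le: "A V \<le> val V (ev g)" if V: "finite_place V" for V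
  proof (cases "V \<in> ?S")
    case True
    have "g = p V ^ nat (A V) * (\<Prod>V\<in>?S - {V}. p V ^ nat (A V))"
      unfolding g_def by (rule prod.remove[OF finS True])
    then have eq: "ev g = ev (p V) ^ nat (A V) * ev (\<Prod>V\<in>?S - {V}. p V ^ nat (A V))"
      by (simp only: ev_mult ev_power)
    have pV: "place V" using V by blast
    have "vge V (int (nat (A V)) + 0) (ev g)"
      unfolding eq
    proof (rule vge_mult[OF pV _ ev_in_F _ vge_R[OF ev_in_R V]])
      show "ev (p V) ^ nat (A V) \<in> F" by (intro subring_power F_subring ev_in_F)
      show "vge V (int (nat (A V))) (ev (p V) ^ nat (A V))" by (rule vge_power[OF pV p(2)[OF True]])
    qed
    then show ?thesis using g0 by (simp add: vge_def split: if_splits)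
  next
    case False
    then have "A V = 0" using V Vinf(2) by blast
    then show ?thesis using vge_R[OF ev_in_R V, of g] g0 by (simp add: vge_def)
  qed
  \<comment> \<open>The entry 0 gives M >= 0 and hence M <= N M; the others dominate
    \<open>A\<close> at infinity and make \<open>ell_Ainf\<close> applicable.\<close>
  define M where "M = Max (insert 0 (insert (A Vinf) (gap ` {..<N})))"
  have Mfin: "finite (insert 0 (insert (A Vinf) (gap ` {..<N})))" by simp
  have M: "M \<ge> 0" "A Vinf \<le> M" "\<And>i. i < N \<Longrightarrow> gap i \<le> M"
    unfolding M_def by (rule Max_ge[OF Mfin], simp)+
  have NM: "M \<le> int N * M" using M(1) N_pos mult_right_mono[of 1 "int N" M] by simp
  define A' where "A' V = (if V = Vinf then int N * M else if V \<in> zero_places g then val V (ev g) else 0)" for V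
  have supp: "{V. A' V \<noteq> 0} \<subseteq> insert Vinf (zero_places g)" by (auto simp: A'_def split: if_splits)
  have nVinf: "Vinf \<notin> zero_places g" using Vinf by (simp add: zero_places_def)
  have A'div: "A' \<in> divisors \<iota> F"
    unfolding divisors_def using finite_subset[OF supp] zero_places_finite[OF g0] supp Vinf(1)
    by (auto simp: zero_places_def)
  have le: "A V \<le> A' V" for V
  proof (cases "place V")
    case True
    show ?thesis
    proof (cases "V = Vinf")
      case True
      then show ?thesis using M NM by (simp add: A'_def)
    next
      case False
      then have V: "finite_place V" using place_neq_Vinf True by blast
      then show ?thesis using A_le[OF V] val_not_zero_places[OF V, of g] False
        by (cases "V \<in> zero_places g") (simp_all add: A'_def)
    qed
  next
    case False
    then have "A V = 0" "A' V = 0" using A A'div unfolding divisors_def by auto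
    then show ?thesis by simp
  qed
  \<comment> \<open>Multiplication by \<open>ev g\<close> moves the zero divisor of \<open>g\<close>
    to infinity, where \<open>ev g\<close> has a pole of order N deg g.\<close>
  have L_eq: "z \<in> L A' \<longleftrightarrow> ev g * z \<in> L (Ainf (M + int (degree g)))" for z
  proof -
    have "z \<in> F \<longleftrightarrow> ev g * z \<in> F"
    proof
      assume "ev g * z \<in> F"
      then have "ev g * z / ev g \<in> F" by (rule subfield_divide[OF subfield _ ev_in_F])
      then show "z \<in> F" using g0 by simp
    qed (rule subring_mult[OF F_subring ev_in_F])
    moreover have "vge V (- A' V) z \<longleftrightarrow> vge V (- Ainf (M + int (degree g)) V) (ev g * z)"
      if V: "place V" and zF: "z \<in> F" for V
    proof (cases "z = 0")
      case False
      have "val V (ev g * z) = val V (ev g) + val V z"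
        using val_mult[OF V ev_in_F _ zF False] g0 by simp
      moreover have "- A' V = - Ainf (M + int (degree g)) V - val V (ev g)"
        using val_ev_Vinf[OF g0] val_not_zero_places[of V g] place_neq_Vinf[OF V] V nVinf
        by (auto simp: A'_def Ainf_def algebra_simps)
      ultimately show ?thesis using False g0 by (auto simp: vge_def)
    qed (simp add: vge_0)
    ultimately show ?thesis unfolding L_iff by blast
  qed
  have img: "L A' = (\<lambda>z. z / ev g) ` L (Ainf (M + int (degree g)))"
  proof (intro equalityI subsetI)
    fix z assume "z \<in> L A'"
    then show "z \<in> (\<lambda>z. z / ev g) ` L (Ainf (M + int (degree g)))"
      using L_eq g0 by (intro image_eqI[of _ _ "ev g * z"]) simp_all
  next
    fix z assume "z \<in> (\<lambda>z. z / ev g) ` L (Ainf (M + int (degree g)))"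
    then obtain v where v: "v \<in> L (Ainf (M + int (degree g)))" "z = v / ev g" by blast
    then have "ev g * z = v" using g0 by simp
    then show "z \<in> L A'" using L_eq[of z] v(1) by (simp only:)
  qed
  have finL: "finite (L A')" unfolding img by (intro finite_imageI L_Ainf_finite)
  have "inj_on (\<lambda>z. z / ev g) (L (Ainf (M + int (degree g))))" using g0 by (auto simp: inj_on_def)
  then have "card (L A') = card (L (Ainf (M + int (degree g))))" unfolding img by (rule card_image)
  then have "\<kappa> ^ ell \<iota> F A' = \<kappa> ^ ell \<iota> F (Ainf (M + int (degree g)))"
    unfolding card_L[OF finL] card_L[OF L_Ainf_finite] .
  then have "ell \<iota> F A' = ell \<iota> F (Ainf (M + int (degree g)))"
    by (rule power_inject_exp[OF \<kappa>_gt_1, THEN iffD1])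
  moreover have "int (ell \<iota> F (Ainf (M + int (degree g)))) = int N * (M + int (degree g)) + 1 - int \<gamma>"
  proof (rule ell_Ainf)
    fix i assume "i < N"
    then show "gap i \<le> M + int (degree g) + 1" using M(3)[of i] by simp
  qed
  moreover have "divisor_degree \<iota> A' \<le> int N * (M + int (degree g))"
  proof -
    have "divisor_degree \<iota> A' = (\<Sum>V\<in>insert Vinf (zero_places g). A' V * int (residue_degree \<iota> V))"
      using zero_places_finite[OF g0] supp by (intro divisor_degree_superset) auto
    also have "\<dots> = int N * M + (\<Sum>V\<in>zero_places g. A' V * int (residue_degree \<iota> V))"
      using zero_places_finite[OF g0] nVinf by (simp add: A'_def residue_degree_Vinf)
    also have "(\<Sum>V\<in>zero_places g. A' V * int (residue_degree \<iota> V)) =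
      (\<Sum>V\<in>zero_places g. val V (ev g) * int (residue_degree \<iota> V))"
      using nVinf by (intro sum.cong) (auto simp: A'_def)
    finally show ?thesis using degree_zero_divisor_le[OF g0] by (simp add: algebra_simps)
  qed
  ultimately show ?thesis using degree_minus_ell_mono[OF A A'div le finL] by linarith
qed

text \<open>The bound is attained at every multiple of the pole divisor of \<open>P\<close> that is
  large enough for \<open>ell_Ainf\<close>.\<close>

theorem genus_eq: "genus \<iota> F = int \<gamma>"
  unfolding genus_def
proof (rule Greatest_equality)
  define M where "M = Max (insert 0 (gap ` {..<N}))"
  have M: "gap i \<le> M + 1" if "i < N" for i
  proof -
    have "gap i \<le> M" unfolding M_def using that by (intro Max_ge) auto
    then show ?thesis by simp
  qed
  show "\<exists>A\<in>divisors \<iota> F. int \<gamma> = divisor_degree \<iota> A - int (ell \<iota> F A) + 1"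
    by (rule bexI[OF _ Ainf_divisor[of M]]) (simp add: Ainf_degree ell_Ainf[OF M])
next
  fix y assume "\<exists>A\<in>divisors \<iota> F. y = divisor_degree \<iota> A - int (ell \<iota> F A) + 1"
  then show "y \<le> int \<gamma>" using degree_minus_ell_le by auto
qed

end

section \<open>Dickson polynomials and fixed fields\<close>

lemma two_eq_0_of_card:
  assumes "card (UNIV :: 'k::{field,finite} set) = 2 ^ s"
  shows "(2 :: 'k) = 0"
  using of_nat_card_field[where 'k = 'k] assms by simp

text \<open>Both sides come from monic polynomials of degree \<open>n\<close> with the same
  \<open>n\<close> roots; a nonzero difference would have too many roots for its degree.\<close>

lemma prod_roots_of_unity:
  fixes \<iota> :: "'k::{field,finite} \<Rightarrow> 'h::field"
  assumes "field_hom \<iota>" and n: "n > 0" "n dvd card (UNIV :: 'k set) - 1"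
  shows "(\<Prod>\<zeta>\<in>{\<zeta>. \<zeta> ^ n = 1}. Y - \<iota> \<zeta>) = Y ^ n - 1"
proof -
  interpret field_embedding \<iota> by unfold_locales fact
  let ?\<mu> = "{\<zeta> :: 'k. \<zeta> ^ n = 1}"
  let ?p = "\<Prod>\<zeta>\<in>?\<mu>. [:- \<iota> \<zeta>, 1:]" and ?m = "monom 1 n - 1 :: 'h poly"
  have card: "card ?\<mu> = n" by (rule card_roots_of_unity[OF n])
  have lp: "lead_coeff ?p = 1" unfolding lead_coeff_prod by simp
  have dp: "degree ?p = n" using card by (simp add: degree_prod_eq_sum_degree)
  have "degree ?m \<le> n" by (rule degree_diff_le) (auto simp: degree_monom_le)
  have "?p = ?m"
  proof (rule ccontr)
    assume "?p \<noteq> ?m"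
    then have ne: "?p - ?m \<noteq> 0" by simp
    have "degree (?p - ?m) \<le> n" by (rule degree_diff_le[OF eq_refl[OF dp] \<open>degree ?m \<le> n\<close>])
    moreover have "coeff (?p - ?m) n = 0" using lp dp n(1) by (simp add: coeff_1)
    ultimately have "degree (?p - ?m) < n" using ne
      by (metis leading_coeff_0_iff order_le_imp_less_or_eq)
    moreover have "\<iota> ` ?\<mu> \<subseteq> {z. poly (?p - ?m) z = 0}"
      by (auto simp: poly_prod poly_monom simp flip: \<iota>_power)
    then have "card (\<iota> ` ?\<mu>) \<le> card {z. poly (?p - ?m) z = 0}"
      by (rule card_mono[rotated]) (rule poly_roots_finite[OF ne])
    then have "n \<le> degree (?p - ?m)"
      using card_poly_roots_bound[OF ne] card card_image[of \<iota> ?\<mu>] by (simp add: inj_on_def)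
    ultimately show False by simp
  qed
  then have "poly ?p Y = poly ?m Y" by simp
  then show ?thesis by (simp add: poly_prod poly_monom)
qed

text \<open>In characteristic 2 this is the factorization of the Dickson polynomial of odd degree \<open>n\<close>
  as \<open>X\<close> times a square, the roots of the square being the sums \<open>\<zeta> + 1/\<zeta>\<close>.\<close>

context
  fixes n :: nat and Z :: "'k::{field,finite} set"
  assumes n: "n > 0" "n dvd card (UNIV :: 'k set) - 1" and two: "(2 :: 'k) = 0"
  defines "Z \<equiv> (\<lambda>\<zeta>. \<zeta> + inverse \<zeta>) ` ({\<zeta>. \<zeta> ^ n = 1} - {1})"
begin

private abbreviation "S \<equiv> {\<zeta> :: 'k. \<zeta> ^ n = 1} - {1}"

lemma S_neq_0: "\<zeta> \<in> S \<Longrightarrow> \<zeta> \<noteq> 0"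
  using n(1) by (auto simp: zero_power)

lemma S_inverse: "\<zeta> \<in> S \<Longrightarrow> inverse \<zeta> \<in> S"
  by (auto simp: power_inverse)

text \<open>In characteristic 2, \<zeta>^2 = 1 means (\<zeta> - 1)^2 = 0.\<close>

lemma S_inverse_neq: "\<zeta> \<in> S \<Longrightarrow> inverse \<zeta> \<noteq> \<zeta>"
proof
  assume \<zeta>: "\<zeta> \<in> S" and "inverse \<zeta> = \<zeta>"
  then have "\<zeta> * \<zeta> = 1" using S_neq_0[OF \<zeta>] by (metis right_inverse)
  then have "(\<zeta> - 1) * (\<zeta> - 1) = 2 * (1 - \<zeta>)" by (simp add: algebra_simps)
  then have "\<zeta> = 1" using two by simp
  then show False using \<zeta> by simp
qed

lemma fiber_eq:
  assumes "\<zeta> \<in> S"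
  shows "{\<xi>\<in>S. \<xi> + inverse \<xi> = \<zeta> + inverse \<zeta>} = {\<zeta>, inverse \<zeta>}"
proof -
  have "\<xi> = \<zeta> \<or> \<xi> = inverse \<zeta>" if "\<xi> \<in> S" "\<xi> + inverse \<xi> = \<zeta> + inverse \<zeta>" for \<xi>
  proof -
    have nz: "\<xi> \<noteq> 0" "\<zeta> \<noteq> 0" using S_neq_0 that(1) assms by blast+
    have "(\<xi> - \<zeta>) * (\<xi> - inverse \<zeta>) = \<xi> * ((\<xi> + inverse \<xi>) - (\<zeta> + inverse \<zeta>))"
      using nz by (simp add: algebra_simps)
    then show ?thesis using that(2) by simp
  qed
  then show ?thesis using S_inverse[OF assms] assms by (auto simp: add.commute)
qed

lemma zero_notin_Z: "0 \<notin> Z"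
proof
  assume "0 \<in> Z"
  then obtain \<zeta> where \<zeta>: "0 = \<zeta> + inverse \<zeta>" "\<zeta> \<in> S" unfolding Z_def by (elim imageE)
  have "inverse \<zeta> = \<zeta> + inverse \<zeta> + \<zeta> - 2 * \<zeta>" by simp
  then have "inverse \<zeta> = \<zeta>" using \<zeta>(1)[symmetric] two by simp
  then show False using S_inverse_neq[OF \<zeta>(2)] by simp
qed

lemma fiber_card: "a \<in> Z \<Longrightarrow> card {\<xi>\<in>S. \<xi> + inverse \<xi> = a} = 2"
proof -
  assume "a \<in> Z"
  then obtain \<zeta> where \<zeta>: "\<zeta> \<in> S" "a = \<zeta> + inverse \<zeta>" unfolding Z_def by auto
  show ?thesis unfolding \<zeta>(2) fiber_eq[OF \<zeta>(1)] using S_inverse_neq[OF \<zeta>(1)] by simp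
qed

lemma card_S: "card S = n - 1"
proof -
  have "card S = card {\<zeta> :: 'k. \<zeta> ^ n = 1} - 1" by (rule card_Diff_singleton) simp
  then show ?thesis unfolding card_roots_of_unity[OF n] .
qed

lemma card_Z: "n = 2 * card Z + 1"
proof -
  have "(\<Sum>\<zeta>\<in>S. 1) = (\<Sum>a\<in>Z. \<Sum>\<zeta>\<in>{\<xi>\<in>S. \<xi> + inverse \<xi> = a}. 1 :: nat)"
    unfolding Z_def by (rule sum.image_gen) simp
  also have "\<dots> = (\<Sum>a\<in>Z. 2)" by (rule sum.cong) (simp_all only: card_eq_sum[symmetric] fiber_card)
  finally have "card S = 2 * card Z" by simp
  then show ?thesis unfolding card_S using n(1) by simp
qed

lemma dickson_factorization:
  fixes \<iota> :: "'k \<Rightarrow> 'h::field"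
  assumes hom: "field_hom \<iota>" and Y: "Y \<noteq> 0"
  shows "Y ^ n + inverse Y ^ n = (Y + inverse Y) * (\<Prod>a\<in>Z. Y + inverse Y - \<iota> a) ^ 2"
proof -
  interpret field_embedding \<iota> by unfold_locales fact
  have two': "(2 :: 'h) = 0" using \<iota>_of_nat[of 2] two by simp
  let ?P = "Y + inverse Y"
  let ?A = "\<Prod>\<zeta>\<in>S. Y - \<iota> \<zeta>"
  \<comment> \<open>Each fiber of the map from \<zeta> to \<zeta> + 1/\<zeta> has two elements,
    which produces the square.\<close>
  have "(\<Prod>\<zeta>\<in>S. ?P - \<iota> (\<zeta> + inverse \<zeta>)) = (\<Prod>a\<in>Z. \<Prod>\<zeta>\<in>{\<xi>\<in>S. \<xi> + inverse \<xi> = a}. ?P - \<iota> (\<zeta> + inverse \<zeta>))"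
    unfolding Z_def by (rule prod.image_gen) simp
  also have "\<dots> = (\<Prod>a\<in>Z. \<Prod>\<zeta>\<in>{\<xi>\<in>S. \<xi> + inverse \<xi> = a}. ?P - \<iota> a)"
    by (intro prod.cong refl) simp
  also have "\<dots> = (\<Prod>a\<in>Z. (?P - \<iota> a) ^ 2)"
    by (intro prod.cong refl) (simp only: prod_constant fiber_card)
  also have "\<dots> = (\<Prod>a\<in>Z. ?P - \<iota> a) ^ 2" by (rule prod_power_distrib[symmetric])
  finally have 1: "(\<Prod>a\<in>Z. ?P - \<iota> a) ^ 2 = (\<Prod>\<zeta>\<in>S. ?P - \<iota> (\<zeta> + inverse \<zeta>))" by simp
  have "(\<Prod>\<zeta>\<in>S. Y * (?P - \<iota> (\<zeta> + inverse \<zeta>))) = (\<Prod>\<zeta>\<in>S. (Y - \<iota> \<zeta>) * (Y - \<iota> (inverse \<zeta>)))"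
  proof (rule prod.cong)
    fix \<zeta> assume "\<zeta> \<in> S"
    then have "\<zeta> \<noteq> 0" by (rule S_neq_0)
    then have "\<iota> \<zeta> * \<iota> (inverse \<zeta>) = 1" by (simp flip: \<iota>_mult)
    then show "Y * (?P - \<iota> (\<zeta> + inverse \<zeta>)) = (Y - \<iota> \<zeta>) * (Y - \<iota> (inverse \<zeta>))"
      using Y by (simp add: \<iota>_add algebra_simps)
  qed simp
  also have "\<dots> = ?A * (\<Prod>\<zeta>\<in>S. Y - \<iota> (inverse \<zeta>))" by (rule prod.distrib)
  also have "(\<Prod>\<zeta>\<in>S. Y - \<iota> (inverse \<zeta>)) = ?A"
    by (rule prod.reindex_bij_witness[of _ inverse inverse]) (use S_inverse in auto)
  finally have 2: "Y ^ (n - 1) * (\<Prod>\<zeta>\<in>S. ?P - \<iota> (\<zeta> + inverse \<zeta>)) = ?A * ?A"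
    unfolding prod.distrib prod_constant card_S .
  have "(\<Prod>\<zeta>\<in>{\<zeta>. \<zeta> ^ n = 1}. Y - \<iota> \<zeta>) = (Y - \<iota> 1) * ?A" by (rule prod.remove) simp_all
  then have 3: "(Y - 1) * ?A = Y ^ n - 1" using prod_roots_of_unity[OF hom n, of Y] by simp
  \<comment> \<open>Completing the square in characteristic 2; after multiplication by Y^n both
    sides of the claim become (Y^n - 1)^2.\<close>
  have "Y * ?P = (Y - 1) * (Y - 1) + 2 * Y" using Y by (simp add: algebra_simps)
  then have 4: "Y * ?P = (Y - 1) * (Y - 1)" using two' by simp
  have Yn: "Y ^ n = Y * Y ^ (n - 1)" using n(1) by (cases n) auto
  have "Y ^ n * (?P * (\<Prod>a\<in>Z. ?P - \<iota> a) ^ 2) = (Y * ?P) * (Y ^ (n - 1) * (\<Prod>\<zeta>\<in>S. ?P - \<iota> (\<zeta> + inverse \<zeta>)))"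
    unfolding 1 Yn by (simp only: mult_ac)
  also have "\<dots> = ((Y - 1) * ?A) * ((Y - 1) * ?A)" unfolding 2 4 by (simp only: mult_ac)
  also have "\<dots> = (Y ^ n - 1) * (Y ^ n - 1)" unfolding 3 ..
  also have "\<dots> = Y ^ n * (Y ^ n + inverse Y ^ n) - 2 * Y ^ n"
    using Y by (simp add: algebra_simps power_inverse)
  finally have "Y ^ n * (?P * (\<Prod>a\<in>Z. ?P - \<iota> a) ^ 2) = Y ^ n * (Y ^ n + inverse Y ^ n)"
    using two' by simp
  moreover have "Y ^ n \<noteq> 0" using Y by simp
  ultimately show ?thesis using mult_left_cancel by metis
qed

end

lemma gcd_mult_coprime_eq:
  fixes m :: nat
  assumes "coprime a b" "m dvd a * b"
  shows "gcd m a * gcd m b = m"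
proof (rule dvd_antisym)
  have "coprime (gcd m a) (gcd m b)" using assms(1) by (meson coprime_divisors gcd_dvd2)
  then show "gcd m a * gcd m b dvd m" by (intro divides_mult) auto
  obtain a' b' where "m = a' * b'" "a' dvd a" "b' dvd b" using division_decomp[OF assms(2)] by blast
  then show "m dvd gcd m a * gcd m b" by (simp add: mult_dvd_mono)
qed

section \<open>Automorphisms and their fixed fields\<close>

context field_embedding
begin

lemma aut_group_group: "group (aut_group \<iota>)"
proof (rule groupI)
  let ?C = "carrier (aut_group \<iota>)"
  show "\<one>\<^bsub>aut_group \<iota>\<^esub> \<in> ?C" by (simp add: aut_group_def field_hom_def)
  fix f assume f: "f \<in> ?C"
  then have bij: "bij f" and hf: "field_hom f" and fc: "\<And>c. f (\<iota> c) = \<iota> c" by (auto simp: aut_group_def)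
  note surj = bij_is_surj[OF bij] and inj = bij_is_inj[OF bij]
  have "field_hom (inv_into UNIV f)"
    unfolding field_hom_def
  proof (intro conjI allI)
    show "inv_into UNIV f 1 = 1" using hf inv_f_f[OF inj, of 1] by (simp add: field_hom_def)
    fix a b
    have "f (inv_into UNIV f a + inv_into UNIV f b) = a + b" "f (inv_into UNIV f a * inv_into UNIV f b) = a * b"
      using hf surj by (simp_all add: field_hom_def surj_f_inv_f)
    then show "inv_into UNIV f (a + b) = inv_into UNIV f a + inv_into UNIV f b" "inv_into UNIV f (a * b) = inv_into UNIV f a * inv_into UNIV f b"
      using inv_f_f[OF inj] by metis+
  qed
  moreover have "inv_into UNIV f (\<iota> c) = \<iota> c" for c using inv_f_f[OF inj, of "\<iota> c"] fc by simp
  ultimately have "inv_into UNIV f \<in> ?C" using bij_imp_bij_inv[OF bij] by (simp add: aut_group_def)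
  moreover have "inv_into UNIV f \<otimes>\<^bsub>aut_group \<iota>\<^esub> f = \<one>\<^bsub>aut_group \<iota>\<^esub>" using inj by (simp add: aut_group_def)
  ultimately show "\<exists>g\<in>?C. g \<otimes>\<^bsub>aut_group \<iota>\<^esub> f = \<one>\<^bsub>aut_group \<iota>\<^esub>" by blast
qed (auto simp: aut_group_def field_hom_def intro: bij_comp)

lemma generate_fixes:
  assumes A: "A \<subseteq> carrier (aut_group \<iota>)" and fx: "\<And>h. h \<in> A \<Longrightarrow> h z = z"
    and \<sigma>: "\<sigma> \<in> generate (aut_group \<iota>) A"
  shows "\<sigma> z = z"
  using \<sigma>
proof (induction rule: generate.induct)
  case one
  then show ?case by (simp add: aut_group_def)
next
  case (incl h)
  then show ?case by (rule fx)
next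
  case (inv h)
  have "inv\<^bsub>aut_group \<iota>\<^esub> h \<otimes>\<^bsub>aut_group \<iota>\<^esub> h = \<one>\<^bsub>aut_group \<iota>\<^esub>"
    using inv A by (intro group.l_inv aut_group_group) auto
  then have "(inv\<^bsub>aut_group \<iota>\<^esub> h) (h z) = z" by (simp add: aut_group_def fun_eq_iff)
  then show ?case using fx[OF inv] by simp
next
  case (eng h1 h2)
  then show ?case by (simp add: aut_group_def)
qed

end

lemma hom_fixed_subfield:
  assumes "field_hom \<sigma>"
  shows "is_subfield {z. \<sigma> z = z}"
proof -
  interpret field_embedding \<sigma> by unfold_locales fact
  show ?thesis unfolding is_subfield_def by (auto simp: \<iota>_diff \<iota>_mult \<iota>_inverse)
qed

lemma fixed_on_adjoin:
  assumes "field_hom \<sigma>" "\<And>c. \<sigma> (\<iota> c) = \<iota> c" "\<And>s. s \<in> S \<Longrightarrow> \<sigma> s = s" "z \<in> adjoin \<iota> S"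
  shows "\<sigma> z = z"
  using adjoin_least[OF hom_fixed_subfield[OF assms(1)], of \<iota> S] assms(2-4) by auto

section \<open>The quotient of the Hermitian function field\<close>

lemma adj_ring_elem:
  assumes "v \<in> adj_ring A z"
  obtains D f where "\<And>i. f i \<in> A" "v = (\<Sum>i\<le>D. f i * z ^ i)"
proof -
  from assms obtain p where "v = poly p z" "\<forall>i. coeff p i \<in> A" unfolding adj_ring_def by blast
  then show ?thesis using that[of "coeff p" "degree p"] by (simp add: poly_altdef)
qed

locale hermitian_quotient =
  fixes \<iota> :: "'k::{field,finite} \<Rightarrow> 'h::field"
    and x y :: 'h and b :: 'k and q r m d d' :: nat and lam \<omega> :: "'h \<Rightarrow> 'h"
  assumes r: "0 < r" and q: "q = 2 ^ r"
    and herm: "hermitian_function_field q \<iota> x y"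
    and m: "0 < m" "m dvd q^2 - 1"
    and b: "b \<noteq> 0" "m = (LEAST k. 0 < k \<and> b ^ k = 1)"
    and lam: "lam \<in> carrier (aut_group \<iota>)" "lam x = \<iota> b * x" "lam y = \<iota> b ^ (q + 1) * y"
    and \<omega>: "\<omega> \<in> carrier (aut_group \<iota>)" "\<omega> x = x / y" "\<omega> y = 1 / y"
    and d: "d = gcd m (q + 1)" and d': "d' = gcd m (q - 1)"

sublocale hermitian_quotient \<subseteq> field_embedding \<iota>
  by unfold_locales (use herm in \<open>simp add: hermitian_function_field_def\<close>)

context hermitian_quotient
begin

lemma card_k: "card (UNIV :: 'k set) = q ^ 2" and trans_x: "transcendental_over \<iota> x"
  and curve: "y ^ q + y = x ^ (q + 1)" and gen: "adjoin \<iota> {x, y} = UNIV"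
  using herm unfolding hermitian_function_field_def by auto

lemma q_pos: "q \<ge> 2"
  using q r self_le_power[of 2 r] by simp

lemma q_even: "even q"
  using q r by simp

lemma two_k: "(2 :: 'k) = 0"
  using two_eq_0_of_card[where 'k = 'k, of "r * 2"] card_k q by (simp add: power_mult)

lemma two_h: "(2 :: 'h) = 0"
  using \<iota>_of_nat[of 2] two_k by simp

lemma add_self: "a + a = (0 :: 'h)"
  using two_h by (simp flip: mult_2)

lemma q_square: "q ^ 2 - 1 = (q + 1) * (q - 1)"
  using q_pos by (cases q) (simp_all add: power2_eq_square algebra_simps)

lemma coprime_q: "coprime (q + 1) (q - 1)"
proof -
  have "odd (q - 1)" using q_even q_pos by simp
  then have "coprime (2 :: nat) (q - 1)" by simp
  moreover have "q + 1 = 2 + (q - 1)" using q_pos by simp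
  ultimately show ?thesis by (metis coprime_iff_gcd_eq_1 gcd_add1)
qed

lemma m_eq: "m = d * d'"
  unfolding d d' using gcd_mult_coprime_eq[OF coprime_q, of m] m(2) q_square by simp

definition N :: nat where "N = (q + 1) div d"
definition n :: nat where "n = (q - 1) div d'"

lemma dN: "q + 1 = d * N"
  unfolding N_def by (rule dvd_mult_div_cancel[symmetric]) (simp only: d gcd_dvd2)

lemma d'n: "q - 1 = d' * n"
  unfolding n_def by (rule dvd_mult_div_cancel[symmetric]) (simp only: d' gcd_dvd2)

lemma pos: "d > 0" "d' > 0" "N > 0" "n > 0"
proof -
  show "d > 0" "d' > 0" using m_eq m(1) by auto
  have "d * N > 0" unfolding dN[symmetric] by simp
  moreover have "d' * n > 0" unfolding d'n[symmetric] using q_pos by simp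
  ultimately show "N > 0" "n > 0" by auto
qed

lemma n_dvd: "n dvd card (UNIV :: 'k set) - 1" and N_dvd: "N dvd card (UNIV :: 'k set) - 1"
  unfolding card_k q_square dN d'n by simp_all

lemma b_power: "b ^ m = 1" and b_power_neq: "\<And>k. 0 < k \<Longrightarrow> k < m \<Longrightarrow> b ^ k \<noteq> 1"
proof -
  \<comment> \<open>\<open>LEAST\<close> says something about \<open>b\<close> only if some positive
    exponent gives 1; the order of the multiplicative group is one.\<close>
  have "b ^ (card (UNIV :: 'k set) - 1) = 1" by (rule finite_field_power[OF b(1)])
  moreover have "card (UNIV :: 'k set) - 1 > 0"
  proof -
    have "2 ^ 2 \<le> q ^ 2" by (rule power_mono[OF q_pos]) simp
    then show ?thesis unfolding card_k by simp
  qed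
  ultimately have "0 < card (UNIV :: 'k set) - 1 \<and> b ^ (card (UNIV :: 'k set) - 1) = 1" by blast
  from LeastI[of "\<lambda>k. 0 < k \<and> b ^ k = 1", OF this] show "b ^ m = 1"
    unfolding b(2)[symmetric] by blast
  fix k assume "0 < k" "k < m"
  then show "b ^ k \<noteq> 1" using not_less_Least[of k "\<lambda>k. 0 < k \<and> b ^ k = 1"] b(2) by auto
qed

lemma b_power_dvd: "m dvd k \<Longrightarrow> b ^ k = 1"
  using b_power by (auto elim!: dvdE simp: power_mult)

lemma b_power_mod: "b ^ k = 1 \<longleftrightarrow> m dvd k"
proof
  assume k: "b ^ k = 1"
  have "b ^ k = b ^ (m * (k div m) + k mod m)" by simp
  also have "\<dots> = b ^ (k mod m)" unfolding power_add power_mult b_power by simp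
  finally have "b ^ (k mod m) = 1" using k by simp
  then have "k mod m = 0" using b_power_neq[of "k mod m"] m(1) by fastforce
  then show "m dvd k" by (simp add: dvd_eq_mod_eq_0)
qed (rule b_power_dvd)

lemma x_neq_0: "x \<noteq> 0"
  using transcendental_extension.P_neq_0[of \<iota> x] trans_x hom
  by (simp add: transcendental_extension_def transcendental_extension_axioms_def field_embedding_def)

lemma y_factor: "y * (y ^ (q - 1) + 1) = x ^ (q + 1)"
proof -
  have "y ^ q = y * y ^ (q - 1)" using q_pos by (cases q) auto
  then show ?thesis unfolding curve[symmetric] by (simp add: distrib_left)
qed

lemma y_neq_0: "y \<noteq> 0" and y_power_neq: "y ^ (q - 1) + 1 \<noteq> 0"
  using y_factor x_neq_0 by auto

text \<open>\<open>\<omega>\<close> fixes x^2/y and inverts \<open>y\<close>, while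
  \<open>lam\<close> scales them by b^(1-q) and b^(q+1). These scalars have orders m/d' = d and m/d
  = d', which are the exponents in \<open>U\<close> and \<open>Y\<close>.\<close>

definition U :: 'h where "U = (x ^ 2 / y) ^ d"
definition Y :: 'h where "Y = y ^ d'"
definition P :: 'h where "P = Y + inverse Y"
definition Z :: "'k set" where "Z = (\<lambda>\<zeta>. \<zeta> + inverse \<zeta>) ` ({\<zeta>. \<zeta> ^ n = 1} - {1})"

lemma Y_neq_0: "Y \<noteq> 0"
  using y_neq_0 by (simp add: Y_def)

lemma Yn: "Y ^ n = y ^ (q - 1)"
  unfolding Y_def d'n power_mult ..

text \<open>At a place where \<open>x\<close> is infinite, the curve equation makes \<open>y\<close>
  infinite, hence \<open>Y\<close>, hence P = Y + 1/Y, as \<open>1/Y\<close> is finite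
  there.\<close>

lemma P_transcendental: "transcendental_over \<iota> P"
proof -
  interpret H: extension_field \<iota> "UNIV :: 'h set"
    by unfold_locales (auto simp: is_subfield_def)
  interpret X: transcendental_extension \<iota> x by unfold_locales (rule trans_x)
  obtain V where V: "H.place V" "x \<notin> V"
    using H.place_exists[OF subring_range _ _ _ X.P_not_integral] by auto
  note S = H.place_subring[OF V(1)]
  have "y \<notin> V"
  proof
    assume "y \<in> V"
    then have "y ^ q + y \<in> V" by (intro subring_add subring_power S)
    then have "x ^ (q + 1) \<in> V" unfolding curve .
    then have "x \<in> V" by (rule H.root_in_place[OF V(1), rotated]) simp_all
    then show False using V(2) by simp
  qed
  then have "Y \<notin> V" unfolding Y_def using H.root_in_place[OF V(1), of y d'] pos(2) by blast
  then have "inverse Y \<in> V" using H.place_cases[OF V(1), of Y] by simp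
  have "P \<notin> V"
  proof
    assume "P \<in> V"
    then have "P - inverse Y \<in> V" using \<open>inverse Y \<in> V\<close> by (rule subring_diff[OF S])
    then show False using \<open>Y \<notin> V\<close> by (simp add: P_def)
  qed
  then show ?thesis using H.transcendental_not_in_place[OF V(1)] by simp
qed

text \<open>With u = y^(q-1) the curve equation gives (x^2/y)^(q+1) = (u + 1)^2 / u, which is u +
  1/u in characteristic 2.\<close>

lemma U_power: "U ^ N = Y ^ n + inverse Y ^ n"
proof -
  let ?u = "y ^ (q - 1)"
  have "U ^ N = (x ^ 2 / y) ^ (q + 1)" by (simp only: U_def dN power_mult)
  also have "\<dots> = (x ^ (q + 1)) ^ 2 / y ^ (q + 1)"
    by (simp only: power_divide power_mult[symmetric] mult.commute)
  also have "\<dots> = (y * (?u + 1)) ^ 2 / (y ^ 2 * ?u)"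
  proof -
    have "q + 1 = 2 + (q - 1)" using q_pos by simp
    then have "y ^ (q + 1) = y ^ 2 * ?u" by (metis power_add)
    then show ?thesis unfolding y_factor by simp
  qed
  also have "\<dots> = (?u + 1) ^ 2 / ?u" using y_neq_0 by (simp add: power_mult_distrib)
  also have "(?u + 1) ^ 2 = ?u ^ 2 + 1"
    using add_self[of ?u] by (simp add: power2_eq_square algebra_simps)
  also have "(?u ^ 2 + 1) / ?u = ?u + inverse ?u"
    using y_neq_0 by (simp add: field_simps power2_eq_square)
  finally show ?thesis unfolding power_inverse Yn .
qed

lemma kummer: "kummer_curve \<iota> P U Z N"
proof unfold_locales
  note Zf = zero_notin_Z[OF pos(4) n_dvd two_k, folded Z_def]
    dickson_factorization[OF pos(4) n_dvd two_k hom Y_neq_0, folded Z_def P_def]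
    card_Z[OF pos(4) n_dvd two_k, folded Z_def]
  show "transcendental_over \<iota> P" by (rule P_transcendental)
  show "U ^ N = P * (\<Prod>a\<in>Z. P - \<iota> a)\<^sup>2" unfolding U_power by (rule Zf(2))
  show "0 \<notin> Z" by (rule Zf(1))
  have "odd (d * N)" using dN q_even by (metis even_plus_one_iff)
  then show "odd N" by simp
  have "coprime (d * N) (d' * n)" using coprime_q unfolding dN d'n .
  then have "coprime N n" by simp
  then show "coprime N (2 * card Z + 1)" using Zf(3) by simp
  show "N dvd card (UNIV :: 'k set) - 1" by (rule N_dvd)
qed

lemma n_eq: "n = 2 * card Z + 1"
  by (rule card_Z[OF pos(4) n_dvd two_k, folded Z_def])

lemma lam_hom: "field_hom lam" and lam_const: "lam (\<iota> c) = \<iota> c"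
  and \<omega>_hom: "field_hom \<omega>" and \<omega>_const: "\<omega> (\<iota> c) = \<iota> c"
  using lam(1) \<omega>(1) unfolding aut_group_def by auto

lemma divide_hom: "field_hom f \<Longrightarrow> f (u / v) = f u / f v"
proof -
  assume "field_hom f"
  then interpret f: field_embedding f by unfold_locales
  show ?thesis by (simp add: divide_inverse f.\<iota>_mult f.\<iota>_inverse)
qed

lemma power_hom: "field_hom f \<Longrightarrow> f (u ^ k) = f u ^ k"
proof -
  assume "field_hom f"
  then interpret f: field_embedding f by unfold_locales
  show ?thesis by (rule f.\<iota>_power)
qed

lemma lam_U: "lam U = U"
proof -
  have "m dvd (q - 1) * d" unfolding m_eq d'n by simp
  then have "b ^ ((q - 1) * d) = 1" by (rule b_power_dvd)
  then have 1: "\<iota> b ^ ((q - 1) * d) = 1" by (simp flip: \<iota>_power)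
  have "lam (x ^ 2 / y) = (\<iota> b ^ 2 / \<iota> b ^ (q + 1)) * (x ^ 2 / y)"
    unfolding divide_hom[OF lam_hom] power_hom[OF lam_hom] lam(2,3) by (simp add: power_mult_distrib)
  also have "\<iota> b ^ (q + 1) = \<iota> b ^ 2 * \<iota> b ^ (q - 1)"
    using q_pos by (simp flip: power_add)
  also have "\<iota> b ^ 2 / (\<iota> b ^ 2 * \<iota> b ^ (q - 1)) = inverse (\<iota> b ^ (q - 1))"
    using b(1) by (simp add: field_simps)
  finally have "lam U = (inverse (\<iota> b ^ (q - 1)) * (x ^ 2 / y)) ^ d"
    unfolding U_def power_hom[OF lam_hom] by simp
  also have "\<dots> = inverse (\<iota> b ^ ((q - 1) * d)) * U"
    unfolding power_mult_distrib U_def by (simp add: power_inverse power_mult)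
  finally show ?thesis unfolding 1 by simp
qed

lemma lam_Y: "lam Y = Y"
proof -
  have "m dvd (q + 1) * d'" unfolding m_eq dN by simp
  then have "b ^ ((q + 1) * d') = 1" by (rule b_power_dvd)
  then have 1: "\<iota> b ^ ((q + 1) * d') = 1" by (simp only: \<iota>_power[symmetric] \<iota>_1)
  have "lam Y = \<iota> b ^ ((q + 1) * d') * Y"
    unfolding Y_def power_hom[OF lam_hom] lam(3) power_mult_distrib power_mult ..
  then show ?thesis unfolding 1 by simp
qed

lemma \<omega>_U: "\<omega> U = U"
proof -
  have "\<omega> (x ^ 2 / y) = x ^ 2 / y"
    unfolding divide_hom[OF \<omega>_hom] power_hom[OF \<omega>_hom] \<omega>(2,3)
    using y_neq_0 by (simp add: power_divide power2_eq_square field_simps)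
  then show ?thesis unfolding U_def power_hom[OF \<omega>_hom] by simp
qed

lemma \<omega>_Y: "\<omega> Y = inverse Y"
  unfolding Y_def power_hom[OF \<omega>_hom] \<omega>(3) by (simp add: divide_inverse power_inverse)

section \<open>The fixed field of \<open>lam\<close>\<close>

abbreviation F\<^sub>0 :: "'h set" where "F\<^sub>0 \<equiv> adjoin \<iota> {P, U}"
abbreviation F\<^sub>1 :: "'h set" where "F\<^sub>1 \<equiv> adjoin \<iota> {U, Y}"

lemma U_F1: "U \<in> F\<^sub>1" and Y_F1: "Y \<in> F\<^sub>1" and P_F0: "P \<in> F\<^sub>0" and U_F0: "U \<in> F\<^sub>0"
  using adjoin_gen by blast+

lemmas F1_field = adjoin_subfield[of \<iota> "{U, Y}"]
lemmas F1_ring = subfield_subring[OF F1_field]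
lemmas F0_field = adjoin_subfield[of \<iota> "{P, U}"]
lemmas F0_ring = subfield_subring[OF F0_field]

lemma const_F1: "\<iota> c \<in> F\<^sub>1"
  using adjoin_const by blast

lemma lam_F1: "z \<in> F\<^sub>1 \<Longrightarrow> lam z = z"
  by (rule fixed_on_adjoin[OF lam_hom lam_const]) (use lam_U lam_Y in auto)

lemma \<omega>_F0: "z \<in> F\<^sub>0 \<Longrightarrow> \<omega> z = z"
proof (rule fixed_on_adjoin[OF \<omega>_hom \<omega>_const])
  interpret w: field_embedding \<omega> by unfold_locales (rule \<omega>_hom)
  fix s assume "s \<in> {P, U}"
  then show "\<omega> s = s" using \<omega>_U \<omega>_Y by (auto simp: P_def w.\<iota>_add w.\<iota>_inverse add.commute)
qed

lemma F0_sub_F1: "F\<^sub>0 \<subseteq> F\<^sub>1"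
  using adjoin_const U_F1 Y_F1 unfolding P_def
  by (intro adjoin_least F1_field) (auto intro!: subring_add F1_ring subfield_inverse F1_field)

text \<open>The square of x^m is U^d' Y^d, and the power x^(q^2-1) lies in K(Y). As (q^2-1)/m is
  odd, x^m is the quotient of the latter by a power of the former.\<close>

lemma x_power_m: "x ^ m \<in> F\<^sub>1"
proof -
  have "(x ^ m) ^ 2 = (x ^ 2 / y) ^ m * y ^ m"
    using y_neq_0 by (simp add: power_divide mult.commute flip: power_mult)
  also have "\<dots> = U ^ d' * Y ^ d"
    unfolding U_def Y_def m_eq by (simp add: mult.commute flip: power_mult)
  also have "\<dots> \<in> F\<^sub>1" by (intro subring_mult subring_power F1_ring U_F1 Y_F1)
  finally have even_part: "(x ^ m) ^ 2 \<in> F\<^sub>1" .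
  have "x ^ (q ^ 2 - 1) = (y * (y ^ (q - 1) + 1)) ^ (q - 1)"
    unfolding y_factor q_square power_mult ..
  also have "\<dots> = Y ^ n * (Y ^ n + 1) ^ (q - 1)"
    unfolding Yn power_mult_distrib by (simp add: mult.commute)
  also have "\<dots> \<in> F\<^sub>1"
    by (intro subring_mult subring_power subring_add subring_1 F1_ring Y_F1)
  finally have full: "x ^ (q ^ 2 - 1) \<in> F\<^sub>1" .
  obtain h where h: "q ^ 2 - 1 = m * h" using m(2) by (elim dvdE)
  have "odd (q ^ 2 - 1)" unfolding q_square using q_even q_pos by simp
  then have "odd h" unfolding h by simp
  then obtain e where e: "h = 2 * e + 1" by (elim oddE)
  have "x ^ (q ^ 2 - 1) = ((x ^ m) ^ 2) ^ e * x ^ m"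
    unfolding h e by (simp add: algebra_simps power_add flip: power_mult)
  then have "x ^ m = x ^ (q ^ 2 - 1) / ((x ^ m) ^ 2) ^ e" using x_neq_0 by simp
  also have "\<dots> \<in> F\<^sub>1"
    by (rule subfield_divide[OF F1_field full subring_power[OF F1_ring even_part]])
  finally show ?thesis .
qed

abbreviation S :: "'h set" where "S \<equiv> adj_ring F\<^sub>1 x"

lemmas S_ring = adj_ring_subring[OF F1_ring, of x]

lemma F1_sub_S: "F\<^sub>1 \<subseteq> S"
  by (rule adj_ring_superset[OF F1_ring])

text \<open>y = x^(q+1) / (Y^n + 1). So the whole field consists of fractions over \<open>S\<close>,
  on which \<open>lam\<close> acts monomial by monomial.\<close>

lemma y_in_S: "y \<in> S"
proof -
  have 1: "inverse (Y ^ n + 1) \<in> F\<^sub>1"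
    by (intro subfield_inverse F1_field subring_add subring_power subring_1 F1_ring Y_F1)
  have 2: "x ^ (q + 1) * inverse (Y ^ n + 1) = y"
    unfolding Yn y_factor[symmetric] using y_power_neq by simp
  have "x ^ (q + 1) \<in> S" by (rule subring_power[OF S_ring adj_ring_mem[OF F1_ring]])
  from subring_mult[OF S_ring this subsetD[OF F1_sub_S 1]] show ?thesis unfolding 2 .
qed

interpretation lam: field_embedding lam
  by unfold_locales (rule lam_hom)

lemma lam_iter_S:
  assumes "\<And>i. f i \<in> F\<^sub>1"
  shows "(lam ^^ j) (\<Sum>i\<le>D. f i * x ^ i) = (\<Sum>i\<le>D. (f i * \<iota> (b ^ (i * j))) * x ^ i)"
proof (induction j)
  case (Suc j)
  have "(lam ^^ Suc j) (\<Sum>i\<le>D. f i * x ^ i) = lam (\<Sum>i\<le>D. (f i * \<iota> (b ^ (i * j))) * x ^ i)"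
    using Suc by simp
  also have "\<dots> = (\<Sum>i\<le>D. (f i * \<iota> (b ^ (i * j))) * (\<iota> b * x) ^ i)"
    by (simp add: lam.\<iota>_sum lam.\<iota>_mult lam.\<iota>_power lam(2) lam_F1[OF assms] lam_const)
  also have "\<dots> = (\<Sum>i\<le>D. (f i * \<iota> (b ^ (i * Suc j))) * x ^ i)"
    by (rule sum.cong) (simp_all add: power_mult_distrib power_add \<iota>_mult \<iota>_power mult_ac)
  finally show ?case .
qed simp

lemma lam_iter_in_S: "v \<in> S \<Longrightarrow> (lam ^^ j) v \<in> S"
proof (elim adj_ring_elem)
  fix D f assume f: "\<And>i. f i \<in> F\<^sub>1" and v: "v = (\<Sum>i\<le>D. f i * x ^ i)"
  show "(lam ^^ j) v \<in> S"
    unfolding v lam_iter_S[of f, OF f] using F1_sub_S f const_F1 adj_ring_mem[OF F1_ring, of x]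
    by (intro subring_sum subring_mult subring_power S_ring) auto
qed

lemma lam_iter_m: "v \<in> S \<Longrightarrow> (lam ^^ m) v = v"
proof (elim adj_ring_elem)
  fix D f assume f: "\<And>i. f i \<in> F\<^sub>1" and v: "v = (\<Sum>i\<le>D. f i * x ^ i)"
  have "b ^ (i * m) = 1" for i by (rule b_power_dvd) simp
  then show "(lam ^^ m) v = v" unfolding v lam_iter_S[of f, OF f] by simp
qed

lemma of_nat_m: "of_nat m \<noteq> (0 :: 'k)"
  by (rule of_nat_dvd_card_neq_0) (unfold card_k, rule m(2))

lemma sum_b_powers: "(\<Sum>j<m. b ^ (i * j)) = (if m dvd i then of_nat m else 0)"
proof (cases "m dvd i")
  case True
  then have "b ^ i = 1" by (rule b_power_dvd)
  then show ?thesis using True by (simp add: power_mult)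
next
  case False
  have "(b ^ i) ^ m = (b ^ m) ^ i" by (simp only: power_mult[symmetric] mult.commute)
  then have "(b ^ i) ^ m = 1" using b_power by simp
  moreover have "b ^ i \<noteq> 1" using False b_power_mod by blast
  ultimately have "(\<Sum>j<m. (b ^ i) ^ j) = 0" by (simp add: geometric_sum)
  then show ?thesis using False by (simp add: power_mult)
qed

text \<open>Averaging over the powers of \<open>lam\<close> kills all monomials \<open>x^i\<close> with \<open>i\<close> not divisible by \<open>m\<close>.\<close>

lemma lam_fixed_in_F1:
  assumes v: "v \<in> S" "lam v = v"
  shows "v \<in> F\<^sub>1"
proof -
  obtain D f where f: "\<And>i. f i \<in> F\<^sub>1" and vf: "v = (\<Sum>i\<le>D. f i * x ^ i)" by (rule adj_ring_elem[OF v(1)]) blast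
  have fixed: "(lam ^^ j) v = v" for j by (induction j) (use v(2) in auto)
  have "\<iota> (of_nat m) * v = (\<Sum>j<m. (lam ^^ j) v)" unfolding fixed by (simp add: \<iota>_of_nat)
  also have "\<dots> = (\<Sum>j<m. \<Sum>i\<le>D. (f i * \<iota> (b ^ (i * j))) * x ^ i)"
    unfolding vf lam_iter_S[of f, OF f] ..
  also have "\<dots> = (\<Sum>i\<le>D. \<Sum>j<m. (f i * \<iota> (b ^ (i * j))) * x ^ i)" by (rule sum.swap)
  also have "\<dots> = (\<Sum>i\<le>D. f i * \<iota> (\<Sum>j<m. b ^ (i * j)) * x ^ i)"
    unfolding \<iota>_sum sum_distrib_left sum_distrib_right ..
  also have "\<dots> = (\<Sum>i\<le>D. if m dvd i then f i * \<iota> (of_nat m) * x ^ i else 0)"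
    by (rule sum.cong) (auto simp: sum_b_powers)
  also have "\<dots> \<in> F\<^sub>1"
  proof (rule subring_sum[OF F1_ring])
    fix i
    show "(if m dvd i then f i * \<iota> (of_nat m) * x ^ i else 0) \<in> F\<^sub>1"
    proof (cases "m dvd i")
      case True
      then obtain l where "i = m * l" by (elim dvdE)
      then have "x ^ i \<in> F\<^sub>1" using subring_power[OF F1_ring x_power_m] by (simp add: power_mult)
      then show ?thesis using True f const_F1 by (simp add: subring_mult F1_ring)
    qed (simp add: subring_0 F1_ring)
  qed
  finally have "\<iota> (of_nat m) * v \<in> F\<^sub>1" .
  from subfield_divide[OF F1_field this const_F1[of "of_nat m"]]
  show ?thesis using of_nat_m by simp
qed

lemma fractions: "\<exists>A\<in>S. \<exists>B\<in>S. B \<noteq> 0 \<and> z = A / B"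
proof -
  let ?Q = "{z. \<exists>A\<in>S. \<exists>B\<in>S. B \<noteq> 0 \<and> z = A / B}"
  have SQ: "S \<subseteq> ?Q"
  proof
    fix v assume "v \<in> S"
    then show "v \<in> ?Q" using subring_1[OF S_ring] by (intro CollectI bexI[of _ v] bexI[of _ 1]) auto
  qed
  have "is_subfield ?Q"
    unfolding is_subfield_def
  proof (intro conjI ballI)
    show "1 \<in> ?Q" using SQ subring_1[OF S_ring] by blast
    fix u assume u: "u \<in> ?Q"
    then obtain A B where AB: "A \<in> S" "B \<in> S" "B \<noteq> 0" "u = A / B" by blast
    show "inverse u \<in> ?Q"
    proof (cases "A = 0")
      case True
      then show ?thesis using AB u by simp
    next
      case False
      then show ?thesis using AB by (intro CollectI bexI[of _ B] bexI[of _ A]) auto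
    qed
    fix v assume "v \<in> ?Q"
    then obtain C D where CD: "C \<in> S" "D \<in> S" "D \<noteq> 0" "v = C / D" by blast
    have "u - v = (A * D - C * B) / (B * D)" using AB CD by (simp add: diff_frac_eq)
    moreover have "A * D - C * B \<in> S" "B * D \<in> S"
      using AB CD by (auto intro!: subring_diff subring_mult S_ring)
    ultimately show "u - v \<in> ?Q" using AB CD by (intro CollectI bexI[of _ "A * D - C * B"] bexI[of _ "B * D"]) auto
    have "u * v = (A * C) / (B * D)" using AB CD by simp
    moreover have "A * C \<in> S" using AB CD by (auto intro!: subring_mult S_ring)
    ultimately show "u * v \<in> ?Q" using \<open>B * D \<in> S\<close> AB CD
      by (intro CollectI bexI[of _ "A * C"] bexI[of _ "B * D"]) auto
  qed
  moreover have "range \<iota> \<subseteq> ?Q" using SQ F1_sub_S adjoin_const by blast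
  moreover have "{x, y} \<subseteq> ?Q" using SQ y_in_S adj_ring_mem[OF F1_ring, of x] by blast
  ultimately have "adjoin \<iota> {x, y} \<subseteq> ?Q" by (rule adjoin_least)
  then show ?thesis unfolding gen by blast
qed

text \<open>Multiplying numerator and denominator by the other conjugates of the denominator turns
  the denominator into a norm, fixed by \<open>lam\<close>. Then the numerator is fixed as well, and
  both lie in \<open>S\<close>.\<close>

lemma lam_fixed_F1:
  assumes z: "lam z = z"
  shows "z \<in> F\<^sub>1"
proof -
  obtain A B where AB: "A \<in> S" "B \<in> S" "B \<noteq> 0" "z = A / B" using fractions by blast
  define B' where "B' = (\<Prod>j\<in>{1..<m}. (lam ^^ j) B)"
  have iter0: "(lam ^^ j) B \<noteq> 0" for j by (induction j) (use AB(3) in auto)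
  have B'S: "B' \<in> S" unfolding B'_def using lam_iter_in_S[OF AB(2)] by (intro subring_prod S_ring)
  have "{..<m} = insert 0 {1..<m}" using m(1) by auto
  then have norm: "(\<Prod>j<m. (lam ^^ j) B) = B * B'" by (simp add: B'_def)
  \<comment> \<open>\<open>lam\<close> shifts the factors cyclically, as its m-th iterate is the
    identity on \<open>S\<close>.\<close>
  have "lam (\<Prod>j<m. (lam ^^ j) B) = (\<Prod>j<m. (lam ^^ Suc j) B)" by (simp add: lam.\<iota>_prod)
  also have "\<dots> = (\<Prod>j\<in>{1..<Suc m}. (lam ^^ j) B)"
    by (rule prod.reindex_bij_witness[of _ "\<lambda>j. j - 1" Suc]) auto
  also have "{1..<Suc m} = insert m {1..<m}" using m(1) by auto
  also have "(\<Prod>j\<in>insert m {1..<m}. (lam ^^ j) B) = B * B'"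
    by (simp add: B'_def lam_iter_m[OF AB(2)])
  finally have fixN: "lam (B * B') = B * B'" unfolding norm .
  have BB: "B * B' \<in> F\<^sub>1" by (rule lam_fixed_in_F1[OF subring_mult[OF S_ring AB(2) B'S] fixN])
  have "B' \<noteq> 0" unfolding B'_def using iter0 by simp
  have eq: "A * B' = z * (B * B')" using AB by simp
  have "A * B' \<in> S" by (rule subring_mult[OF S_ring AB(1) B'S])
  then have "z * (B * B') \<in> S" unfolding eq .
  moreover have "lam (z * (B * B')) = z * (B * B')" unfolding lam.\<iota>_mult[of z] z fixN ..
  ultimately have "z * (B * B') \<in> F\<^sub>1" by (rule lam_fixed_in_F1)
  from subfield_divide[OF F1_field this BB] show ?thesis using AB(3) \<open>B' \<noteq> 0\<close> by simp
qed

section \<open>The fixed field of the whole group\<close>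

lemma \<omega>_lin: "a \<in> F\<^sub>0 \<Longrightarrow> c \<in> F\<^sub>0 \<Longrightarrow> \<omega> (a + c * Y) = a + c * inverse Y"
proof -
  interpret w: field_embedding \<omega> by unfold_locales (rule \<omega>_hom)
  show "a \<in> F\<^sub>0 \<Longrightarrow> c \<in> F\<^sub>0 \<Longrightarrow> ?thesis" by (simp add: w.\<iota>_add w.\<iota>_mult \<omega>_F0 \<omega>_Y)
qed

text \<open>\<open>Y\<close> is a root of T^2 - P T + 1 over \<open>F\<^sub>0\<close>, so the span
  of 1 and \<open>Y\<close> is a ring; inverses come from the norm, the product of \<open>u\<close>
  with its image under \<open>\<omega>\<close>.\<close>

lemma F1_lin:
  assumes "z \<in> F\<^sub>1"
  shows "\<exists>a\<in>F\<^sub>0. \<exists>c\<in>F\<^sub>0. z = a + c * Y"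
proof -
  interpret w: field_embedding \<omega> by unfold_locales (rule \<omega>_hom)
  let ?T = "{a + c * Y | a c. a \<in> F\<^sub>0 \<and> c \<in> F\<^sub>0}"
  have TI: "a + c * Y \<in> ?T" if "a \<in> F\<^sub>0" "c \<in> F\<^sub>0" for a c using that by blast
  have YY: "Y * Y = P * Y - 1" using Y_neq_0 by (simp add: P_def algebra_simps)
  have iY: "inverse Y = P - Y" by (simp add: P_def)
  note F0 = subring_diff[OF F0_ring] subring_add[OF F0_ring] subring_mult[OF F0_ring]
    subring_0[OF F0_ring] subring_1[OF F0_ring] subfield_divide[OF F0_field] P_F0
  have "is_subfield ?T"
    unfolding is_subfield_def
  proof (intro conjI ballI)
    show "1 \<in> ?T" using TI[of 1 0] F0 by simp
    fix u assume "u \<in> ?T"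
    then obtain a c where u: "u = a + c * Y" "a \<in> F\<^sub>0" "c \<in> F\<^sub>0" by blast
    show "inverse u \<in> ?T"
    proof (cases "u = 0")
      case True
      then show ?thesis using TI[of 0 0] F0 by simp
    next
      case False
      let ?M = "a * a + a * c * P + c * c"
      have M: "u * (a + c * inverse Y) = ?M"
        unfolding u(1) P_def using Y_neq_0 by (simp add: algebra_simps)
      have nz: "a + c * inverse Y \<noteq> 0"
        using False \<omega>_lin[OF u(2,3)] w.\<iota>_eq_0_iff[of u] u(1) by simp
      have "inverse u = e / (u * e)" if "e \<noteq> 0" for e
        using False that by (simp add: field_simps)
      from this[OF nz] have "inverse u = (a + c * inverse Y) / ?M" unfolding M .
      also have "\<dots> = (a + c * P) / ?M + (- c / ?M) * Y"
        unfolding iY by (simp add: add_divide_distrib diff_divide_distrib algebra_simps)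
      also have "\<dots> \<in> ?T" using u(2,3) F0 by (intro TI) (auto intro: subring_uminus[OF F0_ring])
      finally show ?thesis .
    qed
    fix v assume "v \<in> ?T"
    then obtain e g where v: "v = e + g * Y" "e \<in> F\<^sub>0" "g \<in> F\<^sub>0" by blast
    have "u - v = (a - e) + (c - g) * Y" unfolding u v by (simp add: algebra_simps)
    also have "\<dots> \<in> ?T" using u v F0 by (intro TI) auto
    finally show "u - v \<in> ?T" .
    have "u * v = a * e + (a * g + c * e) * Y + c * g * (Y * Y)" unfolding u v by (simp add: algebra_simps)
    also have "\<dots> = (a * e - c * g) + (a * g + c * e + c * g * P) * Y"
      unfolding YY by (simp add: algebra_simps)
    also have "\<dots> \<in> ?T" using u v F0 by (intro TI) auto
    finally show "u * v \<in> ?T" .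
  qed
  moreover have F0T: "F\<^sub>0 \<subseteq> ?T" using TI[of _ 0] F0 by auto
  then have "range \<iota> \<subseteq> ?T" using adjoin_const by blast
  moreover have "U \<in> ?T" using F0T U_F0 by blast
  moreover have "Y \<in> ?T" using TI[of 0 1] F0 by simp
  ultimately have "F\<^sub>1 \<subseteq> ?T" by (intro adjoin_least) auto
  then show ?thesis using assms by blast
qed

lemma fixed_field_eq: "fixed_field (generate (aut_group \<iota>) {lam, \<omega>}) = F\<^sub>0"
proof
  show "fixed_field (generate (aut_group \<iota>) {lam, \<omega>}) \<subseteq> F\<^sub>0"
  proof
    fix z assume "z \<in> fixed_field (generate (aut_group \<iota>) {lam, \<omega>})"
    then have z: "lam z = z" "\<omega> z = z" unfolding fixed_field_def by (auto intro: generate.incl)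
    obtain a c where ac: "a \<in> F\<^sub>0" "c \<in> F\<^sub>0" "z = a + c * Y"
      using F1_lin[OF lam_fixed_F1[OF z(1)]] by blast
    have "a + c * inverse Y = a + c * Y" using z(2) \<omega>_lin[OF ac(1,2)] ac(3) by simp
    then have "c * inverse Y = c * Y" by simp
    \<comment> \<open>In characteristic 2 the two equal terms cancel, leaving c P = 0 with
      \<open>P\<close> nonzero.\<close>
    then have "c * (inverse Y + Y) = c * Y + c * Y" by (simp add: distrib_left)
    then have "c * P = 0" unfolding add_self by (simp add: P_def add.commute)
    moreover have "P \<noteq> 0"
      using transcendental_extension.P_neq_0[OF kummer_curve.axioms(1)[OF kummer]] .
    ultimately show "z \<in> F\<^sub>0" using ac by simp
  qed
  show "F\<^sub>0 \<subseteq> fixed_field (generate (aut_group \<iota>) {lam, \<omega>})"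
    unfolding fixed_field_def
  proof (intro subsetI CollectI ballI)
    fix z \<sigma> assume z: "z \<in> F\<^sub>0" and \<sigma>: "\<sigma> \<in> generate (aut_group \<iota>) {lam, \<omega>}"
    show "\<sigma> z = z"
    proof (rule generate_fixes[OF _ _ \<sigma>])
      fix h assume "h \<in> {lam, \<omega>}"
      then show "h z = z" using \<omega>_F0[OF z] lam_F1 z F0_sub_F1 by auto
    qed (use lam(1) \<omega>(1) in auto)
  qed
qed

theorem genus_fixed_field:
  "real_of_int (genus \<iota> (fixed_field (generate (aut_group \<iota>) {lam, \<omega>}))) =
    (real q ^ 2 - real q + real m - (real d - 1) * (real q - 1) - real d' * (real q + 1))
      / (4 * real m)"
proof -
  interpret K: kummer_curve \<iota> P U Z N by (rule kummer)
  have g: "genus \<iota> (fixed_field (generate (aut_group \<iota>) {lam, \<omega>})) = int K.\<gamma>"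
    unfolding fixed_field_eq by (rule K.genus_eq)
  have "even ((N - 1) * card Z)" using K.N_odd by simp
  then have "2 * K.\<gamma> = (N - 1) * card Z" by (simp add: K.\<gamma>_def)
  then have "2 * real K.\<gamma> = real (N - 1) * real (card Z)" by (metis of_nat_mult of_nat_numeral)
  then have \<gamma>: "2 * real K.\<gamma> = (real N - 1) * real (card Z)" using pos(3) by (simp add: of_nat_diff)
  have "real (q + 1) = real (d * N)" using dN by simp
  then have q1: "real q = real d * real N - 1" by simp
  have "real (q - 1) = real (d' * n)" using d'n by simp
  then have q2: "real q - 1 = real d' * real n" using q_pos by (simp add: of_nat_diff)
  have rm: "real m = real d * real d'" by (simp add: m_eq)
  \<comment> \<open>With d N = q + 1, d' n = q - 1 and m = d d' the numerator factors as m (N - 1)(n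
    - 1), and n - 1 is twice the cardinality of \<open>Z\<close>.\<close>
  have "real q ^ 2 - real q + real m - (real d - 1) * (real q - 1) - real d' * (real q + 1)
    = (real q + 1) * (real q - 1) + real m - real d * (real q - 1) - real d' * (real q + 1)"
    by (simp add: power2_eq_square algebra_simps)
  also have "\<dots> = real m * ((real N - 1) * (real n - 1))"
    unfolding q2 using q1 by (simp add: rm algebra_simps)
  also have "\<dots> = 4 * real m * real K.\<gamma>"
    using \<gamma> by (simp add: n_eq)
  finally show ?thesis unfolding g using m(1) by simp
qed

end

theorem theorem3p2:
  fixes \<iota> :: "'k::{field,finite} \<Rightarrow> 'h::field"
    and x y :: 'h and b :: 'k and q r m d d' :: nat
    and lam \<omega> :: "'h \<Rightarrow> 'h" and G :: "('h \<Rightarrow> 'h) set"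
  assumes "0 < r" and "q = 2 ^ r"
    and "hermitian_function_field q \<iota> x y"
    and "0 < m" and "m dvd q^2 - 1"
    and "b \<noteq> 0" and "m = (LEAST k. 0 < k \<and> b ^ k = 1)"
    and "lam \<in> carrier (aut_group \<iota>)"
    and "lam x = \<iota> b * x" and "lam y = \<iota> b ^ (q + 1) * y"
    and "\<omega> \<in> carrier (aut_group \<iota>)"
    and "\<omega> x = x / y" and "\<omega> y = 1 / y"
    and "G = generate (aut_group \<iota>) {lam, \<omega>}"
    and "d = gcd m (q + 1)" and "d' = gcd m (q - 1)"
  shows "real_of_int (genus \<iota> (fixed_field G)) =
    (real q ^ 2 - real q + real m - (real d - 1) * (real q - 1) - real d' * (real q + 1))
      / (4 * real m)"
proof -
  interpret hermitian_quotient \<iota> x y b q r m d d' lam \<omega>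
    by unfold_locales fact+
  show ?thesis unfolding \<open>G = generate (aut_group \<iota>) {lam, \<omega>}\<close> by (rule genus_fixed_field)
qed

end
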